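(* Let $\lambda^{(1)}/\mu^{(1)},\dots,\lambda^{(n)}/\mu^{(n)}$ be $n$ skew shapes, let $\lambda=\bigcup_i\lambda^{(i)}$ be the partition obtained by arranging all parts of all $\lambda^{(i)}$ in weakly decreasing order, and similarly let $\mu=\bigcup_i\mu^{(i)}$. Then $$\prod_{i=1}^n s_{\lambda^{[i,n]}/\mu^{[i,n]}} - \prod_{i=1}^n s_{\lambda^{(i)}/\mu^{(i)}}$$ is Schur nonnegative.
   Context: A skew shape $\lambda/\mu$ is a pair of partitions (padded with zeros) with $\mu_i\le\lambda_i$ for all $i$; $s_{\lambda/\mu}$ is the skew Schur function. For a partition $\lambda$ and $1\le i\le n$, $\lambda^{[i,n]}:=(\lambda_i,\lambda_{i+n},\lambda_{i+2n},\dots)$. A symmetric function is Schur nonnegative if it is a nonnegative linear combination of Schur functions. *)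

theory Defs
  imports "HOL-Library.Multiset" "HOL-Library.FuncSet"
begin

text \<open>
  Formal power series with integer coefficients in countably many commuting variables
  \<open>x\<^sub>0, x\<^sub>1, x\<^sub>2, \<dots>\<close>. A monomial is the finite multiset of the indices of its variables,
  counted with exponents, so multiplying monomials is adding multisets.
  The ring of symmetric functions over the integers is a subring.
\<close>

typedef series = "UNIV :: (nat multiset \<Rightarrow> int) set"
  morphisms series_coeff Abs_series
  by simp

lemma series_coeff_Abs [simp]: "series_coeff (Abs_series f) = f"
  by (simp add: Abs_series_inverse)

lemma series_eqI: "(\<And>m. series_coeff f m = series_coeff g m) \<Longrightarrow> f = g"
  by (metis ext series_coeff_inject)

lemma finite_submultisets: "finite {a. a \<subseteq># (m :: 'a multiset)}"
proof (rule finite_subset)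
  show "{a. a \<subseteq># m} \<subseteq> mset ` {xs. set xs \<subseteq> set_mset m \<and> length xs \<le> size m}"
  proof
    fix a assume "a \<in> {a. a \<subseteq># m}"
    moreover obtain xs where "a = mset xs" by (metis ex_mset)
    ultimately show "a \<in> mset ` {xs. set xs \<subseteq> set_mset m \<and> length xs \<le> size m}"
      using set_mset_mono size_mset_mono by fastforce
  qed
qed (simp add: finite_lists_length_le)

lemma finite_multiset_splits: "finite {(a, b). a + b = (m :: 'a multiset)}"
  by (rule finite_subset[OF _ finite_cartesian_product[OF finite_submultisets finite_submultisets],
        of _ m m]) auto

instantiation series :: comm_ring_1
begin

definition "0 = Abs_series (\<lambda>m. 0)"
definition "1 = Abs_series (\<lambda>m. if m = {#} then 1 else 0)"
definition "f + g = Abs_series (\<lambda>m. series_coeff f m + series_coeff g m)"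
definition "- f = Abs_series (\<lambda>m. - series_coeff f m)"
definition "f - g = Abs_series (\<lambda>m. series_coeff f m - series_coeff g m)"
definition "f * g =
  Abs_series (\<lambda>m. \<Sum>(a, b) \<in> {(a, b). a + b = m}. series_coeff f a * series_coeff g b)"

instance
proof
  fix f g h :: series
  note defs = zero_series_def one_series_def plus_series_def uminus_series_def
    minus_series_def times_series_def
  show "f + g + h = f + (g + h)" "f + g = g + f" "0 + f = f" "- f + f = 0" "f - g = f + - g"
    by (auto intro!: series_eqI simp: defs)
  show "(0 :: series) \<noteq> 1"
  proof
    assume "(0 :: series) = 1"
    then have "series_coeff 0 {#} = series_coeff 1 {#}" by simp
    then show False by (simp add: defs)
  qed
  show "(f + g) * h = f * h + g * h"
    by (auto intro!: series_eqI simp: defs split_def distrib_right sum.distrib)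
  show "f * g = g * f"
  proof (rule series_eqI)
    fix m
    show "series_coeff (f * g) m = series_coeff (g * f) m"
      unfolding defs series_coeff_Abs
      by (rule sum.reindex_bij_witness[where i = "\<lambda>(a, b). (b, a)" and j = "\<lambda>(a, b). (b, a)"])
        (auto simp: add.commute)
  qed
  show "1 * f = f"
  proof (rule series_eqI)
    fix m
    have "series_coeff (1 * f) m =
        (\<Sum>(a, b) \<in> {(a, b). a + b = m}. (if a = {#} then 1 else 0) * series_coeff f b)"
      by (simp add: defs)
    also have "\<dots> = (\<Sum>(a, b) \<in> {({#} :: nat multiset, m)}.
        (if a = {#} then 1 else 0) * series_coeff f b)"
      by (rule sum.mono_neutral_right) (auto simp: finite_multiset_splits split: if_splits)
    finally show "series_coeff (1 * f) m = series_coeff f m" by simp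
  qed
  show "f * g * h = f * (g * h)"
  proof (rule series_eqI)
    fix m
    let ?t = "\<lambda>a b c. series_coeff f a * series_coeff g b * series_coeff h c"
    have "series_coeff (f * g * h) m = (\<Sum>p \<in> {(d, c). d + c = m}.
        \<Sum>q \<in> {(a, b). a + b = fst p}. ?t (fst q) (snd q) (snd p))"
      by (simp add: defs split_def sum_distrib_right)
    also have "\<dots> = (\<Sum>(p, q) \<in> (SIGMA p : {(d, c). d + c = m}. {(a, b). a + b = fst p}).
        ?t (fst q) (snd q) (snd p))"
      by (rule sum.Sigma) (auto simp: finite_multiset_splits)
    also have "\<dots> = (\<Sum>(p, q) \<in> (SIGMA p : {(a, e). a + e = m}. {(b, c). b + c = snd p}).
        ?t (fst p) (fst q) (snd q))"
      by (rule sum.reindex_bij_witness[where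
            j = "\<lambda>((d, c), (a, b)). ((a, b + c), (b, c))" and
            i = "\<lambda>((a, e), (b, c)). ((a + b, c), (a, b))"]) (auto simp: add.assoc)
    also have "\<dots> = (\<Sum>p \<in> {(a, e). a + e = m}.
        \<Sum>q \<in> {(b, c). b + c = snd p}. ?t (fst p) (fst q) (snd q))"
      by (rule sum.Sigma[symmetric]) (auto simp: finite_multiset_splits)
    also have "\<dots> = series_coeff (f * (g * h)) m"
      by (simp add: defs split_def sum_distrib_left mult.assoc)
    finally show "series_coeff (f * g * h) m = series_coeff (f * (g * h)) m" .
  qed
qed

end

text \<open>
  Partitions are weakly decreasing sequences padded with infinitely many zeros. Indexing starts
  at 0: the value at \<open>j\<close> is the part usually written with subscript \<open>j + 1\<close>.
\<close>

definition is_partition :: "(nat \<Rightarrow> nat) \<Rightarrow> bool" where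
  "is_partition lam \<longleftrightarrow> antimono lam \<and> finite {j. lam j \<noteq> 0}"

definition skew_shape :: "(nat \<Rightarrow> nat) \<Rightarrow> (nat \<Rightarrow> nat) \<Rightarrow> bool" where
  "skew_shape lam mu \<longleftrightarrow> is_partition lam \<and> is_partition mu \<and> (\<forall>j. mu j \<le> lam j)"

text \<open>Cells \<open>(r, c)\<close> in matrix coordinates, both counted from 0.\<close>

definition skew_cells :: "(nat \<Rightarrow> nat) \<Rightarrow> (nat \<Rightarrow> nat) \<Rightarrow> (nat \<times> nat) set" where
  "skew_cells lam mu = {(r, c). mu r \<le> c \<and> c < lam r}"

definition ssyt :: "(nat \<Rightarrow> nat) \<Rightarrow> (nat \<Rightarrow> nat) \<Rightarrow> (nat \<times> nat \<Rightarrow> nat) set" where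
  "ssyt lam mu = {T \<in> skew_cells lam mu \<rightarrow>\<^sub>E UNIV.
     (\<forall>r c c'. (r, c) \<in> skew_cells lam mu \<and> (r, c') \<in> skew_cells lam mu \<and> c < c' \<longrightarrow>
        T (r, c) \<le> T (r, c')) \<and>
     (\<forall>r r' c. (r, c) \<in> skew_cells lam mu \<and> (r', c) \<in> skew_cells lam mu \<and> r < r' \<longrightarrow>
        T (r, c) < T (r', c))}"

definition tableau_weight ::
  "(nat \<Rightarrow> nat) \<Rightarrow> (nat \<Rightarrow> nat) \<Rightarrow> (nat \<times> nat \<Rightarrow> nat) \<Rightarrow> nat multiset" where
  "tableau_weight lam mu T = image_mset T (mset_set (skew_cells lam mu))"

definition skew_schur :: "(nat \<Rightarrow> nat) \<Rightarrow> (nat \<Rightarrow> nat) \<Rightarrow> series" where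
  "skew_schur lam mu = Abs_series (\<lambda>m. int (card {T \<in> ssyt lam mu. tableau_weight lam mu T = m}))"

lemma finite_skew_cells:
  assumes "is_partition lam"
  shows "finite (skew_cells lam mu)"
proof (rule finite_subset)
  show "skew_cells lam mu \<subseteq> (SIGMA r : {j. lam j \<noteq> 0}. {..<lam r})"
    by (auto simp: skew_cells_def)
  show "finite (SIGMA r : {j. lam j \<noteq> 0}. {..<lam r})"
    using assms by (auto simp: is_partition_def)
qed

text \<open>The cardinality in the definition of \<open>skew_schur\<close> is that of a finite set.\<close>

lemma finite_ssyt_weight:
  assumes "is_partition lam"
  shows "finite {T \<in> ssyt lam mu. tableau_weight lam mu T = m}"
proof (rule finite_subset)
  show "{T \<in> ssyt lam mu. tableau_weight lam mu T = m} \<subseteq> skew_cells lam mu \<rightarrow>\<^sub>E set_mset m"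
    using finite_skew_cells[OF assms, of mu]
    by (auto simp: ssyt_def tableau_weight_def PiE_iff extensional_def)
  show "finite (skew_cells lam mu \<rightarrow>\<^sub>E set_mset m)"
    by (intro finite_PiE finite_skew_cells[OF assms]) simp
qed

definition schur :: "(nat \<Rightarrow> nat) \<Rightarrow> series" where
  "schur nu = skew_schur nu (\<lambda>_. 0)"

definition schur_nonneg :: "series \<Rightarrow> bool" where
  "schur_nonneg f \<longleftrightarrow> (\<exists>P (c :: (nat \<Rightarrow> nat) \<Rightarrow> int).
     finite P \<and> (\<forall>nu \<in> P. is_partition nu \<and> c nu \<ge> 0) \<and>
     f = (\<Sum>nu \<in> P. of_int (c nu) * schur nu))"

definition parts :: "(nat \<Rightarrow> nat) \<Rightarrow> nat multiset" where
  "parts lam = image_mset lam (mset_set {j. lam j \<noteq> 0})"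

definition partition_of_parts :: "nat multiset \<Rightarrow> nat \<Rightarrow> nat" where
  "partition_of_parts M j =
     (let xs = rev (sorted_list_of_multiset M) in if j < length xs then xs ! j else 0)"

definition partition_union :: "nat \<Rightarrow> (nat \<Rightarrow> nat \<Rightarrow> nat) \<Rightarrow> nat \<Rightarrow> nat" where
  "partition_union n lams = partition_of_parts (\<Sum>i<n. parts (lams i))"

text \<open>
  With 0-based indices, \<open>every_nth lam i n\<close> for \<open>i < n\<close> is the partition written
  \<open>lam\<close> with superscript \<open>[i + 1, n]\<close>, whose parts have the (1-based) subscripts
  \<open>i + 1, i + 1 + n, i + 1 + 2n, \<dots>\<close>.
\<close>

definition every_nth :: "(nat \<Rightarrow> nat) \<Rightarrow> nat \<Rightarrow> nat \<Rightarrow> (nat \<Rightarrow> nat)" where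
  "every_nth lam i n = (\<lambda>j. lam (i + j * n))"

end

theory Submission
  imports Defs "HOL-Combinatorics.Permutations"
begin

text \<open>
  A tableau is encoded by the chain of partitions \<open>g t\<close> filled by its entries below \<open>t\<close>. Given two
  skew shapes drawn in the same coordinates, read the cells of both tableaux by columns from right
  to left, from top to bottom, and with the first tableau first at a common position. Applying a
  Bender--Knuth involution to the unread cells at the first violation of the lattice condition
  shows that the coefficient of \<open>s\<^sub>\<nu>\<close> in the product of the two skew Schur functions is the
  number of pairs of weight \<open>\<nu>\<close> satisfying the lattice condition.

  Passing to the shapes given by the row-wise maxima and minima, a pair of tableaux is transformed
  by exchanging entries along the connected components attached to the rows where the two shapes
  have to be exchanged. This is injective, and it only replaces adjacent letters \<open>b a\<close> with
  \<open>a < b\<close> by \<open>a b\<close> in the reading word, so the lattice condition persists. Hence replacing two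
  shapes by their maximum and minimum, possibly after shifting one of them by a row, can only
  increase the product in the Schur order, and such moves sort the merged sequence of all parts.
\<close>

section \<open>Bender--Knuth moves on chains of partitions\<close>

text \<open>On chains the tableau conditions become inequalities between neighbouring integers: the
  two inequalities below say that consecutive shapes differ by a horizontal strip. A Bender--Knuth
  move then changes a single layer \<open>g (Suc k)\<close>, and two tableaux of different shapes
  can be exchanged node by node. The obstacle is to exchange in a way that respects a condition
  counting Schur multiplicities. Interleaving the two tableaux row by row within a common column is
  chosen for this: an exchange is then visible only to prefixes that stop between the two colours of
  one row. The multiplicities are extracted by alternating sums over exponent vectors, which
  determine a symmetric series.

  Maximum and minimum in equal rows compare the positions \<open>i + r n\<close> and
  \<open>i' + r n\<close> of the merged sequence, where \<open>i < i' < n\<close>. The remaining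
  comparisons, of \<open>i' + r n\<close> with \<open>i + (r + 1) n\<close>, need one shape lowered
  by an empty row. The process ends because the sum of position times part drops with every
  effective move.\<close>

definition gt_chain :: "(nat \<Rightarrow> nat) \<Rightarrow> (nat \<Rightarrow> nat) \<Rightarrow> (nat \<Rightarrow> nat \<Rightarrow> nat) \<Rightarrow> bool" where
  "gt_chain lam mu g \<longleftrightarrow> g 0 = mu \<and> (\<exists>N. \<forall>t\<ge>N. g t = lam) \<and>
     (\<forall>t r. g t r \<le> g (Suc t) r \<and> g (Suc t) (Suc r) \<le> g t r)"

definition gt_weight :: "nat \<Rightarrow> (nat \<Rightarrow> nat \<Rightarrow> nat) \<Rightarrow> nat \<Rightarrow> nat" where
  "gt_weight R g t = (\<Sum>r<R. g (Suc t) r - g t r)"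

lemma gt_chain_step:
  assumes "gt_chain lam mu g"
  shows "g t r \<le> g (Suc t) r" "g (Suc t) (Suc r) \<le> g t r"
  using assms by (auto simp: gt_chain_def)

lemma gt_chain_mono: "gt_chain lam mu g \<Longrightarrow> s \<le> t \<Longrightarrow> g s r \<le> g t r"
  by (rule lift_Suc_mono_le[of "\<lambda>t. g t r"]) (auto simp: gt_chain_def)

lemma gt_chain_le_outer:
  assumes "gt_chain lam mu g" shows "g t r \<le> lam r"
proof -
  obtain N where "\<forall>t\<ge>N. g t = lam" using assms by (auto simp: gt_chain_def)
  then show ?thesis using gt_chain_mono[OF assms, of t "max t N" r] by simp
qed

lemma gt_chain_inner_le: "gt_chain lam mu g \<Longrightarrow> mu r \<le> g t r"
  using gt_chain_mono[of lam mu g 0 t r] by (simp add: gt_chain_def)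

lemma gt_chain_antimono: "gt_chain lam mu g \<Longrightarrow> antimono (g t)"
  unfolding antimono_iff_le_Suc using gt_chain_step le_trans by metis

lemma gt_chain_strip: "gt_chain lam mu g \<Longrightarrow> a < b \<Longrightarrow> g (Suc t) b \<le> g t a"
  using gt_chain_antimono[of lam mu g "Suc t"] gt_chain_step(2)[of lam mu g t a]
  by (metis Suc_leI antimonoD order_trans)

text \<open>
  The Bender--Knuth move on the entries \<open>k\<close>, \<open>k + 1\<close> of the cells lying, in each row \<open>r\<close>, to the
  left of column \<open>c r\<close>.
\<close>

definition bk_low :: "nat \<Rightarrow> (nat \<Rightarrow> nat \<Rightarrow> nat) \<Rightarrow> nat \<Rightarrow> nat" where
  "bk_low k g r = max (g k r) (g (Suc (Suc k)) (Suc r))"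

text \<open>An entry \<open>k\<close> of row \<open>r\<close> left of \<open>bk_low k g r\<close>
  has a \<open>k + 1\<close> below it; an entry \<open>k + 1\<close> from column
  \<open>bk_high k g r\<close> on has a \<open>k\<close> above it. The free entries lie in the
  columns between these bounds. Nothing stands above row 0, whence the case distinction.\<close>

definition bk_high :: "nat \<Rightarrow> (nat \<Rightarrow> nat \<Rightarrow> nat) \<Rightarrow> nat \<Rightarrow> nat" where
  "bk_high k g r =
     (case r of 0 \<Rightarrow> g (Suc (Suc k)) 0 | Suc r' \<Rightarrow> min (g (Suc (Suc k)) r) (g k r'))"

text \<open>The boundary between free \<open>k\<close> and free \<open>k + 1\<close> is reflected in
  the interval from \<open>bk_low k g r\<close> to \<open>min (bk_high k g r) (c r)\<close>, which
  interchanges their numbers. A row whose boundary lies right of the cut is left alone.\<close>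

definition bk_row :: "nat \<Rightarrow> (nat \<Rightarrow> nat) \<Rightarrow> (nat \<Rightarrow> nat \<Rightarrow> nat) \<Rightarrow> nat \<Rightarrow> nat" where
  "bk_row k c g r = (if g (Suc k) r \<le> c r
     then bk_low k g r + min (bk_high k g r) (c r) - g (Suc k) r else g (Suc k) r)"

definition bk :: "nat \<Rightarrow> (nat \<Rightarrow> nat) \<Rightarrow> (nat \<Rightarrow> nat \<Rightarrow> nat) \<Rightarrow> nat \<Rightarrow> nat \<Rightarrow> nat" where
  "bk k c g = g(Suc k := bk_row k c g)"

lemma bk_bounds:
  assumes "gt_chain lam mu g"
  shows "bk_low k g r \<le> g (Suc k) r" "g (Suc k) r \<le> bk_high k g r"
  using gt_chain_step[OF assms]
  by (auto simp: bk_low_def bk_high_def split: nat.split)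

lemma bk_row_bounds:
  assumes "gt_chain lam mu g"
  shows "bk_low k g r \<le> bk_row k c g r" "bk_row k c g r \<le> bk_high k g r"
  using bk_bounds[OF assms, of k r] by (auto simp: bk_row_def)

lemma bk_low_bk: "bk_low k (bk k c g) = bk_low k g"
  by (rule ext) (simp add: bk_low_def bk_def)

lemma bk_high_bk: "bk_high k (bk k c g) = bk_high k g"
  by (rule ext) (simp add: bk_high_def bk_def split: nat.split)

text \<open>The interval of reflection depends on the layers \<open>k\<close> and
  \<open>k + 2\<close> and on the cut, none of which is moved, and a reflected boundary is again at
  most \<open>c r\<close>.\<close>

lemma bk_bk:
  assumes "gt_chain lam mu g" shows "bk k c (bk k c g) = g"
proof -
  have "bk_row k c (bk k c g) r = g (Suc k) r" for r
    using bk_bounds[OF assms, of k r]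
    unfolding bk_row_def bk_low_bk bk_high_bk by (auto simp: bk_def bk_row_def)
  then have "bk_row k c (bk k c g) = g (Suc k)" by (rule ext)
  then show ?thesis unfolding bk_def[of k c "bk k c g"] by (simp add: bk_def)
qed

lemma bk_apply: "bk k c g (Suc k) = bk_row k c g" "t \<noteq> Suc k \<Longrightarrow> bk k c g t = g t"
  by (auto simp: bk_def)

lemma gt_chain_bk:
  assumes g: "gt_chain lam mu g" shows "gt_chain lam mu (bk k c g)"
proof -
  obtain N where N: "\<forall>t\<ge>N. g t = lam" using g by (auto simp: gt_chain_def)
  have b: "g k r \<le> bk_row k c g r" "g (Suc (Suc k)) (Suc r) \<le> bk_row k c g r"
    "bk_row k c g r \<le> g (Suc (Suc k)) r" "bk_row k c g (Suc r) \<le> g k r" for r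
    using bk_row_bounds[OF g, where k = k and c = c and r = r]
      bk_row_bounds(2)[OF g, where k = k and c = c and r = "Suc r"]
    by (auto simp: bk_low_def bk_high_def split: nat.splits)
  have "bk k c g t r \<le> bk k c g (Suc t) r \<and> bk k c g (Suc t) (Suc r) \<le> bk k c g t r" for t r
    using b gt_chain_step[OF g] by (auto simp: bk_def)
  moreover have "\<forall>t\<ge>max N (Suc (Suc k)). bk k c g t = lam"
    using N by (auto simp: bk_def)
  moreover have "bk k c g 0 = mu" using g by (simp add: bk_def gt_chain_def)
  ultimately show ?thesis unfolding gt_chain_def by blast
qed

text \<open>Only boundaries at most \<open>c r\<close> move, and they stay at most
  \<open>c r\<close>, so both truncated differences vanish. Everything right of the cut is thus
  preserved.\<close>

lemma bk_head: "c r \<le> c' \<Longrightarrow> bk k c g t r - c' = g t r - c'" if "gt_chain lam mu g"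
  using bk_bounds[OF that, of k r] by (auto simp: bk_def bk_row_def)

text \<open>
  By hypothesis \<open>free\<close>, a free \<open>k\<close> left of the cut is never followed by a \<open>k\<close> right of the cut in its
  row; by hypothesis \<open>split\<close>, the cut separates no vertical pair \<open>k\<close>, \<open>k + 1\<close>.
\<close>

lemma bk_row_sum:
  assumes g: "gt_chain lam mu g" and R: "\<forall>r\<ge>R. lam r = 0"
    and free: "\<And>r. \<not> (bk_low k g r < c r \<and> c r < g (Suc k) r)"
    and c: "\<And>r. c r \<le> c (Suc r)"
    and split: "\<And>r. c r < c (Suc r) \<Longrightarrow> g k r < c (Suc r) \<Longrightarrow> g (Suc (Suc k)) (Suc r) \<le> c r"
  shows "(\<Sum>r<R. min (bk_row k c g r) (c r) + min (g (Suc k) r) (c r)) =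
         (\<Sum>r<R. min (g (Suc (Suc k)) r) (c r) + min (g k r) (c r))"
proof -
  let ?l = "g (Suc (Suc k))" and ?m = "g k"
  have l0: "?l R = 0" using gt_chain_le_outer[OF g, of "Suc (Suc k)" R] R by simp
  have row: "min (bk_row k c g r) (c r) + min (g (Suc k) r) (c r) =
    min (bk_low k g r) (c r) + min (bk_high k g r) (c r)" for r
    using free[of r] bk_bounds[OF g, of k r] by (auto simp: bk_row_def min_def)
  \<comment> \<open>The low end of row \<open>r\<close> and the high end of row \<open>r + 1\<close>
    are the maximum and the minimum of the same two numbers. The hypothesis \<open>split\<close>
    keeps this true after truncation at two different cuts.\<close>
  have pair: "min (bk_low k g r) (c r) + min (bk_high k g (Suc r)) (c (Suc r)) =
    min (?m r) (c r) + min (?l (Suc r)) (c (Suc r))" for r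
  proof (cases "c r < c (Suc r) \<and> g k r < c (Suc r)")
    case True
    then show ?thesis using split[of r] by (auto simp: bk_low_def bk_high_def min_def max_def)
  next
    case False
    then have "c r = c (Suc r) \<or> c (Suc r) \<le> g k r" using c[of r] by auto
    then show ?thesis using c[of r] by (auto simp: bk_low_def bk_high_def min_def max_def)
  qed
  \<comment> \<open>Row \<open>R\<close> is empty, so the high ends can be summed with the row index
    shifted by one; row 0 contributes \<open>?l 0\<close>.\<close>
  have "bk_high k g R = 0" using l0 by (auto simp: bk_high_def split: nat.split)
  then have "(\<Sum>r<R. min (bk_high k g r) (c r)) = (\<Sum>r<Suc R. min (bk_high k g r) (c r))" by simp
  also have "\<dots> = min (?l 0) (c 0) + (\<Sum>r<R. min (bk_high k g (Suc r)) (c (Suc r)))"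
    by (subst sum.lessThan_Suc_shift) (simp add: bk_high_def)
  finally have high: "(\<Sum>r<R. min (bk_high k g r) (c r)) =
    min (?l 0) (c 0) + (\<Sum>r<R. min (bk_high k g (Suc r)) (c (Suc r)))" .
  have "(\<Sum>r<R. min (?l r) (c r)) = (\<Sum>r<Suc R. min (?l r) (c r))" using l0 by simp
  also have "\<dots> = min (?l 0) (c 0) + (\<Sum>r<R. min (?l (Suc r)) (c (Suc r)))"
    by (subst sum.lessThan_Suc_shift) simp
  finally have low: "(\<Sum>r<R. min (?l r) (c r)) =
    min (?l 0) (c 0) + (\<Sum>r<R. min (?l (Suc r)) (c (Suc r)))" .
  have "(\<Sum>r<R. min (bk_low k g r) (c r)) + (\<Sum>r<R. min (bk_high k g (Suc r)) (c (Suc r))) =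
    (\<Sum>r<R. min (?m r) (c r)) + (\<Sum>r<R. min (?l (Suc r)) (c (Suc r)))"
    unfolding sum.distrib[symmetric] pair ..
  then show ?thesis unfolding row unfolding sum.distrib high low by simp
qed

text \<open>
  For the cells right of the columns \<open>c r\<close>: the number of entries \<open>k\<close> minus the number of
  entries \<open>k + 1\<close>. The truncated difference \<open>g t r - c r\<close> counts the columns from \<open>c r\<close> on.
\<close>

definition excess :: "nat \<Rightarrow> (nat \<Rightarrow> nat \<Rightarrow> nat) \<Rightarrow> nat \<Rightarrow> (nat \<Rightarrow> nat) \<Rightarrow> int" where
  "excess R g k c = (\<Sum>r<R. 2 * int (g (Suc k) r - c r) - int (g k r - c r)
     - int (g (Suc (Suc k)) r - c r))"

lemma excess_bk_head:
  assumes "gt_chain lam mu g" "\<And>r. c r \<le> c' r"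
  shows "excess R (bk j c g) k c' = excess R g k c'"
  unfolding excess_def by (simp add: bk_head[where c = c, OF assms(1) assms(2)])

text \<open>Left of the cut the numbers of \<open>k\<close> and \<open>k + 1\<close> are
  interchanged, right of it nothing happens. Hence the new number of \<open>k\<close> is the old
  number of \<open>k + 1\<close> plus the excess right of the cut.\<close>

lemma bk_sum:
  assumes g: "gt_chain lam mu g" and R: "\<forall>r\<ge>R. lam r = 0"
    and free: "\<And>r. \<not> (bk_low k g r < c r \<and> c r < g (Suc k) r)"
    and c: "\<And>r. c r \<le> c (Suc r)"
    and split: "\<And>r. c r < c (Suc r) \<Longrightarrow> g k r < c (Suc r) \<Longrightarrow> g (Suc (Suc k)) (Suc r) \<le> c r"
  shows "int (\<Sum>r<R. bk_row k c g r) + int (\<Sum>r<R. g (Suc k) r) =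
         int (\<Sum>r<R. g (Suc (Suc k)) r) + int (\<Sum>r<R. g k r) + excess R g k c"
proof -
  have h: "bk_row k c g r - c r = g (Suc k) r - c r" for r
    using bk_head[OF g, of c r "c r" k "Suc k"] by (simp add: bk_apply)
  have dec: "int x = int (min x y) + int (x - y)" for x y :: nat by auto
  note s = bk_row_sum[OF g R free c split]
  have "int (\<Sum>r<R. bk_row k c g r) + int (\<Sum>r<R. g (Suc k) r) =
    (\<Sum>r<R. int (min (bk_row k c g r) (c r) + min (g (Suc k) r) (c r))) +
    (\<Sum>r<R. 2 * int (g (Suc k) r - c r))"
    unfolding of_nat_sum sum.distrib[symmetric]
  proof (rule sum.cong[OF refl])
    fix r
    show "int (bk_row k c g r) + int (g (Suc k) r) =
      int (min (bk_row k c g r) (c r) + min (g (Suc k) r) (c r)) + 2 * int (g (Suc k) r - c r)"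
      using dec[of "bk_row k c g r" "c r"] dec[of "g (Suc k) r" "c r"] h[of r] by simp
  qed
  also have "(\<Sum>r<R. int (min (bk_row k c g r) (c r) + min (g (Suc k) r) (c r))) =
    (\<Sum>r<R. int (min (g (Suc (Suc k)) r) (c r) + min (g k r) (c r)))"
    using s by (simp only: of_nat_sum[symmetric])
  also have "(\<Sum>r<R. int (min (g (Suc (Suc k)) r) (c r) + min (g k r) (c r))) +
     (\<Sum>r<R. 2 * int (g (Suc k) r - c r)) =
    int (\<Sum>r<R. g (Suc (Suc k)) r) + int (\<Sum>r<R. g k r) + excess R g k c"
    unfolding of_nat_sum excess_def sum.distrib[symmetric]
  proof (rule sum.cong[OF refl])
    fix r
    show "int (min (g (Suc (Suc k)) r) (c r) + min (g k r) (c r)) + 2 * int (g (Suc k) r - c r) =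
      int (g (Suc (Suc k)) r) + int (g k r) +
       (2 * int (g (Suc k) r - c r) - int (g k r - c r) - int (g (Suc (Suc k)) r - c r))"
      using dec[of "g k r" "c r"] dec[of "g (Suc (Suc k)) r" "c r"] by simp
  qed
  finally show ?thesis .
qed

section \<open>The reading order and the first violation\<close>

text \<open>
  Cells of two tableaux are read by columns from right to left and, in a column, from top to
  bottom, colour 0 before colour 1 in the same row. When \<open>s\<close> half rows of column \<open>j\<close> have been
  read, the unread cells of row \<open>r\<close> and colour \<open>i\<close> are those left of column \<open>cut_column i j s r\<close>.
\<close>

definition cut_column :: "nat \<Rightarrow> nat \<Rightarrow> nat \<Rightarrow> nat \<Rightarrow> nat" where
  "cut_column i j s r = (if 2 * r + i < s then j else Suc j)"

definition pair_excess ::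
  "nat \<Rightarrow> (nat \<Rightarrow> nat \<Rightarrow> nat) \<Rightarrow> (nat \<Rightarrow> nat \<Rightarrow> nat) \<Rightarrow> nat \<Rightarrow> nat \<Rightarrow> nat \<Rightarrow> int" where
  "pair_excess R g h k j s = excess R g k (cut_column 0 j s) + excess R h k (cut_column 1 j s)"

definition yamanouchi :: "nat \<Rightarrow> (nat \<Rightarrow> nat \<Rightarrow> nat) \<Rightarrow> (nat \<Rightarrow> nat \<Rightarrow> nat) \<Rightarrow> bool" where
  "yamanouchi R g h \<longleftrightarrow> (\<forall>k j s. 0 \<le> pair_excess R g h k j s)"

text \<open>For a chain, the contribution of the cell in row \<open>r\<close> and column
  \<open>j\<close> to the excess: 1 for an entry \<open>k\<close>, -1 for \<open>k + 1\<close>, and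
  0 otherwise.\<close>

definition incr :: "(nat \<Rightarrow> nat \<Rightarrow> nat) \<Rightarrow> nat \<Rightarrow> nat \<Rightarrow> nat \<Rightarrow> int" where
  "incr g k j r = 2 * of_bool (j < g (Suc k) r) - of_bool (j < g k r)
     - of_bool (j < g (Suc (Suc k)) r)"

lemma cut_column_0: "cut_column i j 0 = (\<lambda>_. Suc j)"
  by (simp add: cut_column_def fun_eq_iff)

lemma cut_column_mono: "cut_column i j s r \<le> cut_column i j s (Suc r)"
  by (simp add: cut_column_def)

lemma excess_cut_full:
  assumes "2 * R \<le> s" "i \<le> 1"
  shows "excess R g k (cut_column i j s) = excess R g k (\<lambda>_. j)"
  unfolding excess_def by (rule sum.cong) (use assms in \<open>auto simp: cut_column_def\<close>)

lemma excess_cut: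
  "excess R g k (cut_column i j s) =
     excess R g k (\<lambda>_. Suc j) + (\<Sum>r | r < R \<and> 2 * r + i < s. incr g k j r)"
proof -
  have step: "int (x - j) = int (x - Suc j) + of_bool (j < x)" for x by auto
  have "excess R g k (cut_column i j s) = (\<Sum>r<R. 2 * int (g (Suc k) r - Suc j) - int (g k r - Suc j)
     - int (g (Suc (Suc k)) r - Suc j) + (if 2 * r + i < s then incr g k j r else 0))"
    unfolding excess_def by (rule sum.cong[OF refl]) (simp only: cut_column_def step incr_def, auto)
  also have "(\<Sum>r<R. if 2 * r + i < s then incr g k j r else 0) =
      (\<Sum>r | r < R \<and> 2 * r + i < s. incr g k j r)"
    by (simp add: sum.If_cases Int_def)
  then have "(\<Sum>r<R. 2 * int (g (Suc k) r - Suc j) - int (g k r - Suc j)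
     - int (g (Suc (Suc k)) r - Suc j) + (if 2 * r + i < s then incr g k j r else 0)) =
     excess R g k (\<lambda>_. Suc j) + (\<Sum>r | r < R \<and> 2 * r + i < s. incr g k j r)"
    unfolding excess_def sum.distrib by simp
  finally show ?thesis .
qed

context
  fixes lam mu g
  assumes g: "gt_chain lam mu g"
begin

lemma incr_neg_iff: "incr g k j r < 0 \<longleftrightarrow> g (Suc k) r \<le> j \<and> j < g (Suc (Suc k)) r"
  using gt_chain_step(1)[OF g, of k r] gt_chain_step(1)[OF g, of "Suc k" r]
  by (auto simp: incr_def)

lemma incr_ge: "- 1 \<le> incr g k j r"
  using gt_chain_step(1)[OF g, of k r] gt_chain_step(1)[OF g, of "Suc k" r]
  by (auto simp: incr_def)

lemma incr_zero: "g (Suc (Suc k)) r \<le> j \<Longrightarrow> incr g k j r = 0"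
  using gt_chain_step(1)[OF g, of k r] gt_chain_step(1)[OF g, of "Suc k" r]
  by (auto simp: incr_def)

lemma incr_pos: "g k r \<le> j \<Longrightarrow> j < g (Suc k) r \<Longrightarrow> incr g k j r = 1"
  using gt_chain_step(1)[OF g, of "Suc k" r]
  by (auto simp: incr_def)

text \<open>Strictly below and weakly to the right of a \<open>k + 1\<close>, cells hold larger
  entries.\<close>

lemma incr_zero_below_neg: "incr g k j a < 0 \<Longrightarrow> a < b \<Longrightarrow> j \<le> j' \<Longrightarrow> incr g k j' b = 0"
  using gt_chain_strip[OF g, of a b "Suc k"] by (intro incr_zero) (simp add: incr_neg_iff)

lemma incr_nonneg_above: "j < g (Suc k) r \<Longrightarrow> a \<le> r \<Longrightarrow> 0 \<le> incr g k j a"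
  using incr_neg_iff[of k j a] antimonoD[OF gt_chain_antimono[OF g, of "Suc k"], of a r]
  by (force simp: not_less)

text \<open>A column contains at most one \<open>k + 1\<close>.\<close>

lemma sum_incr_ge:
  assumes "finite S" shows "- 1 \<le> (\<Sum>r\<in>S. incr g k j r)"
proof (cases "\<exists>a\<in>S. incr g k j a < 0")
  case True
  then obtain a where a: "a \<in> S" "incr g k j a < 0" by blast
  have "0 \<le> incr g k j b" if "b \<in> S - {a}" for b
  proof (cases "a < b")
    case True then show ?thesis using incr_zero_below_neg[OF a(2) True, of j] by simp
  next
    case False
    then have "b < a" using that by auto
    then show ?thesis using incr_zero_below_neg[of k j b a j] a(2) by force
  qed
  then have "0 \<le> (\<Sum>r\<in>S - {a}. incr g k j r)" by (rule sum_nonneg)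
  then show ?thesis using sum.remove[OF assms a(1), of "incr g k j"] incr_ge[of k j a] by simp
next
  case False
  then show ?thesis using sum_nonneg[of S "incr g k j"] by force
qed

text \<open>The cell in row \<open>r\<close> holds a \<open>k\<close>. No \<open>k + 1\<close> can
  stand above it, and \<open>below\<close> excludes one underneath.\<close>

lemma sum_incr_pos:
  assumes "finite S" "r \<in> S" "g k r \<le> j" "j < g (Suc k) r"
    and below: "\<And>b. b \<in> S \<Longrightarrow> r < b \<Longrightarrow> g (Suc (Suc k)) b \<le> j"
  shows "1 \<le> (\<Sum>r\<in>S. incr g k j r)"
proof -
  have "0 \<le> incr g k j b" if "b \<in> S - {r}" for b
  proof (cases "r < b")
    case True then show ?thesis using incr_zero below that by simp
  next
    case False then show ?thesis using incr_nonneg_above[OF assms(4), of b] by simp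
  qed
  then have "0 \<le> (\<Sum>r\<in>S - {r}. incr g k j r)" by (rule sum_nonneg)
  then show ?thesis
    using sum.remove[OF assms(1,2), of "incr g k j"] incr_pos[OF assms(3,4)] by simp
qed

text \<open>The cells of one tableau in the last rows of column \<open>j + 1\<close> and the first rows of column \<open>j\<close>.\<close>

lemma sum_incr_two_columns:
  assumes "finite S" "finite T" and less: "\<And>a b. a \<in> S \<Longrightarrow> b \<in> T \<Longrightarrow> a < b"
  shows "- 1 \<le> (\<Sum>r\<in>S. incr g k j r) + (\<Sum>r\<in>T. incr g k (Suc j) r)"
proof (cases "\<exists>a\<in>S. incr g k j a < 0")
  case True
  then obtain a where a: "a \<in> S" "incr g k j a < 0" by blast
  have "(\<Sum>r\<in>T. incr g k (Suc j) r) = 0"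
    using incr_zero_below_neg[OF a(2)] less[OF a(1)] by (simp add: sum.neutral)
  then show ?thesis using sum_incr_ge[OF assms(1), of k j] by simp
next
  case False
  then have "0 \<le> (\<Sum>r\<in>S. incr g k j r)" using sum_nonneg[of S "incr g k j"] by force
  then show ?thesis using sum_incr_ge[OF assms(2), of k "Suc j"] by simp
qed

lemma antimono_le: "a \<le> b \<Longrightarrow> g t b \<le> g t a"
  using antimonoD[OF gt_chain_antimono[OF g, of t]] .

end

text \<open>This supplies the hypotheses \<open>free\<close> and \<open>split\<close> of
  \<open>bk_row_sum\<close> for either tableau, \<open>i\<close> being the colour of
  \<open>g\<close>. If one of them failed, \<open>g\<close> would gain at least 1 over a stretch of
  the word ending at the cut, while \<open>h\<close> loses at most 1 over that stretch; the excess
  could then not have become negative.\<close>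

lemma first_violation_tail:
  assumes g: "gt_chain lam mu g" and h: "gt_chain lam' mu' h"
    and R: "\<forall>r\<ge>R. lam r = 0"
    and i: "i \<le> 1" "i' \<le> 1"
    and neg: "excess R g k (cut_column i j s) + excess R h k (cut_column i' j s) < 0"
    and earlier: "\<And>s'. 0 \<le> excess R g k (cut_column i (Suc j) s') + excess R h k (cut_column i' (Suc j) s')"
  shows "\<not> (bk_low k g r < cut_column i j s r \<and> cut_column i j s r < g (Suc k) r)" (is ?free)
    and "cut_column i j s r < cut_column i j s (Suc r) \<Longrightarrow> g k r < cut_column i j s (Suc r) \<Longrightarrow>
      g (Suc (Suc k)) (Suc r) \<le> cut_column i j s r" (is "_ \<Longrightarrow> _ \<Longrightarrow> ?split")
proof -
  let ?S = "\<lambda>i s. {r. r < R \<and> 2 * r + i < s}"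
  have fin: "finite (?S i s)" for i s by simp
  have rR: "r < R" if "0 < g t r" for t r
    using R gt_chain_le_outer[OF g, of t r] that by (cases "r < R") auto
  have "0 \<le> excess R g k (\<lambda>_. Suc j) + excess R h k (\<lambda>_. Suc j)"
    using earlier[of "2 * R"] i by (simp add: excess_cut_full)
  then have "(\<Sum>r\<in>?S i s. incr g k j r) + (\<Sum>r\<in>?S i' s. incr h k j r) < 0"
    using neg unfolding excess_cut by simp
  \<comment> \<open>Column \<open>j\<close> alone turns a nonnegative excess into a negative one,
    and \<open>h\<close> accounts for at least -1 of the change.\<close>
  then have upper: "\<not> 1 \<le> (\<Sum>r\<in>?S i s. incr g k j r)"
    using sum_incr_ge[OF h fin, of k j i' s] by linarith
  show ?free
  proof
    assume a: "bk_low k g r < cut_column i j s r \<and> cut_column i j s r < g (Suc k) r"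
    then have r: "r < R" using rR[of "Suc k" r] by simp
    show False
    proof (cases "2 * r + i < s")
      case True
      then have c: "cut_column i j s r = j" by (simp add: cut_column_def)
      have "g (Suc (Suc k)) b \<le> j" if "r < b" for b
        using antimono_le[OF g, of "Suc r" b "Suc (Suc k)"] that a
        by (simp add: c bk_low_def)
      then have "1 \<le> (\<Sum>r\<in>?S i s. incr g k j r)"
        using a r True by (intro sum_incr_pos[OF g fin, of r]) (auto simp: c bk_low_def)
      then show False using upper by blast
    next
      case False
      then have c: "cut_column i j s r = Suc j" by (simp add: cut_column_def)
      have low: "g k r \<le> j" "g (Suc (Suc k)) (Suc r) \<le> j" and n: "Suc j < g (Suc k) r"
        using a by (auto simp: c bk_low_def)
      \<comment> \<open>The comparison is with the prefix stopping just before row \<open>r\<close>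
        of colour \<open>i\<close> in column \<open>j + 1\<close>. The cells \<open>(r, j)\<close>
        and \<open>(r, j + 1)\<close> of \<open>g\<close> both hold \<open>k\<close>, and no
        \<open>k + 1\<close> stands below the latter.\<close>
      let ?s = "2 * r + i"
      let ?T = "\<lambda>i. {b. b < R \<and> \<not> 2 * b + i < ?s}"
      have col: "excess R f k (\<lambda>_. Suc j) = excess R f k (cut_column i' (Suc j) ?s) +
          (\<Sum>r\<in>?T i'. incr f k (Suc j) r)" if "i' \<le> 1" for f i'
      proof -
        have "excess R f k (\<lambda>_. Suc j) = excess R f k (cut_column i' (Suc j) (2 * R))"
          using that by (simp add: excess_cut_full)
        also have "{r. r < R \<and> 2 * r + i' < 2 * R} = ?S i' ?s \<union> ?T i'" using that by auto
        then have "excess R f k (cut_column i' (Suc j) (2 * R)) =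
            excess R f k (\<lambda>_. Suc (Suc j)) + (\<Sum>r\<in>?S i' ?s \<union> ?T i'. incr f k (Suc j) r)"
          unfolding excess_cut[of _ _ _ _ _ "2 * R"] by simp
        also have "(\<Sum>r\<in>?S i' ?s \<union> ?T i'. incr f k (Suc j) r) =
            (\<Sum>r\<in>?S i' ?s. incr f k (Suc j) r) + (\<Sum>r\<in>?T i'. incr f k (Suc j) r)"
          by (rule sum.union_disjoint) auto
        finally show ?thesis unfolding excess_cut[of _ _ _ _ _ ?s] by simp
      qed
      have "1 \<le> (\<Sum>r\<in>?T i. incr g k (Suc j) r)"
        using r low n order_trans[OF antimono_le[OF g, of "Suc r" _ "Suc (Suc k)"] low(2)]
        by (intro sum_incr_pos[OF g, of _ r]) (auto intro!: le_SucI)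
      moreover have "0 \<le> (\<Sum>r\<in>?S i s. incr g k j r)"
        using False n by (intro sum_nonneg incr_nonneg_above[OF g, of j k r]) auto
      \<comment> \<open>Row \<open>r\<close> is unread in column \<open>j\<close>, so the rows of
        \<open>h\<close> read there lie above those remaining in column \<open>j + 1\<close>;
        together they contain at most one \<open>k + 1\<close>.\<close>
      moreover have "- 1 \<le> (\<Sum>r\<in>?S i' s. incr h k j r) + (\<Sum>r\<in>?T i'. incr h k (Suc j) r)"
        using False by (intro sum_incr_two_columns[OF h]) auto
      ultimately show False
        using neg earlier[of ?s] unfolding excess_cut[of _ _ _ _ j] col[OF i(1), of g] col[OF i(2), of h]
        by linarith
    qed
  qed
  show ?split if less: "cut_column i j s r < cut_column i j s (Suc r)" and m: "g k r < cut_column i j s (Suc r)"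
  proof (rule ccontr)
    assume "\<not> ?split"
    moreover have c: "cut_column i j s r = j" "cut_column i j s (Suc r) = Suc j" "2 * r + i < s" "\<not> 2 * Suc r + i < s"
      using less by (auto simp: cut_column_def split: if_splits)
    ultimately have l: "j < g (Suc (Suc k)) (Suc r)" by simp
    then have n: "j < g (Suc k) r" using gt_chain_step(2)[OF g, of "Suc k" r] by simp
    \<comment> \<open>The \<open>k\<close> at \<open>(r, j)\<close> has been read, but the
      \<open>k + 1\<close> below it has not.\<close>
    have "1 \<le> (\<Sum>r\<in>?S i s. incr g k j r)"
      using m n rR[of "Suc k" r] c by (intro sum_incr_pos[OF g fin, of r]) auto
    then show False using upper by blast
  qed
qed


text \<open>Violations are ordered by the length of the prefix, ties being broken by the least
  \<open>k\<close>. The definition speaks only of prefixes up to the violating one, so moves left of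
  the cut do not affect it.\<close>

definition first_violation ::
  "nat \<Rightarrow> (nat \<Rightarrow> nat \<Rightarrow> nat) \<Rightarrow> (nat \<Rightarrow> nat \<Rightarrow> nat) \<Rightarrow> nat \<Rightarrow> nat \<Rightarrow> nat \<Rightarrow> bool" where
  "first_violation R g h k j s \<longleftrightarrow> pair_excess R g h k j s < 0 \<and>
     (\<forall>j'>j. \<forall>k' s'. 0 \<le> pair_excess R g h k' j' s') \<and>
     (\<forall>s'<s. \<forall>k'. 0 \<le> pair_excess R g h k' j s') \<and>
     (\<forall>k'<k. 0 \<le> pair_excess R g h k' j s)"

lemma first_violation_unique:
  assumes "first_violation R g h k j s" "first_violation R g h k' j' s'"
  shows "k = k' \<and> j = j' \<and> s = s'"
  using assms unfolding first_violation_def by (metis linorder_less_linear not_less)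

lemma pair_excess_far:
  assumes "gt_chain lam mu g" "gt_chain lam' mu' h" "\<And>r. lam r \<le> j" "\<And>r. lam' r \<le> j"
  shows "pair_excess R g h k j s = 0"
proof -
  have le: "g t r \<le> cut_column i j s r" "h t r \<le> cut_column i j s r" for t r i
    using gt_chain_le_outer[OF assms(1), of t r] gt_chain_le_outer[OF assms(2), of t r]
      assms(3,4)[of r] by (auto simp: cut_column_def intro: order_trans le_SucI)
  then show ?thesis by (simp add: pair_excess_def excess_def)
qed

lemma first_violation_exists:
  assumes g: "gt_chain lam mu g" and h: "gt_chain lam' mu' h"
    and bad: "\<not> yamanouchi R g h"
  shows "\<exists>k j s. first_violation R g h k j s"
proof -
  define V where "V k j s \<longleftrightarrow> pair_excess R g h k j s < 0" for k j s
  obtain m where m: "g m = lam" using g by (auto simp: gt_chain_def)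
  obtain m' where m': "h m' = lam'" using h by (auto simp: gt_chain_def)
  have "lam r \<le> lam 0" "lam' r \<le> lam' 0" for r
    using antimonoD[OF gt_chain_antimono[OF g, of m], of 0 r]
      antimonoD[OF gt_chain_antimono[OF h, of m'], of 0 r] m m' by simp_all
  then have "V k j s \<Longrightarrow> j \<le> max (lam 0) (lam' 0)" for k j s
    using pair_excess_far[OF g h, of j R k s] unfolding V_def
    by (metis le_max_iff_disj less_irrefl nat_le_linear order_trans)
  then have bound: "\<exists>k s. V k j s \<Longrightarrow> j \<le> max (lam 0) (lam' 0)" for j by blast
  have ex: "\<exists>j k s. V k j s" using bad by (auto simp: yamanouchi_def V_def not_le)
  define j where "j = (GREATEST j. \<exists>k s. V k j s)"
  define s where "s = (LEAST s. \<exists>k. V k j s)"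
  define k where "k = (LEAST k. V k j s)"
  have j: "\<exists>k s. V k j s" unfolding j_def
    using ex bound by (intro GreatestI_ex_nat[where P = "\<lambda>j. \<exists>k s. V k j s"]) auto
  have "\<exists>k. V k j s" unfolding s_def using j by (intro LeastI_ex[where P = "\<lambda>s. \<exists>k. V k j s"]) auto
  then have "V k j s" unfolding k_def by (rule LeastI_ex)
  moreover have "\<not> V k' j' s'" if "j < j'" for k' j' s'
    using Greatest_le_nat[where P = "\<lambda>j. \<exists>k s. V k j s", OF _ bound] that
    unfolding j_def[symmetric] by (metis not_less)
  moreover have "\<not> V k' j s'" if "s' < s" for k' s'
    using not_less_Least[of s' "\<lambda>s. \<exists>k. V k j s"] that unfolding s_def by blast
  moreover have "\<not> V k' j s" if "k' < k" for k'
    using not_less_Least[of k' "\<lambda>k. V k j s"] that unfolding k_def by blast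
  ultimately have "first_violation R g h k j s"
    unfolding first_violation_def V_def by (simp add: not_less)
  then show ?thesis by blast
qed

text \<open>A half row belongs to one colour, so one step reads at most one cell. Hence the excess
  at a first violation is exactly -1.\<close>

lemma pair_excess_step:
  assumes g: "gt_chain lam mu g" and h: "gt_chain lam' mu' h"
  shows "pair_excess R g h k j s - 1 \<le> pair_excess R g h k j (Suc s)"
proof -
  have split: "(\<Sum>r | r < R \<and> 2 * r + i < Suc s. f r) =
    (\<Sum>r | r < R \<and> 2 * r + i < s. f r) + (\<Sum>r | r < R \<and> 2 * r + i = s. f r)"
    for i and f :: "nat \<Rightarrow> int"
    by (subst sum.union_disjoint[symmetric]) (auto intro!: sum.cong)
  have "{r. r < R \<and> 2 * r + 0 = s} = {} \<or> {r. r < R \<and> 2 * r + 1 = s} = {}" by auto presburger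
  then have "- 1 \<le> (\<Sum>r | r < R \<and> 2 * r + 0 = s. incr g k j r) +
      (\<Sum>r | r < R \<and> 2 * r + 1 = s. incr h k j r)"
    using sum_incr_ge[OF g, of "{r. r < R \<and> 2 * r + 0 = s}" k j]
      sum_incr_ge[OF h, of "{r. r < R \<and> 2 * r + 1 = s}" k j]
    by (elim disjE) (simp_all only: sum.empty, simp_all)
  then show ?thesis unfolding pair_excess_def excess_cut split by linarith
qed

lemma pair_excess_next_column: "pair_excess R g h k j 0 = pair_excess R g h k (Suc j) (2 * R)"
  by (simp add: pair_excess_def excess_cut_full cut_column_0)

lemma int_gt_weight:
  assumes "gt_chain lam mu g"
  shows "int (gt_weight R g t) = int (\<Sum>r<R. g (Suc t) r) - int (\<Sum>r<R. g t r)"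
  by (simp add: gt_weight_def sum_subtractf[symmetric] of_nat_diff[OF gt_chain_step(1)[OF assms]])

text \<open>As the excess is -1, the exponents \<open>(a, b)\<close> of \<open>k\<close> and
  \<open>k + 1\<close> become \<open>(b - 1, a + 1)\<close>: an adjacent transposition acting on the
  exponents shifted by delta. The prefixes up to the cut are preserved, so the same violation is
  found again.\<close>

lemma first_violation_bk:
  fixes R g h k j s
  defines "g' \<equiv> bk k (cut_column 0 j s) g" and "h' \<equiv> bk k (cut_column 1 j s) h"
  assumes g: "gt_chain lam mu g" and h: "gt_chain lam' mu' h"
    and R: "\<forall>r\<ge>R. lam r = 0" "\<forall>r\<ge>R. lam' r = 0"
    and first: "first_violation R g h k j s"
  shows "first_violation R g' h' k j s"
    and "gt_weight R g' k + gt_weight R h' k + 1 = gt_weight R g (Suc k) + gt_weight R h (Suc k)"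
    and "gt_weight R g' (Suc k) + gt_weight R h' (Suc k) = gt_weight R g k + gt_weight R h k + 1"
    and "t \<noteq> k \<Longrightarrow> t \<noteq> Suc k \<Longrightarrow>
      gt_weight R g' t + gt_weight R h' t = gt_weight R g t + gt_weight R h t"
proof -
  have neg: "pair_excess R g h k j s < 0"
    and right: "\<And>j' k' s'. j < j' \<Longrightarrow> 0 \<le> pair_excess R g h k' j' s'"
    and above: "\<And>s' k'. s' < s \<Longrightarrow> 0 \<le> pair_excess R g h k' j s'"
    using first by (auto simp: first_violation_def)
  \<comment> \<open>With \<open>s = 0\<close> the prefix is the one ending with all of column
    \<open>j + 1\<close>, where no violation occurs.\<close>
  have "s \<noteq> 0" using neg right[of "Suc j" k "2 * R"] pair_excess_next_column[of R g h k j]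
    by (cases s) auto
  then obtain s0 where "s = Suc s0" using not0_implies_Suc by blast
  then have minus1: "pair_excess R g h k j s = - 1"
    using above[of s0 k] neg pair_excess_step[OF g h, of R k j s0] by simp
  have same: "pair_excess R g' h' k' j' s' = pair_excess R g h k' j' s'"
    if "j < j' \<or> j' = j \<and> s' \<le> s" for k' j' s'
  proof -
    have "cut_column i j s r \<le> cut_column i j' s' r" for i r using that by (auto simp: cut_column_def)
    then show ?thesis unfolding pair_excess_def g'_def h'_def
      by (simp add: excess_bk_head[OF g] excess_bk_head[OF h])
  qed
  show "first_violation R g' h' k j s" using first unfolding first_violation_def by (simp add: same)
  note tail = first_violation_tail[OF g h R(1), of 0 1 k j s]
    first_violation_tail[OF h g R(2), of 1 0 k j s]
  have sum: "int (\<Sum>r<R. g' (Suc k) r) + int (\<Sum>r<R. h' (Suc k) r) +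
      int (\<Sum>r<R. g (Suc k) r) + int (\<Sum>r<R. h (Suc k) r) + 1 =
      int (\<Sum>r<R. g (Suc (Suc k)) r) + int (\<Sum>r<R. h (Suc (Suc k)) r) +
      int (\<Sum>r<R. g k r) + int (\<Sum>r<R. h k r)"
    using bk_sum[OF g R(1), of k "cut_column 0 j s"] bk_sum[OF h R(2), of k "cut_column 1 j s"]
      tail cut_column_mono minus1 neg right[of "Suc j"]
    unfolding pair_excess_def g'_def h'_def bk_apply by (simp add: add.commute)
  have g': "gt_chain lam mu g'" and h': "gt_chain lam' mu' h'"
    unfolding g'_def h'_def by (rule gt_chain_bk[OF g] gt_chain_bk[OF h])+
  have other: "g' t = g t" "h' t = h t" if "t \<noteq> Suc k" for t
    using that by (simp_all add: g'_def h'_def bk_apply)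
  have o: "g' k = g k" "h' k = h k" "g' (Suc (Suc k)) = g (Suc (Suc k))"
      "h' (Suc (Suc k)) = h (Suc (Suc k))"
    by (simp_all add: other)
  note w = int_gt_weight[OF g] int_gt_weight[OF h] int_gt_weight[OF g'] int_gt_weight[OF h']
  show "gt_weight R g' k + gt_weight R h' k + 1 = gt_weight R g (Suc k) + gt_weight R h (Suc k)"
    using sum w[of R k] w[of R "Suc k"] unfolding o by linarith
  show "gt_weight R g' (Suc k) + gt_weight R h' (Suc k) = gt_weight R g k + gt_weight R h k + 1"
    using sum w[of R k] w[of R "Suc k"] unfolding o by linarith
  show "t \<noteq> k \<Longrightarrow> t \<noteq> Suc k \<Longrightarrow>
      gt_weight R g' t + gt_weight R h' t = gt_weight R g t + gt_weight R h t"
    unfolding gt_weight_def using other by simp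
qed

section \<open>Schur multiplicities by alternating sums\<close>

lemma sum_initial_max:
  fixes b :: "nat \<Rightarrow> nat"
  assumes "finite A" "A \<subseteq> {..<N}" and b: "\<And>i j. i \<le> j \<Longrightarrow> j < N \<Longrightarrow> b j \<le> b i"
  shows "(\<Sum>i\<in>A. b i) \<le> (\<Sum>i<card A. b i)"
  using assms(1,2)
proof (induction A rule: finite_linorder_max_induct)
  case empty
  then show ?case by simp
next
  case (insert m A)
  then have "A \<subseteq> {..<m}" "m \<notin> A" by auto
  moreover from this have "card A \<le> m" using card_mono[of "{..<m}" A] by simp
  ultimately show ?case using insert b[of "card A" m] by simp
qed

lemma sum_staircase:
  fixes f :: "nat \<Rightarrow> nat"
  shows "(\<Sum>i<N. (N - Suc i) * f i) = (\<Sum>j<N. \<Sum>i<j. f i)"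
proof (induction N)
  case (Suc N)
  have "(\<Sum>i<N. (N - i) * f i) = (\<Sum>i<N. (N - Suc i) * f i + f i)"
    by (rule sum.cong) (auto simp: Suc_diff_Suc[symmetric])
  then show ?case using Suc by (simp add: sum.distrib)
qed simp

text \<open>A strict rearrangement inequality. By Abel summation it suffices to compare initial
  sums: those of the permuted sequence are never larger, and the one including the first moved point
  is smaller.\<close>

lemma sum_staircase_permutes:
  fixes b :: "nat \<Rightarrow> nat"
  assumes b: "\<And>i j. i < j \<Longrightarrow> j < N \<Longrightarrow> b j < b i" and p: "p permutes {..<N}" "p \<noteq> id"
  shows "(\<Sum>i<N. (N - Suc i) * b (p i)) < (\<Sum>i<N. (N - Suc i) * b i)"
  unfolding sum_staircase
proof (rule sum_strict_mono_ex1)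
  have inj: "inj p" using p(1) by (rule permutes_inj)
  have mono: "i \<le> j \<Longrightarrow> j < N \<Longrightarrow> b j \<le> b i" for i j
    using b[of i j] by (cases "i = j") auto
  show "\<forall>j\<in>{..<N}. (\<Sum>i<j. b (p i)) \<le> (\<Sum>i<j. b i)"
  proof
    fix j assume "j \<in> {..<N}"
    then have "p ` {..<j} \<subseteq> {..<N}" using permutes_in_image[OF p(1)] by force
    then have "(\<Sum>i\<in>p ` {..<j}. b i) \<le> (\<Sum>i<card (p ` {..<j}). b i)"
      by (intro sum_initial_max[OF _ _ mono]) simp_all
    then show "(\<Sum>i<j. b (p i)) \<le> (\<Sum>i<j. b i)"
      using inj_on_subset[OF inj subset_UNIV, of "{..<j}"] by (simp add: sum.reindex card_image)
  qed
  define m where "m = (LEAST i. p i \<noteq> i)"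
  have "\<exists>i. p i \<noteq> i" using p(2) by (auto simp: fun_eq_iff)
  then have m: "p m \<noteq> m" unfolding m_def by (rule LeastI_ex)
  have fix_below: "p i = i" if "i < m" for i using not_less_Least that unfolding m_def by blast
  have "m < p m"
    using m fix_below[of "p m"] injD[OF inj, of "p m" m] by (meson linorder_neqE_nat)
  moreover have "p m < N" using m permutes_not_in[OF p(1), of m] permutes_in_image[OF p(1), of m] by auto
  ultimately have "Suc m \<in> {..<N}" "b (p m) < b m" using b by auto
  moreover have "(\<Sum>i<m. b (p i)) = (\<Sum>i<m. b i)" using fix_below by simp
  ultimately show "\<exists>j\<in>{..<N}. (\<Sum>i<j. b (p i)) < (\<Sum>i<j. b i)"
    by (intro bexI[of _ "Suc m"]) simp_all
qed simp

text \<open>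
  The coefficient with which the monomial of exponents \<open>c\<close> contributes to the multiplicity of
  the Schur function of \<open>nu\<close> in a symmetric function of \<open>N\<close> variables: the sign of the
  permutation carrying \<open>nu + delta\<close> to \<open>c + delta\<close>, and 0 if there is none.
\<close>

definition alt_sign :: "nat \<Rightarrow> (nat \<Rightarrow> nat) \<Rightarrow> (nat \<Rightarrow> nat) \<Rightarrow> int" where
  "alt_sign N nu c = (\<Sum>p | p permutes {..<N} \<and>
     (\<forall>i<N. c i + (N - Suc i) = nu (p i) + (N - Suc (p i))). sign p)"

text \<open>The shifted exponents \<open>c i + (N - Suc i)\<close> at \<open>k\<close> and
  \<open>k + 1\<close> are interchanged, so composing with the transposition reindexes the sum and
  reverses each sign.\<close>

lemma alt_sign_swap:
  assumes k: "Suc k < N" and c: "Suc (c' k) = c (Suc k)" "c' (Suc k) = Suc (c k)"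
    "\<And>i. i < N \<Longrightarrow> i \<noteq> k \<Longrightarrow> i \<noteq> Suc k \<Longrightarrow> c' i = c i"
  shows "alt_sign N nu c' = - alt_sign N nu c"
proof -
  let ?t = "transpose k (Suc k)"
  have t: "?t permutes {..<N}" using k by (intro permutes_swap_id) auto
  have tt: "q \<circ> ?t \<circ> ?t = q" for q :: "nat \<Rightarrow> nat" by (rule ext) simp
  have c': "c' i + (N - Suc i) = c (?t i) + (N - Suc (?t i))" if "i < N" for i
    using c k that by (cases "i = k"; cases "i = Suc k") (auto simp: transpose_def)
  have reindex: "(\<forall>i<N. P (?t i)) \<longleftrightarrow> (\<forall>i<N. P i)" for P
    using permutes_in_image[OF t] by (metis lessThan_iff transpose_involutory)
  have iff: "(\<forall>i<N. c' i + (N - Suc i) = nu (q i) + (N - Suc (q i))) \<longleftrightarrow>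
      (\<forall>i<N. c i + (N - Suc i) = nu ((q \<circ> ?t) i) + (N - Suc ((q \<circ> ?t) i)))" for q
    using reindex[of "\<lambda>i. c i + (N - Suc i) = nu ((q \<circ> ?t) i) + (N - Suc ((q \<circ> ?t) i))"] c'
    by simp
  have "alt_sign N nu c' = (\<Sum>p | p permutes {..<N} \<and>
     (\<forall>i<N. c i + (N - Suc i) = nu (p i) + (N - Suc (p i))). - sign p)"
    unfolding alt_sign_def
  proof (rule sum.reindex_bij_witness[where i = "\<lambda>q. q \<circ> ?t" and j = "\<lambda>q. q \<circ> ?t"])
    fix q assume q: "q \<in> {p. p permutes {..<N} \<and>
      (\<forall>i<N. c' i + (N - Suc i) = nu (p i) + (N - Suc (p i)))}"
    then have "permutation q" by (auto intro: permutes_imp_permutation)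
    then show "- sign (q \<circ> ?t) = sign q"
      by (simp add: sign_compose permutation_swap_id sign_swap_id)
    show "q \<circ> ?t \<in> {p. p permutes {..<N} \<and>
      (\<forall>i<N. c i + (N - Suc i) = nu (p i) + (N - Suc (p i)))}"
      using q iff[of q] permutes_compose[OF t] by auto
  next
    fix q assume q: "q \<in> {p. p permutes {..<N} \<and>
      (\<forall>i<N. c i + (N - Suc i) = nu (p i) + (N - Suc (p i)))}"
    then show "q \<circ> ?t \<in> {p. p permutes {..<N} \<and>
      (\<forall>i<N. c' i + (N - Suc i) = nu (p i) + (N - Suc (p i)))}"
      using iff[of "q \<circ> ?t"] permutes_compose[OF t] unfolding tt by auto
  qed (rule tt)+
  then show ?thesis by (simp add: alt_sign_def sum_negf)
qed

lemma permutes_strict_mono_id: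
  fixes p :: "nat \<Rightarrow> nat"
  assumes p: "p permutes {..<N}" and mono: "\<And>i j. i < j \<Longrightarrow> j < N \<Longrightarrow> p i < p j"
  shows "p = id"
proof -
  have "i < N \<Longrightarrow> i \<le> p i" for i
  proof (induction i)
    case (Suc i)
    then show ?case using mono[of i "Suc i"] by simp
  qed simp
  then show ?thesis using permutes_natset_ge[OF p] by simp
qed

lemma shift_strict: 
  fixes c :: "nat \<Rightarrow> nat"
  assumes "antimono c" "i < j" "j < N" shows "c j + (N - Suc j) < c i + (N - Suc i)"
  using antimonoD[OF assms(1), of i j] assms(2,3) by simp

text \<open>After the shift both sequences decrease strictly, so only the identity can carry one to
  the other.\<close>

lemma alt_sign_antimono:
  assumes c: "antimono c" and nu: "antimono nu"
  shows "alt_sign N nu c = of_bool (\<forall>i<N. c i = nu i)"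
proof -
  have id: "p = id" if p: "p permutes {..<N}"
    and eq: "\<forall>i<N. c i + (N - Suc i) = nu (p i) + (N - Suc (p i))" for p
  proof (rule permutes_strict_mono_id[OF p])
    fix i j assume ij: "i < j" "j < N"
    then have "nu (p j) + (N - Suc (p j)) < nu (p i) + (N - Suc (p i))"
      using shift_strict[OF c ij] eq by simp
    moreover have "p i < N" using permutes_in_image[OF p, of i] ij by simp
    ultimately show "p i < p j"
      using shift_strict[OF nu, of "p j" "p i" N] by (cases "p i = p j") (simp, linarith)
  qed
  have "{p. p permutes {..<N} \<and> (\<forall>i<N. c i + (N - Suc i) = nu (p i) + (N - Suc (p i)))} =
      (if \<forall>i<N. c i = nu i then {id} else {})"
  proof (cases "\<forall>i<N. c i = nu i")
    case True
    then show ?thesis using id permutes_id by auto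
  next
    case False
    then show ?thesis using id by (auto dest!: id)
  qed
  then show ?thesis by (simp add: alt_sign_def)
qed

lemma count_image_transpose: "count (image_mset (transpose a b) m) x = count m (transpose a b x)"
proof (induction m)
  case (add y m)
  have "transpose a b y = x \<longleftrightarrow> y = transpose a b x" by (metis transpose_involutory)
  then show ?case using add by simp
qed simp


text \<open>With \<open>delta i = N - Suc i\<close> this is the squared norm of
  \<open>c + delta\<close> minus its scalar product with \<open>delta\<close>. Permuting
  \<open>c + delta\<close> keeps the norm, while the scalar product is largest for the decreasing
  arrangement. Sorting \<open>c\<close> itself has the opposite effect on the rank, and the extremal
  argument needs both.\<close>

definition exps_rank :: "nat \<Rightarrow> (nat \<Rightarrow> nat) \<Rightarrow> nat" where
  "exps_rank N c = (\<Sum>i<N. c i * (c i + (N - Suc i)))"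

lemma exps_rank_less:
  assumes nu: "antimono nu" and p: "p permutes {..<N}" "p \<noteq> id"
    and c: "\<forall>i<N. c i + (N - Suc i) = nu (p i) + (N - Suc (p i))"
  shows "exps_rank N nu < exps_rank N c"
proof -
  define b where "b i = nu i + (N - Suc i)" for i
  have split: "(\<Sum>i<N. a i * (a i + (N - Suc i))) + (\<Sum>i<N. (N - Suc i) * (a i + (N - Suc i))) =
      (\<Sum>i<N. (a i + (N - Suc i))\<^sup>2)" for a :: "nat \<Rightarrow> nat"
    by (simp only: sum.distrib[symmetric] add_mult_distrib[symmetric] power2_eq_square)
  have "(\<Sum>i<N. (N - Suc i) * b (p i)) < (\<Sum>i<N. (N - Suc i) * b i)"
    using shift_strict[OF nu] by (intro sum_staircase_permutes[OF _ p]) (simp add: b_def)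
  moreover have "(\<Sum>i<N. (b (p i))\<^sup>2) = (\<Sum>i<N. (b i)\<^sup>2)"
    using sum.permute[OF p(1), of "\<lambda>i. (b i)\<^sup>2"] by (simp add: comp_def)
  moreover have "(\<Sum>i<N. (c i + (N - Suc i))\<^sup>2) = (\<Sum>i<N. (b (p i))\<^sup>2)"
    "(\<Sum>i<N. (N - Suc i) * (c i + (N - Suc i))) = (\<Sum>i<N. (N - Suc i) * b (p i))"
    using c by (simp_all add: b_def)
  ultimately show ?thesis using split[of c] split[of nu] unfolding exps_rank_def b_def by linarith
qed

text \<open>The squares of the exponents are merely rearranged, while the larger exponent now meets
  the larger entry of delta.\<close>

lemma exps_rank_swap:
  assumes k: "Suc k < N" and less: "c k < c (Suc k)"
    and c': "c' k = c (Suc k)" "c' (Suc k) = c k" "\<And>i. i \<noteq> k \<Longrightarrow> i \<noteq> Suc k \<Longrightarrow> c' i = c i"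
  shows "exps_rank N c < exps_rank N c'"
proof -
  have set: "{..<N} = insert k (insert (Suc k) ({..<N} - {k, Suc k}))" using k by auto
  have rank: "exps_rank N a = a k * (a k + (N - Suc k)) + (a (Suc k) * (a (Suc k) + (N - Suc (Suc k))) +
      (\<Sum>i\<in>{..<N} - {k, Suc k}. a i * (a i + (N - Suc i))))" for a
    unfolding exps_rank_def by (subst set) simp
  obtain e where e: "N - Suc k = Suc e" "N - Suc (Suc k) = e" using k
    by (metis Suc_diff_Suc)
  have "c k * (c k + Suc e) + c (Suc k) * (c (Suc k) + e) < c (Suc k) * (c (Suc k) + Suc e) + c k * (c k + e)"
    using less by (simp add: algebra_simps)
  then show ?thesis unfolding rank[of c] rank[of c'] e using c' by simp
qed

lemma antimono_count:
  assumes "set_mset m \<subseteq> {..<N}" and "\<And>k. Suc k < N \<Longrightarrow> count m (Suc k) \<le> count m k"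
  shows "antimono (count m)"
  unfolding antimono_iff_le_Suc
proof
  fix k show "count m (Suc k) \<le> count m k"
  proof (cases "Suc k < N")
    case False
    then have "Suc k \<notin># m" using assms(1) by auto
    then show ?thesis by (simp add: not_in_iff)
  qed (rule assms(2))
qed

text \<open>
  Take a monomial of maximal rank among those with nonzero coefficient. By symmetry its exponents
  are decreasing, and all other monomials contributing to their Schur multiplicity have larger rank.
\<close>

lemma symmetric_eq_zero:
  fixes f :: "nat multiset \<Rightarrow> int"
  assumes sym: "\<And>m k. m \<in> multisets_of_size {..<N} d \<Longrightarrow> Suc k < N \<Longrightarrow>
      f (image_mset (transpose k (Suc k)) m) = f m"
    and zero: "\<And>nu. antimono nu \<Longrightarrow> (\<And>i. N \<le> i \<Longrightarrow> nu i = 0) \<Longrightarrow> (\<Sum>i<N. nu i) = d \<Longrightarrow>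
      (\<Sum>m\<in>multisets_of_size {..<N} d. alt_sign N nu (count m) * f m) = 0"
    and m: "m \<in> multisets_of_size {..<N} d"
  shows "f m = 0"
proof (rule ccontr)
  let ?M = "multisets_of_size {..<N} d" and ?q = "\<lambda>m. exps_rank N (count m)"
  assume "f m \<noteq> 0"
  define A where "A = {m \<in> ?M. f m \<noteq> 0}"
  have A: "finite A" "A \<noteq> {}"
    using m \<open>f m \<noteq> 0\<close> by (auto simp: A_def finite_multisets_of_size)
  then obtain t where "t \<in> A" "?q t = Max (?q ` A)"
    using Max_in[of "?q ` A"] by (metis (no_types, lifting) finite_imageI image_iff image_is_empty)
  then have t: "t \<in> ?M" "f t \<noteq> 0" and max: "\<And>m. m \<in> ?M \<Longrightarrow> f m \<noteq> 0 \<Longrightarrow> ?q m \<le> ?q t"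
    using A(1) by (auto simp: A_def)
  have sub: "set_mset t \<subseteq> {..<N}" and size: "size t = d"
    using t(1) by (auto simp: multisets_of_size_def)
  have anti: "antimono (count t)"
  proof (rule antimono_count[OF sub], rule ccontr)
    fix k assume k: "Suc k < N" and "\<not> count t (Suc k) \<le> count t k"
    let ?t = "image_mset (transpose k (Suc k)) t"
    have "?t \<in> ?M" using sub size k by (auto simp: multisets_of_size_def transpose_def)
    moreover have "f ?t \<noteq> 0" using sym[OF t(1) k] t(2) by simp
    moreover have "?q t < ?q ?t"
      using \<open>\<not> count t (Suc k) \<le> count t k\<close>
      by (intro exps_rank_swap[OF k]) (simp_all add: count_image_transpose)
    ultimately show False using max[of ?t] by simp
  qed
  have out: "count t i = 0" if "N \<le> i" for i
    using sub that by (metis count_inI lessThan_iff not_less subsetD)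
  have sum: "(\<Sum>i<N. count t i) = d"
    unfolding size[symmetric] size_multiset_overloaded_eq
    by (rule sum.mono_neutral_right) (use sub in \<open>auto simp: not_in_iff\<close>)
  have "alt_sign N (count t) (count m) * f m = (if m = t then f t else 0)" if "m \<in> ?M" for m
  proof (cases "m = t")
    case True
    then show ?thesis using alt_sign_antimono[OF anti anti] by simp
  next
    case False
    show ?thesis
    proof (cases "f m = 0")
      case False
      have "\<not> (p permutes {..<N} \<and>
        (\<forall>i<N. count m i + (N - Suc i) = count t (p i) + (N - Suc (p i))))" for p
      proof
        assume p: "p permutes {..<N} \<and>
          (\<forall>i<N. count m i + (N - Suc i) = count t (p i) + (N - Suc (p i)))"
        have "p \<noteq> id"
        proof
          assume "p = id"
          then have "count m i = count t i" for i
            using p out[of i] that by (cases "i < N") (auto simp: multisets_of_size_def not_in_iff)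
          then show False using \<open>m \<noteq> t\<close> by (simp add: multiset_eq_iff)
        qed
        then show False using exps_rank_less[OF anti] p max[OF that False] by fastforce
      qed
      then have "alt_sign N (count t) (count m) = 0"
        unfolding alt_sign_def by (intro sum.neutral) blast
      then show ?thesis using \<open>m \<noteq> t\<close> by simp
    qed (use \<open>m \<noteq> t\<close> in simp)
  qed
  then have "(\<Sum>m\<in>?M. alt_sign N (count t) (count m) * f m) = (\<Sum>m\<in>?M. if m = t then f t else 0)"
    by (rule sum.cong[OF refl])
  also have "\<dots> = f t" using t(1) by (simp add: finite_multisets_of_size)
  finally show False using zero[OF anti out sum] t(2) by simp
qed

section \<open>The sign-reversing involution on pairs of chains\<close>

definition gt_pairs where
  "gt_pairs lam mu lam' mu' = {(g, h). gt_chain lam mu g \<and> gt_chain lam' mu' h}"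

definition pair_weight ::
  "nat \<Rightarrow> (nat \<Rightarrow> nat \<Rightarrow> nat) \<times> (nat \<Rightarrow> nat \<Rightarrow> nat) \<Rightarrow> nat \<Rightarrow> nat" where
  "pair_weight R = (\<lambda>(g, h) t. gt_weight R g t + gt_weight R h t)"

text \<open>No cell lies right of the cut \<open>lam 0\<close>, so this is the classical
  Bender--Knuth involution, the source of the symmetry of skew Schur functions.\<close>

lemma gt_weight_bk_full:
  fixes lam g k
  assumes g: "gt_chain lam mu g" and R: "\<forall>r\<ge>R. lam r = 0"
  defines "g' \<equiv> bk k (\<lambda>_. lam 0) g"
  shows "gt_weight R g' t = gt_weight R g (transpose k (Suc k) t)"
proof -
  obtain m where "g m = lam" using g by (auto simp: gt_chain_def)
  then have "lam r \<le> lam 0" for r using antimonoD[OF gt_chain_antimono[OF g, of m], of 0 r] by simp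
  then have le: "g t r \<le> lam 0" for t r using gt_chain_le_outer[OF g, of t r] order_trans by blast
  then have excess: "excess R g k (\<lambda>_. lam 0) = 0" by (simp add: excess_def)
  have sum: "int (\<Sum>r<R. g' (Suc k) r) + int (\<Sum>r<R. g (Suc k) r) =
      int (\<Sum>r<R. g (Suc (Suc k)) r) + int (\<Sum>r<R. g k r)"
    using bk_sum[OF g R, of k "\<lambda>_. lam 0"] le excess
    unfolding g'_def bk_apply by (simp add: not_less)
  have g': "gt_chain lam mu g'" unfolding g'_def by (rule gt_chain_bk[OF g])
  have other: "g' t = g t" if "t \<noteq> Suc k" for t
    using that by (simp add: g'_def bk_apply)
  have o: "g' k = g k" "g' (Suc (Suc k)) = g (Suc (Suc k))" by (simp_all add: other)
  note w = int_gt_weight[OF g] int_gt_weight[OF g']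
  have "gt_weight R g' k = gt_weight R g (Suc k)" "gt_weight R g' (Suc k) = gt_weight R g k"
    using sum w[of R k] w[of R "Suc k"] unfolding o by linarith+
  moreover have "t \<noteq> k \<Longrightarrow> t \<noteq> Suc k \<Longrightarrow> gt_weight R g' t = gt_weight R g t"
    unfolding gt_weight_def using other by simp
  ultimately show ?thesis by (cases "t = k"; cases "t = Suc k") (auto simp: transpose_def)
qed

lemma card_pairs_symmetric:
  assumes R: "\<forall>r\<ge>R. lam r = 0" "\<forall>r\<ge>R. lam' r = 0"
  shows "card {x \<in> gt_pairs lam mu lam' mu'. \<forall>t. pair_weight R x t = c (transpose k (Suc k) t)} =
    card {x \<in> gt_pairs lam mu lam' mu'. \<forall>t. pair_weight R x t = c t}"
proof -
  let ?t = "transpose k (Suc k)"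
  let ?f = "\<lambda>(g, h). (bk k (\<lambda>_. lam 0) g, bk k (\<lambda>_. lam' 0) h)"
  let ?S = "\<lambda>c. {x \<in> gt_pairs lam mu lam' mu'. \<forall>t. pair_weight R x t = c t}"
  have inv: "?f (?f x) = x" if "x \<in> gt_pairs lam mu lam' mu'" for x
    using that by (auto simp: gt_pairs_def bk_bk)
  have weight: "pair_weight R (?f x) t = pair_weight R x (?t t)"
    if "x \<in> gt_pairs lam mu lam' mu'" for x t
    using that R by (auto simp: gt_pairs_def pair_weight_def gt_weight_bk_full)
  have mem: "?f x \<in> gt_pairs lam mu lam' mu'" if "x \<in> gt_pairs lam mu lam' mu'" for x
    using that by (auto simp: gt_pairs_def gt_chain_bk)
  have closed: "?f x \<in> ?S (\<lambda>t. c (?t t))" if "x \<in> ?S c" for x c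
    using that weight[of x] mem[of x] by simp
  have "bij_betw ?f (?S (\<lambda>t. c (?t t))) (?S c)"
  proof (rule bij_betw_byWitness[where f' = ?f])
    show "?f ` ?S c \<subseteq> ?S (\<lambda>t. c (?t t))" using closed by blast
    show "?f ` ?S (\<lambda>t. c (?t t)) \<subseteq> ?S c" using closed[of _ "\<lambda>t. c (?t t)"] by fastforce
  qed (use inv in simp)+
  then show ?thesis by (rule bij_betw_same_card)
qed

text \<open>The lattice condition is applied to the whole word: column 0 with all half rows
  read.\<close>

lemma yamanouchi_antimono:
  assumes x: "(g, h) \<in> gt_pairs lam mu lam' mu'" and y: "yamanouchi R g h"
  shows "antimono (pair_weight R (g, h))"
  unfolding antimono_iff_le_Suc
proof
  fix k
  have ex: "excess R f k (\<lambda>_. 0) = int (gt_weight R f k) - int (gt_weight R f (Suc k))"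
    if "gt_chain l m f" for f l m
    unfolding int_gt_weight[OF that] by (simp add: excess_def sum_subtractf sum_distrib_left sum.distrib algebra_simps)
  have "0 \<le> pair_excess R g h k 0 (2 * R)" using y by (simp add: yamanouchi_def)
  then show "pair_weight R (g, h) (Suc k) \<le> pair_weight R (g, h) k"
    using x ex[of lam mu g] ex[of lam' mu' h]
    by (simp add: pair_excess_def excess_cut_full gt_pairs_def pair_weight_def)
qed

definition toggle ::
  "nat \<Rightarrow> (nat \<Rightarrow> nat \<Rightarrow> nat) \<times> (nat \<Rightarrow> nat \<Rightarrow> nat) \<Rightarrow> (nat \<Rightarrow> nat \<Rightarrow> nat) \<times> (nat \<Rightarrow> nat \<Rightarrow> nat)" where
  "toggle R = (\<lambda>(g, h). let (k, j, s) = (SOME (k, j, s). first_violation R g h k j s)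
     in (bk k (cut_column 0 j s) g, bk k (cut_column 1 j s) h))"

lemma toggle_eq:
  assumes "first_violation R g h k j s"
  shows "toggle R (g, h) = (bk k (cut_column 0 j s) g, bk k (cut_column 1 j s) h)"
proof -
  have "(SOME (k, j, s). first_violation R g h k j s) = (k, j, s)"
  proof (rule some_equality)
    fix x assume "case x of (k, j, s) \<Rightarrow> first_violation R g h k j s"
    then show "x = (k, j, s)"
      by (cases x) (use first_violation_unique[OF assms] in blast)
  qed (use assms in simp)
  then show ?thesis by (simp add: toggle_def)
qed

text \<open>\<open>toggle R\<close> is an involution on the violating pairs which negates the
  summand, so the sum equals its own negative.\<close>

lemma sum_alt_sign_bad:
  assumes R: "\<forall>r\<ge>R. lam r = 0" "\<forall>r\<ge>R. lam' r = 0"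
    and X: "X = {x \<in> gt_pairs lam mu lam' mu'. \<forall>t\<ge>N. pair_weight R x t = 0}" "finite X"
  shows "(\<Sum>x | x \<in> X \<and> \<not> yamanouchi R (fst x) (snd x). alt_sign N nu (pair_weight R x)) = 0"
    (is "sum ?f ?B = 0")
proof -
  have step: "toggle R x \<in> ?B \<and> toggle R (toggle R x) = x \<and> ?f (toggle R x) = - ?f x"
    if x: "x \<in> ?B" for x
  proof -
    obtain g h where gh: "x = (g, h)" by (cases x)
    have g: "gt_chain lam mu g" and h: "gt_chain lam' mu' h"
      and w: "\<And>t. N \<le> t \<Longrightarrow> pair_weight R x t = 0" and bad: "\<not> yamanouchi R g h"
      using x by (auto simp: gh X(1) gt_pairs_def)
    obtain k j s where first: "first_violation R g h k j s"
      using first_violation_exists[OF g h bad] by blast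
    let ?g = "bk k (cut_column 0 j s) g" and ?h = "bk k (cut_column 1 j s) h"
    have t: "toggle R (g, h) = (?g, ?h)" by (rule toggle_eq[OF first])
    note fb = first_violation_bk[OF g h R first]
    have "toggle R (?g, ?h) = (bk k (cut_column 0 j s) ?g, bk k (cut_column 1 j s) ?h)"
      by (rule toggle_eq[OF fb(1)])
    then have tt: "toggle R (toggle R x) = x"
      unfolding gh t bk_bk[OF g] bk_bk[OF h] .
    have wk: "Suc (pair_weight R (toggle R x) k) = pair_weight R x (Suc k)"
      "pair_weight R (toggle R x) (Suc k) = Suc (pair_weight R x k)"
      "\<And>t. t \<noteq> k \<Longrightarrow> t \<noteq> Suc k \<Longrightarrow> pair_weight R (toggle R x) t = pair_weight R x t"
      using fb(2-4) unfolding gh t pair_weight_def by simp_all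
    \<comment> \<open>The old weight is positive at \<open>k + 1\<close>, so the move stays within
      the first \<open>N\<close> variables.\<close>
    have k: "Suc k < N" using w[of "Suc k"] wk(1) by (cases "Suc k < N") auto
    have "pair_weight R (toggle R x) t = 0" if "N \<le> t" for t
      using wk(3)[of t] w[OF that] k that by auto
    moreover have "\<not> yamanouchi R ?g ?h"
      using fb(1) by (auto simp: first_violation_def yamanouchi_def not_le)
    ultimately have "toggle R x \<in> ?B"
      unfolding X(1) gh t using gt_chain_bk[OF g] gt_chain_bk[OF h] by (simp add: gt_pairs_def)
    moreover have "?f (toggle R x) = - ?f x" by (rule alt_sign_swap[OF k wk])
    ultimately show ?thesis using tt by blast
  qed
  have "sum ?f ?B = (\<Sum>x\<in>?B. - ?f x)"
    by (rule sum.reindex_bij_witness[where i = "toggle R" and j = "toggle R"]) (use step in auto)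
  then show ?thesis by (simp add: sum_negf)
qed

lemma sum_alt_sign_pairs:
  assumes R: "\<forall>r\<ge>R. lam r = 0" "\<forall>r\<ge>R. lam' r = 0"
    and X: "X = {x \<in> gt_pairs lam mu lam' mu'. \<forall>t\<ge>N. pair_weight R x t = 0}" "finite X"
    and nu: "antimono nu" "\<And>i. N \<le> i \<Longrightarrow> nu i = 0"
  shows "(\<Sum>x\<in>X. alt_sign N nu (pair_weight R x)) =
    int (card {x \<in> gt_pairs lam mu lam' mu'. yamanouchi R (fst x) (snd x) \<and> pair_weight R x = nu})"
proof -
  let ?f = "\<lambda>x. alt_sign N nu (pair_weight R x)"
  let ?Y = "{x \<in> X. yamanouchi R (fst x) (snd x)}"
  let ?B = "{x. x \<in> X \<and> \<not> yamanouchi R (fst x) (snd x)}"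
  have "sum ?f X = sum ?f ?Y + sum ?f ?B"
    using X(2) by (subst sum.union_disjoint[symmetric]) (auto intro!: sum.cong)
  also have "sum ?f ?B = 0" by (rule sum_alt_sign_bad[OF R X])
  also have "sum ?f ?Y = (\<Sum>x\<in>?Y. of_bool (pair_weight R x = nu))"
  proof (rule sum.cong[OF refl])
    fix x assume x: "x \<in> ?Y"
    then have "antimono (pair_weight R x)"
      using yamanouchi_antimono[of "fst x" "snd x" lam mu lam' mu' R] by (simp add: X(1))
    moreover have "(\<forall>i<N. pair_weight R x i = nu i) \<longleftrightarrow> pair_weight R x = nu"
      using x nu(2) by (auto simp: X(1) fun_eq_iff) (metis not_less)
    ultimately show "?f x = of_bool (pair_weight R x = nu)"
      by (simp add: alt_sign_antimono nu(1))
  qed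
  also have "\<dots> = int (card {x \<in> ?Y. pair_weight R x = nu})"
    using X(2) by (simp add: Int_def)
  also have "{x \<in> ?Y. pair_weight R x = nu} =
      {x \<in> gt_pairs lam mu lam' mu'. yamanouchi R (fst x) (snd x) \<and> pair_weight R x = nu}"
    using nu(2) by (auto simp: X(1))
  finally show ?thesis by simp
qed

section \<open>Tableaux as chains\<close>

definition tableau_chain ::
  "(nat \<Rightarrow> nat) \<Rightarrow> (nat \<Rightarrow> nat) \<Rightarrow> (nat \<times> nat \<Rightarrow> nat) \<Rightarrow> nat \<Rightarrow> nat \<Rightarrow> nat" where
  "tableau_chain lam mu T t r = mu r + card {c \<in> {mu r..<lam r}. T (r, c) < t}"

definition chain_tableau ::
  "(nat \<Rightarrow> nat) \<Rightarrow> (nat \<Rightarrow> nat) \<Rightarrow> (nat \<Rightarrow> nat \<Rightarrow> nat) \<Rightarrow> nat \<times> nat \<Rightarrow> nat" where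
  "chain_tableau lam mu g = restrict (\<lambda>(r, c). LEAST t. c < g (Suc t) r) (skew_cells lam mu)"

text \<open>The entries below \<open>t\<close> form an initial segment of their row, which is why
  \<open>tableau_chain\<close> can record them by their number.\<close>

lemma initial_segment_eq:
  fixes S :: "nat set"
  assumes fin: "finite S" and ge: "\<And>c. c \<in> S \<Longrightarrow> a \<le> c"
    and closed: "\<And>c c'. c \<in> S \<Longrightarrow> a \<le> c' \<Longrightarrow> c' < c \<Longrightarrow> c' \<in> S"
  shows "S = {a..<a + card S}"
proof -
  have "c < a + card S" if c: "c \<in> S" for c
  proof -
    have "{a..c} \<subseteq> S" using closed[OF c] c by (force simp: le_less)
    then have "card {a..c} \<le> card S" using fin by (rule card_mono[rotated])
    then show ?thesis using ge[OF c] by simp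
  qed
  then have "S \<subseteq> {a..<a + card S}" using ge by auto
  then show ?thesis by (intro card_subset_eq) auto
qed

context
  fixes lam mu :: "nat \<Rightarrow> nat"
  assumes shape: "skew_shape lam mu"
begin

lemma skew_shape_antimono: "i \<le> j \<Longrightarrow> lam j \<le> lam i" "i \<le> j \<Longrightarrow> mu j \<le> mu i" "mu i \<le> lam i"
  using shape by (auto simp: skew_shape_def is_partition_def dest: antimonoD)

lemma tableau_chain_less_iff:
  assumes T: "T \<in> ssyt lam mu" and c: "mu r \<le> c" "c < lam r"
  shows "c < tableau_chain lam mu T t r \<longleftrightarrow> T (r, c) < t"
proof -
  let ?S = "{c \<in> {mu r..<lam r}. T (r, c) < t}"
  have row: "T (r, c') \<le> T (r, c)" if "c' < c" "mu r \<le> c'" "c < lam r" for c c'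
    using T that by (auto simp: ssyt_def skew_cells_def)
  have "?S = {mu r..<mu r + card ?S}"
    by (rule initial_segment_eq) (auto intro: le_less_trans[OF row])
  then have "c \<in> ?S \<longleftrightarrow> c \<in> {mu r..<mu r + card ?S}" by blast
  then show ?thesis using c by (auto simp: tableau_chain_def)
qed

lemma tableau_chain_bounds: "mu r \<le> tableau_chain lam mu T t r" "tableau_chain lam mu T t r \<le> lam r"
proof -
  have "card {c \<in> {mu r..<lam r}. T (r, c) < t} \<le> card {mu r..<lam r}" by (rule card_mono) auto
  then show "tableau_chain lam mu T t r \<le> lam r"
    using skew_shape_antimono(3)[of r] by (simp add: tableau_chain_def)
qed (simp add: tableau_chain_def)

lemma gt_chain_tableau:
  assumes T: "T \<in> ssyt lam mu" shows "gt_chain lam mu (tableau_chain lam mu T)"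
proof -
  let ?g = "tableau_chain lam mu T"
  have fin: "finite (skew_cells lam mu)"
    using shape by (auto simp: skew_shape_def intro: finite_skew_cells)
  have "?g 0 = mu" by (auto simp: tableau_chain_def)
  moreover have "?g t = lam" if "Suc (Max (T ` skew_cells lam mu)) \<le> t" for t
  proof
    fix r
    have "{c \<in> {mu r..<lam r}. T (r, c) < t} = {mu r..<lam r}"
    proof (intro equalityI subsetI)
      fix c assume c: "c \<in> {mu r..<lam r}"
      then have "T (r, c) \<le> Max (T ` skew_cells lam mu)"
        using fin by (intro Max_ge) (auto simp: skew_cells_def)
      then show "c \<in> {c \<in> {mu r..<lam r}. T (r, c) < t}" using that c by simp
    qed simp
    then show "?g t r = lam r" using skew_shape_antimono(3)[of r] by (simp add: tableau_chain_def)
  qed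
  then have "\<exists>N. \<forall>t\<ge>N. ?g t = lam" by blast
  moreover have "?g t r \<le> ?g (Suc t) r" for t r
    unfolding tableau_chain_def by (intro add_left_mono card_mono) auto
  moreover have "?g (Suc t) (Suc r) \<le> ?g t r" for t r
  proof (rule ccontr)
    assume "\<not> ?g (Suc t) (Suc r) \<le> ?g t r"
    then have c: "?g t r < ?g (Suc t) (Suc r)" by simp
    \<comment> \<open>The first column after the entries below \<open>t\<close> in row
      \<open>r\<close>; the cell underneath would hold an entry at most \<open>t\<close>.\<close>
    define c where "c = ?g t r"
    have cell: "mu (Suc r) \<le> c" "c < lam (Suc r)" "mu r \<le> c" "c < lam r"
      using c tableau_chain_bounds(1)[of r T t] tableau_chain_bounds(2)[of T "Suc t" "Suc r"]
        skew_shape_antimono(1,2)[of r "Suc r"] unfolding c_def by linarith+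
    have "T (Suc r, c) < Suc t" using tableau_chain_less_iff[OF T cell(1,2)] c c_def by simp
    moreover have "T (r, c) < T (Suc r, c)"
      using T cell by (auto simp: ssyt_def skew_cells_def)
    ultimately have "c < ?g t r" using tableau_chain_less_iff[OF T cell(3,4)] by simp
    then show False by (simp add: c_def)
  qed
  ultimately show ?thesis unfolding gt_chain_def by blast
qed

lemma chain_tableau_less_iff:
  assumes g: "gt_chain lam mu g" and c: "mu r \<le> c" "c < lam r"
  shows "chain_tableau lam mu g (r, c) < t \<longleftrightarrow> c < g t r"
proof -
  let ?l = "LEAST t. c < g (Suc t) r"
  obtain N where "\<forall>t\<ge>N. g t = lam" using g by (auto simp: gt_chain_def)
  then have "c < g (Suc N) r" using c by simp
  then have l: "c < g (Suc ?l) r" by (rule LeastI)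
  have "?l < t \<longleftrightarrow> c < g t r"
  proof
    assume "?l < t"
    then show "c < g t r" using l gt_chain_mono[OF g, of "Suc ?l" t r] by simp
  next
    assume a: "c < g t r"
    then obtain t' where "t = Suc t'" using g c by (cases t) (auto simp: gt_chain_def)
    then show "?l < t" using a Least_le[of "\<lambda>t. c < g (Suc t) r" t'] by simp
  qed
  then show ?thesis using c by (simp add: chain_tableau_def skew_cells_def)
qed

lemma chain_tableau_ssyt:
  assumes g: "gt_chain lam mu g" shows "chain_tableau lam mu g \<in> ssyt lam mu"
proof -
  let ?T = "chain_tableau lam mu g"
  have "?T (r, c) \<le> ?T (r, c')" if "mu r \<le> c" "c < c'" "c' < lam r" for r c c'
    using chain_tableau_less_iff[OF g, of r c "Suc (?T (r, c'))"]
      chain_tableau_less_iff[OF g, of r c' "Suc (?T (r, c'))"] that by auto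
  moreover have "?T (r, c) < ?T (r', c)"
    if "mu r \<le> c" "c < lam r" "mu r' \<le> c" "c < lam r'" "r < r'" for r r' c
    using chain_tableau_less_iff[OF g that(1,2), of "?T (r', c)"]
      chain_tableau_less_iff[OF g that(3,4), of "Suc (?T (r', c))"]
      gt_chain_strip[OF g that(5), of "?T (r', c)"] by simp
  ultimately show ?thesis by (auto simp: ssyt_def skew_cells_def chain_tableau_def)
qed

lemma chain_tableau_inverse:
  assumes T: "T \<in> ssyt lam mu" shows "chain_tableau lam mu (tableau_chain lam mu T) = T"
proof (rule extensionalityI[where A = "skew_cells lam mu"])
  show "T \<in> extensional (skew_cells lam mu)" using T by (auto simp: ssyt_def PiE_def)
  fix x assume "x \<in> skew_cells lam mu"
  then obtain r c where x: "x = (r, c)" "mu r \<le> c" "c < lam r" by (auto simp: skew_cells_def)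
  then show "chain_tableau lam mu (tableau_chain lam mu T) x = T x"
    using chain_tableau_less_iff[OF gt_chain_tableau[OF T] x(2,3)] tableau_chain_less_iff[OF T x(2,3)]
    by (metis less_irrefl linorder_neqE_nat)
qed (simp add: chain_tableau_def)

lemma tableau_chain_inverse:
  assumes g: "gt_chain lam mu g" shows "tableau_chain lam mu (chain_tableau lam mu g) = g"
proof (intro ext)
  fix t r
  have "{c \<in> {mu r..<lam r}. chain_tableau lam mu g (r, c) < t} = {mu r..<g t r}"
    using chain_tableau_less_iff[OF g, of r _ t] gt_chain_le_outer[OF g, of t r] by auto
  then show "tableau_chain lam mu (chain_tableau lam mu g) t r = g t r"
    using gt_chain_inner_le[OF g, of r t] by (simp add: tableau_chain_def)
qed

lemma count_tableau_weight:
  assumes T: "T \<in> ssyt lam mu" and R: "\<forall>r\<ge>R. lam r = 0"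
  shows "count (tableau_weight lam mu T) t = gt_weight R (tableau_chain lam mu T) t"
proof -
  let ?g = "tableau_chain lam mu T"
  have fin: "finite (skew_cells lam mu)"
    using shape by (auto simp: skew_shape_def intro: finite_skew_cells)
  have "count (tableau_weight lam mu T) t = card {x \<in> skew_cells lam mu. t = T x}"
    using fin by (simp add: tableau_weight_def count_image_mset' Collect_conj_eq Int_commute)
  also have "{x \<in> skew_cells lam mu. t = T x} = (SIGMA r:{..<R}. {?g t r..<?g (Suc t) r})"
  proof (intro equalityI subsetI)
    fix x assume "x \<in> {x \<in> skew_cells lam mu. t = T x}"
    then obtain r c where x: "x = (r, c)" "mu r \<le> c" "c < lam r" "t = T (r, c)"
      by (auto simp: skew_cells_def)
    moreover have "r < R" using R x by (cases "r < R") auto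
    ultimately show "x \<in> (SIGMA r:{..<R}. {?g t r..<?g (Suc t) r})"
      using tableau_chain_less_iff[OF T x(2,3)] by (auto simp: not_less[symmetric])
  next
    fix x assume "x \<in> (SIGMA r:{..<R}. {?g t r..<?g (Suc t) r})"
    then obtain r c where x: "x = (r, c)" "?g t r \<le> c" "c < ?g (Suc t) r" by auto
    then have c: "mu r \<le> c" "c < lam r"
      using tableau_chain_bounds(1)[of r T t] tableau_chain_bounds(2)[of T "Suc t" r] by auto
    then show "x \<in> {x \<in> skew_cells lam mu. t = T x}"
      using tableau_chain_less_iff[OF T c, of t] tableau_chain_less_iff[OF T c, of "Suc t"] x
      by (auto simp: skew_cells_def)
  qed
  also have "card \<dots> = gt_weight R ?g t" by (simp add: gt_weight_def)
  finally show ?thesis .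
qed

lemma bij_betw_tableau_chain:
  assumes R: "\<forall>r\<ge>R. lam r = 0"
  shows "bij_betw (tableau_chain lam mu) {T \<in> ssyt lam mu. tableau_weight lam mu T = m}
    {g. gt_chain lam mu g \<and> gt_weight R g = count m}"
proof (rule bij_betw_byWitness[where f' = "chain_tableau lam mu"])
  show "tableau_chain lam mu ` {T \<in> ssyt lam mu. tableau_weight lam mu T = m} \<subseteq>
      {g. gt_chain lam mu g \<and> gt_weight R g = count m}"
    using gt_chain_tableau count_tableau_weight[OF _ R] by (auto simp: fun_eq_iff)
  show "chain_tableau lam mu ` {g. gt_chain lam mu g \<and> gt_weight R g = count m} \<subseteq>
      {T \<in> ssyt lam mu. tableau_weight lam mu T = m}"
    using chain_tableau_ssyt count_tableau_weight[OF chain_tableau_ssyt R]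
    by (auto simp: tableau_chain_inverse intro!: multiset_eqI)
qed (auto simp: chain_tableau_inverse tableau_chain_inverse)

lemma finite_chains:
  assumes "\<forall>r\<ge>R. lam r = 0"
  shows "finite {g. gt_chain lam mu g \<and> gt_weight R g = count m}"
  using bij_betw_finite[OF bij_betw_tableau_chain[OF assms, where m = m]] finite_ssyt_weight[of lam mu m] shape
  by (simp add: skew_shape_def)

lemma coeff_skew_schur:
  assumes "\<forall>r\<ge>R. lam r = 0"
  shows "series_coeff (skew_schur lam mu) m =
    int (card {g. gt_chain lam mu g \<and> gt_weight R g = count m})"
  using bij_betw_same_card[OF bij_betw_tableau_chain[OF assms, where m = m]] by (simp add: skew_schur_def)

lemma gt_chain_finite_support:
  assumes g: "gt_chain lam mu g" shows "\<exists>m. gt_weight R g = count m"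
proof -
  obtain N where "\<forall>t\<ge>N. g t = lam" using g by (auto simp: gt_chain_def)
  then have zero: "gt_weight R g t = 0" if "N \<le> t" for t using that by (simp add: gt_weight_def)
  have "{t. 0 < gt_weight R g t} \<subseteq> {..<N}"
  proof
    fix t assume "t \<in> {t. 0 < gt_weight R g t}"
    then show "t \<in> {..<N}" using zero[of t] by (cases "N \<le> t") auto
  qed
  then have "finite {t. 0 < gt_weight R g t}" by (rule finite_subset) simp
  then have "count (Abs_multiset (gt_weight R g)) = gt_weight R g" by simp
  then show ?thesis by metis
qed

end

lemma coeff_times:
  "series_coeff (f * g) m = (\<Sum>(a, b) | a + b = m. series_coeff f a * series_coeff g b)"
  by (simp add: times_series_def)

lemma coeff_skew_schur_times:
  assumes shape: "skew_shape lam mu" "skew_shape lam' mu'"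
    and R: "\<forall>r\<ge>R. lam r = 0" "\<forall>r\<ge>R. lam' r = 0"
  shows "finite {x \<in> gt_pairs lam mu lam' mu'. pair_weight R x = count m}"
    and "series_coeff (skew_schur lam mu * skew_schur lam' mu') m =
      int (card {x \<in> gt_pairs lam mu lam' mu'. pair_weight R x = count m})"
proof -
  let ?G = "\<lambda>a. {g. gt_chain lam mu g \<and> gt_weight R g = count a}"
  let ?H = "\<lambda>b. {h. gt_chain lam' mu' h \<and> gt_weight R h = count b}"
  let ?P = "{(a, b). a + b = m}"
  have eq: "{x \<in> gt_pairs lam mu lam' mu'. pair_weight R x = count m} = (\<Union>(a, b)\<in>?P. ?G a \<times> ?H b)"
  proof (intro equalityI subsetI)
    fix x assume x: "x \<in> {x \<in> gt_pairs lam mu lam' mu'. pair_weight R x = count m}"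
    obtain g h where gh: "x = (g, h)" by (cases x)
    obtain a b where "gt_weight R g = count a" "gt_weight R h = count b"
      using x gt_chain_finite_support[OF shape(1), of g R] gt_chain_finite_support[OF shape(2), of h R]
      by (auto simp: gh gt_pairs_def)
    moreover from this have "a + b = m" using x by (auto simp: gh pair_weight_def fun_eq_iff multiset_eq_iff)
    ultimately show "x \<in> (\<Union>(a, b)\<in>?P. ?G a \<times> ?H b)" using x by (auto simp: gh gt_pairs_def)
  qed (auto simp: gt_pairs_def pair_weight_def fun_eq_iff)
  have fin: "finite (?G a)" "finite (?H a)" for a
    using finite_chains[OF shape(1) R(1), where m = a] finite_chains[OF shape(2) R(2), where m = a] by simp_all
  show "finite {x \<in> gt_pairs lam mu lam' mu'. pair_weight R x = count m}"
    unfolding eq using finite_multiset_splits[of m] fin by auto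
  have "card (\<Union>(a, b)\<in>?P. ?G a \<times> ?H b) = (\<Sum>x\<in>?P. card (case x of (a, b) \<Rightarrow> ?G a \<times> ?H b))"
  proof (rule card_UN_disjoint)
    show "\<forall>x\<in>?P. \<forall>y\<in>?P. x \<noteq> y \<longrightarrow>
      (case x of (a, b) \<Rightarrow> ?G a \<times> ?H b) \<inter> (case y of (a, b) \<Rightarrow> ?G a \<times> ?H b) = {}"
      by (auto simp: count_inject)
  qed (use finite_multiset_splits[of m] fin in auto)
  moreover have "series_coeff (skew_schur lam mu) a = int (card (?G a))"
    "series_coeff (skew_schur lam' mu') a = int (card (?H a))" for a
    using coeff_skew_schur[OF shape(1) R(1)] coeff_skew_schur[OF shape(2) R(2)] by simp_all
  ultimately show "series_coeff (skew_schur lam mu * skew_schur lam' mu') m =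
      int (card {x \<in> gt_pairs lam mu lam' mu'. pair_weight R x = count m})"
    unfolding eq coeff_times by (simp add: split_def card_cartesian_product)
qed

section \<open>The Littlewood--Richardson rule for pairs\<close>

lemma sum_gt_weight:
  assumes g: "gt_chain lam mu g" shows "(\<Sum>t<N. gt_weight R g t) + (\<Sum>r<R. mu r) = (\<Sum>r<R. g N r)"
proof (induction N)
  case 0
  then show ?case using g by (simp add: gt_chain_def)
next
  case (Suc N)
  have "(\<Sum>r<R. g (Suc N) r) = gt_weight R g N + (\<Sum>r<R. g N r)"
    unfolding gt_weight_def sum.distrib[symmetric] by (rule sum.cong) (simp_all add: gt_chain_step(1)[OF g])
  then show ?case using Suc by simp
qed

definition pair_size :: "nat \<Rightarrow> (nat \<Rightarrow> nat) \<Rightarrow> (nat \<Rightarrow> nat) \<Rightarrow> (nat \<Rightarrow> nat) \<Rightarrow> (nat \<Rightarrow> nat) \<Rightarrow> nat" where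
  "pair_size R lam mu lam' mu' = (\<Sum>r<R. lam r + lam' r) - (\<Sum>r<R. mu r + mu' r)"

lemma size_eq_sum_count:
  fixes m :: "nat multiset"
  assumes "set_mset m \<subseteq> {..<N}" shows "size m = (\<Sum>i<N. count m i)"
  unfolding size_multiset_overloaded_eq
  by (rule sum.mono_neutral_left) (use assms in \<open>simp_all add: not_in_iff\<close>)

lemma size_pair_weight:
  assumes x: "x \<in> gt_pairs lam mu lam' mu'" and m: "pair_weight R x = count m"
  shows "size m = pair_size R lam mu lam' mu'"
proof -
  obtain g h where gh: "x = (g, h)" by (cases x)
  then have g: "gt_chain lam mu g" and h: "gt_chain lam' mu' h" using x by (auto simp: gt_pairs_def)
  obtain N1 where N1: "\<forall>t\<ge>N1. g t = lam" using g by (auto simp: gt_chain_def)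
  obtain N2 where N2: "\<forall>t\<ge>N2. h t = lam'" using h by (auto simp: gt_chain_def)
  obtain N3 where N3: "set_mset m \<subseteq> {..<N3}" using finite_nat_set_iff_bounded[of "set_mset m"] by (auto simp: subset_iff)
  define N where "N = max N1 (max N2 N3)"
  have "set_mset m \<subseteq> {..<N}" using N3 by (auto simp: N_def less_max_iff_disj)
  then have "size m = (\<Sum>t<N. gt_weight R g t) + (\<Sum>t<N. gt_weight R h t)"
    by (simp add: size_eq_sum_count m[symmetric] gh pair_weight_def sum.distrib)
  moreover have "g N = lam" "h N = lam'" using N1 N2 by (simp_all add: N_def)
  ultimately show ?thesis
    using sum_gt_weight[OF g, of R N] sum_gt_weight[OF h, of R N] by (simp add: pair_size_def sum.distrib)
qed

text \<open>The Littlewood--Richardson multiplicity of \<open>schur nu\<close> in the product, as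
  \<open>skew_schur_times_expansion\<close> shows.\<close>

definition yamanouchi_count ::
  "nat \<Rightarrow> (nat \<Rightarrow> nat) \<Rightarrow> (nat \<Rightarrow> nat) \<Rightarrow> (nat \<Rightarrow> nat) \<Rightarrow> (nat \<Rightarrow> nat) \<Rightarrow> (nat \<Rightarrow> nat) \<Rightarrow> nat" where
  "yamanouchi_count R lam mu lam' mu' nu =
    card {x \<in> gt_pairs lam mu lam' mu'. yamanouchi R (fst x) (snd x) \<and> pair_weight R x = nu}"

context
  fixes lam mu lam' mu' :: "nat \<Rightarrow> nat" and R :: nat
  assumes shape: "skew_shape lam mu" "skew_shape lam' mu'"
    and R: "\<forall>r\<ge>R. lam r = 0" "\<forall>r\<ge>R. lam' r = 0"
begin

lemma coeff_product_symmetric: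
  "series_coeff (skew_schur lam mu * skew_schur lam' mu') (image_mset (transpose k (Suc k)) m) =
   series_coeff (skew_schur lam mu * skew_schur lam' mu') m"
  unfolding coeff_skew_schur_times(2)[OF shape R] fun_eq_iff count_image_transpose
    card_pairs_symmetric[OF R, where c = "count m"] ..

lemma coeff_product_size:
  assumes "size m \<noteq> pair_size R lam mu lam' mu'"
  shows "series_coeff (skew_schur lam mu * skew_schur lam' mu') m = 0"
proof -
  have "{x \<in> gt_pairs lam mu lam' mu'. pair_weight R x = count m} = {}"
    using size_pair_weight assms by blast
  then show ?thesis unfolding coeff_skew_schur_times(2)[OF shape R] by (simp only: card.empty of_nat_0)
qed

lemma sum_alt_sign_coeff_product:
  assumes nu: "antimono nu" "\<And>i. N \<le> i \<Longrightarrow> nu i = 0"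
  shows "(\<Sum>m\<in>multisets_of_size {..<N} (pair_size R lam mu lam' mu').
      alt_sign N nu (count m) * series_coeff (skew_schur lam mu * skew_schur lam' mu') m) =
    int (yamanouchi_count R lam mu lam' mu' nu)"
proof -
  let ?M = "multisets_of_size {..<N} (pair_size R lam mu lam' mu')"
  let ?P = "\<lambda>m. {x \<in> gt_pairs lam mu lam' mu'. pair_weight R x = count m}"
  define X where "X = {x \<in> gt_pairs lam mu lam' mu'. \<forall>t\<ge>N. pair_weight R x t = 0}"
  have eq: "X = (\<Union>m\<in>?M. ?P m)"
  proof (intro equalityI subsetI)
    fix x assume x: "x \<in> X"
    then have sub: "{t. 0 < pair_weight R x t} \<subseteq> {..<N}" by (auto simp: X_def) (metis gr_implies_not0 not_less)
    then have fin: "finite {t. 0 < pair_weight R x t}" by (rule finite_subset) simp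
    define m where "m = Abs_multiset (pair_weight R x)"
    have m: "pair_weight R x = count m" using fin by (simp add: m_def)
    have "set_mset m \<subseteq> {..<N}" using sub unfolding m by simp
    moreover have "size m = pair_size R lam mu lam' mu'"
      using size_pair_weight[OF _ m] x by (simp add: X_def)
    ultimately have "m \<in> ?M" by (simp add: multisets_of_size_def)
    moreover have "x \<in> ?P m" using x m by (simp add: X_def)
    ultimately show "x \<in> (\<Union>m\<in>?M. ?P m)" by blast
  next
    fix x assume "x \<in> (\<Union>m\<in>?M. ?P m)"
    then obtain m where m: "set_mset m \<subseteq> {..<N}" and x: "x \<in> ?P m"
      unfolding multisets_of_size_def by blast
    have "count m t = 0" if "N \<le> t" for t
      using m that by (metis count_inI lessThan_iff not_less subsetD)
    then show "x \<in> X" using x by (simp add: X_def)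
  qed
  have fin: "finite (?P m)" for m by (rule coeff_skew_schur_times(1)[OF shape R])
  have finX: "finite X" unfolding eq using fin by (auto simp: finite_multisets_of_size)
  have "(\<Sum>m\<in>?M. alt_sign N nu (count m) * series_coeff (skew_schur lam mu * skew_schur lam' mu') m) =
      (\<Sum>m\<in>?M. \<Sum>x\<in>?P m. alt_sign N nu (pair_weight R x))"
    by (rule sum.cong[OF refl]) (simp add: coeff_skew_schur_times(2)[OF shape R])
  also have "\<dots> = (\<Sum>x\<in>X. alt_sign N nu (pair_weight R x))"
    unfolding eq by (rule sum.UNION_disjoint[symmetric])
      (use fin in \<open>auto simp: finite_multisets_of_size count_inject\<close>)
  also have "\<dots> = int (yamanouchi_count R lam mu lam' mu' nu)"
    unfolding yamanouchi_count_def by (rule sum_alt_sign_pairs[OF R X_def finX nu])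
  finally show ?thesis .
qed

end

text \<open>The tableau with all entries of row \<open>r\<close> equal to \<open>r\<close>, the only
  one of its shape satisfying the lattice condition.\<close>

definition straight_chain :: "(nat \<Rightarrow> nat) \<Rightarrow> nat \<Rightarrow> nat \<Rightarrow> nat" where
  "straight_chain kappa t r = (if r < t then kappa r else 0)"

lemma gt_chain_straight:
  assumes "is_partition kappa" shows "gt_chain kappa (\<lambda>_. 0) (straight_chain kappa)"
proof -
  obtain N where N: "{j. kappa j \<noteq> 0} \<subseteq> {..<N}"
    using assms finite_nat_set_iff_bounded[of "{j. kappa j \<noteq> 0}"] by (auto simp: is_partition_def subset_iff)
  have "straight_chain kappa t = kappa" if "N \<le> t" for t
    using N that by (force simp: straight_chain_def)
  moreover have "kappa (Suc r) \<le> kappa r" for r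
    using assms by (simp add: is_partition_def antimono_iff_le_Suc)
  ultimately show ?thesis by (auto simp: gt_chain_def straight_chain_def)
qed

lemma yamanouchi_straight:
  assumes "is_partition kappa" shows "yamanouchi R (straight_chain kappa) (\<lambda>_ _. 0)"
  unfolding yamanouchi_def
proof (intro allI)
  fix k j s
  let ?c = "cut_column 0 j s"
  have "kappa (Suc k) \<le> kappa k" using assms by (simp add: is_partition_def antimono_iff_le_Suc)
  then have "kappa (Suc k) - ?c (Suc k) \<le> kappa k - ?c k"
    using cut_column_mono[of 0 j s k] by linarith
  moreover have "excess R (straight_chain kappa) k ?c =
      (\<Sum>r<R. (if r = k then int (kappa k - ?c k) else 0) -
        (if r = Suc k then int (kappa (Suc k) - ?c (Suc k)) else 0))"
    unfolding excess_def by (rule sum.cong) (auto simp: straight_chain_def)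
  ultimately show "0 \<le> pair_excess R (straight_chain kappa) (\<lambda>_ _. 0) k j s"
    by (simp add: pair_excess_def sum_subtractf) (simp add: excess_def)
qed

text \<open>In the first row \<open>r\<close> not filled with \<open>r\<close>, the last entry is
  some \<open>k + 1\<close> with \<open>r \<le> k\<close>. Rows above hold letters smaller than
  \<open>k\<close>, and from row \<open>r\<close> on nothing lies further right, so this
  \<open>k + 1\<close> is read before any \<open>k\<close>.\<close>

lemma yamanouchi_straight_unique:
  assumes kappa: "is_partition kappa" and R: "\<forall>r\<ge>R. kappa r = 0"
    and g: "gt_chain kappa (\<lambda>_. 0) g" and y: "yamanouchi R g (\<lambda>_ _. 0)"
  shows "g = straight_chain kappa"
proof -
  have zero: "t \<le> r \<Longrightarrow> g t r = 0" for t r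
  proof (induction t arbitrary: r)
    case 0
    then show ?case using g by (simp add: gt_chain_def)
  next
    case (Suc t)
    then obtain r' where "r = Suc r'" "t \<le> r'" by (cases r) auto
    then show ?case using gt_chain_step(2)[OF g, of t r'] Suc.IH by simp
  qed
  have full: "g t r = kappa r" if "g (Suc r) r = kappa r" "r < t" for t r
    using gt_chain_mono[OF g, of "Suc r" t r] gt_chain_le_outer[OF g, of t r] that by simp
  have row: "g (Suc r) r = kappa r" for r
  proof (induction r rule: less_induct)
    case (less r)
    show ?case
    proof (rule ccontr)
      assume "g (Suc r) r \<noteq> kappa r"
      then have lt: "g (Suc r) r < kappa r" using gt_chain_le_outer[OF g, of "Suc r" r] by simp
      then have r: "r < R" using R by (cases "r < R") auto
      define v where "v = (LEAST t. g (Suc t) r = kappa r)"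
      obtain M where "\<forall>t\<ge>M. g t = kappa" using g by (auto simp: gt_chain_def)
      then have "g (Suc M) r = kappa r" by simp
      then have v: "g (Suc v) r = kappa r" unfolding v_def by (rule LeastI)
      have "r < v"
      proof (rule ccontr)
        assume "\<not> r < v"
        then show False using gt_chain_mono[OF g, of "Suc v" "Suc r" r] v lt by simp
      qed
      then obtain k where k: "v = Suc k" "r \<le> k" by (cases v) auto
      have "g v r \<noteq> kappa r"
        using not_less_Least[of k "\<lambda>t. g (Suc t) r = kappa r"] k unfolding v_def[symmetric] by simp
      then have n: "g (Suc k) r < kappa r" using gt_chain_le_outer[OF g, of v r] k by simp
      \<comment> \<open>The last column of row \<open>r\<close>. The prefix ending with the cell
        \<open>(r, j)\<close> has \<open>2 * r + 1\<close> half rows of column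
        \<open>j\<close>.\<close>
      define j where "j = kappa r - 1"
      have j: "kappa r = Suc j" using n by (simp add: j_def)
      have above: "g (Suc (Suc k)) r' = kappa r'" "g (Suc k) r' = kappa r'" "g k r' = kappa r'"
        if "r' < r" for r' using full[OF less] that k by auto
      have below: "g t r' \<le> Suc j" if "r \<le> r'" for t r'
      proof -
        have "kappa r' \<le> kappa r" using kappa that by (auto simp: is_partition_def dest: antimonoD)
        then show ?thesis using gt_chain_le_outer[OF g, of t r'] j by simp
      qed
      have "excess R g k (\<lambda>_. Suc j) = 0"
        unfolding excess_def
      proof (rule sum.neutral, rule ballI)
        fix r' show "2 * int (g (Suc k) r' - Suc j) - int (g k r' - Suc j) -
            int (g (Suc (Suc k)) r' - Suc j) = 0"
          using above[of r'] below[of r'] by (cases "r' < r") auto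
      qed
      moreover have "{r'. r' < R \<and> 2 * r' + 0 < 2 * r + 1} = insert r {..<r}" using r by auto
      moreover have "(\<Sum>r'<r. incr g k j r') = 0"
        using above by (intro sum.neutral) (auto simp: incr_def)
      moreover have "incr g k j r = - 1"
        using n v k j gt_chain_step(1)[OF g, of k r] by (auto simp: incr_def)
      ultimately have "pair_excess R g (\<lambda>_ _. 0) k j (2 * r + 1) < 0"
        unfolding pair_excess_def excess_cut[of R g] by (simp add: excess_def)
      then show False using y by (auto simp: yamanouchi_def not_less[symmetric])
    qed
  qed
  show ?thesis
  proof (intro ext)
    fix t r show "g t r = straight_chain kappa t r"
      using zero[of t r] full[OF row, of r t] by (auto simp: straight_chain_def)
  qed
qed

lemma gt_chain_empty: "gt_chain (\<lambda>_. 0) (\<lambda>_. 0) h \<longleftrightarrow> h = (\<lambda>_ _. 0)"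
proof
  assume "gt_chain (\<lambda>_. 0) (\<lambda>_. 0) h"
  then have "h t r = 0" for t r using gt_chain_le_outer[of "\<lambda>_. 0" "\<lambda>_. 0" h t r] by simp
  then show "h = (\<lambda>_ _. 0)" by (intro ext)
qed (simp add: gt_chain_def)

lemma yamanouchi_count_straight:
  assumes kappa: "is_partition kappa" and R: "\<forall>r\<ge>R. kappa r = 0"
  shows "yamanouchi_count R kappa (\<lambda>_. 0) (\<lambda>_. 0) (\<lambda>_. 0) nu = of_bool (nu = kappa)"
proof -
  let ?x = "(straight_chain kappa, \<lambda>_ _. 0)"
  have "pair_weight R ?x t = kappa t" for t
  proof -
    have "pair_weight R ?x t = (\<Sum>r<R. straight_chain kappa (Suc t) r - straight_chain kappa t r)"
      by (simp add: pair_weight_def gt_weight_def)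
    also have "\<dots> = (\<Sum>r<R. if r = t then kappa t else 0)"
      by (rule sum.cong) (auto simp: straight_chain_def)
    finally have "pair_weight R ?x t = (\<Sum>r<R. if r = t then kappa t else 0)" .
    then show ?thesis using R by auto
  qed
  then have w: "pair_weight R ?x = kappa" by (rule ext)
  have "(x \<in> gt_pairs kappa (\<lambda>_. 0) (\<lambda>_. 0) (\<lambda>_. 0) \<and> yamanouchi R (fst x) (snd x)) = (x = ?x)" for x
  proof
    assume x: "x \<in> gt_pairs kappa (\<lambda>_. 0) (\<lambda>_. 0) (\<lambda>_. 0) \<and> yamanouchi R (fst x) (snd x)"
    then have g: "gt_chain kappa (\<lambda>_. 0) (fst x)" and h: "snd x = (\<lambda>_ _. 0)"
      by (auto simp: gt_pairs_def gt_chain_empty)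
    have "fst x = straight_chain kappa"
      by (rule yamanouchi_straight_unique[OF kappa R g]) (use x h in simp)
    then show "x = ?x" using h by (simp add: prod_eq_iff)
  next
    assume "x = ?x"
    then show "x \<in> gt_pairs kappa (\<lambda>_. 0) (\<lambda>_. 0) (\<lambda>_. 0) \<and> yamanouchi R (fst x) (snd x)"
      using gt_chain_straight[OF kappa] yamanouchi_straight[OF kappa] by (simp add: gt_pairs_def gt_chain_empty)
  qed
  then have "{x \<in> gt_pairs kappa (\<lambda>_. 0) (\<lambda>_. 0) (\<lambda>_. 0). yamanouchi R (fst x) (snd x) \<and>
      pair_weight R x = nu} = (if nu = kappa then {?x} else {})"
    using w by (simp add: conj_assoc[symmetric]) auto
  then show ?thesis by (simp add: yamanouchi_count_def)
qed

lemma coeff_simps: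
  "series_coeff 0 m = 0" "series_coeff (f + g) m = series_coeff f m + series_coeff g m"
  "series_coeff (f - g) m = series_coeff f m - series_coeff g m"
  "series_coeff (- f) m = - series_coeff f m"
  "series_coeff 1 m = of_bool (m = {#})"
  by (simp_all add: zero_series_def plus_series_def minus_series_def uminus_series_def one_series_def)

lemma coeff_sum: "series_coeff (\<Sum>x\<in>A. f x) m = (\<Sum>x\<in>A. series_coeff (f x) m)"
  by (induction A rule: infinite_finite_induct) (simp_all add: coeff_simps)

lemma coeff_of_int_times: "series_coeff (of_int c * f) m = c * series_coeff f m"
proof -
  have "series_coeff (of_nat n * f) m = int n * series_coeff f m" for n
    by (induction n) (simp_all add: coeff_simps distrib_right)
  then show ?thesis by (cases c rule: int_cases2) (simp_all add: coeff_simps)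
qed

lemma skew_shape_empty: "is_partition kappa \<Longrightarrow> skew_shape kappa (\<lambda>_. 0)"
  by (auto simp: skew_shape_def is_partition_def monotone_on_def)

lemma is_partition_zero: "is_partition (\<lambda>_. 0)"
  by (simp add: is_partition_def monotone_on_def)

text \<open>This turns a single Schur function into a product of two factors, to which the results
  on pairs apply.\<close>

lemma skew_schur_empty: "skew_schur (\<lambda>_. 0) (\<lambda>_. 0) = 1"
proof (rule series_eqI)
  fix m
  have "gt_weight 0 h = count m \<longleftrightarrow> m = {#}" for h
    by (auto simp: gt_weight_def fun_eq_iff multiset_eq_iff)
  then have "{g. gt_chain (\<lambda>_. 0) (\<lambda>_. 0) g \<and> gt_weight 0 g = count m} =
      (if m = {#} then {\<lambda>_ _. 0} else {})"
    by (auto simp: gt_chain_empty)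
  then show "series_coeff (skew_schur (\<lambda>_. 0) (\<lambda>_. 0)) m = series_coeff 1 m"
    using coeff_skew_schur[OF skew_shape_empty[OF is_partition_zero], of 0 m] by (simp add: coeff_simps)
qed

definition partitions_of :: "nat \<Rightarrow> (nat \<Rightarrow> nat) set" where
  "partitions_of d = {nu. antimono nu \<and> (\<forall>i\<ge>d. nu i = 0) \<and> (\<Sum>i<d. nu i) = d}"

lemma partitions_ofI:
  assumes nu: "antimono nu" "\<And>i. N \<le> i \<Longrightarrow> nu i = 0" "(\<Sum>i<N. nu i) = d"
  shows "nu \<in> partitions_of d"
proof -
  have zero: "nu i = 0" if "d \<le> i" for i
  proof (rule ccontr)
    assume i: "nu i \<noteq> 0"
    then have "i < N" using nu(2)[of i] by (cases "i < N") auto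
    have "Suc i = (\<Sum>j<Suc i. 1)" by simp
    also have "\<dots> \<le> (\<Sum>j<Suc i. nu j)"
    proof (rule sum_mono)
      fix j assume "j \<in> {..<Suc i}"
      then show "1 \<le> nu j" using i antimonoD[OF nu(1), of j i] by simp
    qed
    also have "\<dots> \<le> (\<Sum>j<N. nu j)" using \<open>i < N\<close> by (intro sum_mono2) auto
    finally show False using nu(3) that by simp
  qed
  have "(\<Sum>i<d. nu i) = (\<Sum>i<max d N. nu i)"
    using zero by (intro sum.mono_neutral_left) auto
  also have "\<dots> = (\<Sum>i<N. nu i)" using nu(2) by (intro sum.mono_neutral_right) auto
  finally show ?thesis using nu zero by (simp add: partitions_of_def)
qed

lemma is_partition_partitions_of:
  assumes "nu \<in> partitions_of d" shows "is_partition nu"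
proof -
  have "{j. nu j \<noteq> 0} \<subseteq> {..<d}"
  proof
    fix j assume "j \<in> {j. nu j \<noteq> 0}"
    then show "j \<in> {..<d}" using assms by (cases "d \<le> j") (auto simp: partitions_of_def)
  qed
  then have "finite {j. nu j \<noteq> 0}" by (rule finite_subset) simp
  then show ?thesis using assms by (simp add: is_partition_def partitions_of_def)
qed

lemma finite_partitions_of: "finite (partitions_of d)"
proof (rule finite_subset)
  show "partitions_of d \<subseteq> {f. \<forall>i. (i \<in> {..<d} \<longrightarrow> f i \<in> {..d}) \<and> (i \<notin> {..<d} \<longrightarrow> f i = 0)}"
  proof
    fix nu assume nu: "nu \<in> partitions_of d"
    then have "nu i \<le> d" if "i < d" for i
      using member_le_sum[of i "{..<d}" nu] that by (simp add: partitions_of_def)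
    then show "nu \<in> {f. \<forall>i. (i \<in> {..<d} \<longrightarrow> f i \<in> {..d}) \<and> (i \<notin> {..<d} \<longrightarrow> f i = 0)}"
      using nu by (simp add: partitions_of_def)
  qed
qed (rule finite_set_of_finite_funs, simp_all)

text \<open>The difference of the two sides is symmetric and homogeneous, and its alternating sums
  vanish: those of the product are the multiplicities, those of a single Schur function are an
  indicator. Hence \<open>symmetric_eq_zero\<close> applies.\<close>

theorem skew_schur_times_expansion:
  assumes shape: "skew_shape lam mu" "skew_shape lam' mu'"
    and R: "\<forall>r\<ge>R. lam r = 0" "\<forall>r\<ge>R. lam' r = 0"
  shows "skew_schur lam mu * skew_schur lam' mu' =
    (\<Sum>nu\<in>partitions_of (pair_size R lam mu lam' mu').
      of_int (int (yamanouchi_count R lam mu lam' mu' nu)) * schur nu)"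
proof (rule series_eqI)
  fix m
  define d where "d = pair_size R lam mu lam' mu'"
  let ?y = "\<lambda>nu. int (yamanouchi_count R lam mu lam' mu' nu)"
  let ?z = "\<lambda>_. 0 :: nat"
  define f where "f m = series_coeff (skew_schur lam mu * skew_schur lam' mu') m -
    (\<Sum>nu\<in>partitions_of d. ?y nu * series_coeff (schur nu) m)" for m
  note z = skew_shape_empty[OF is_partition_zero]
  have schur: "schur nu = skew_schur nu ?z * skew_schur ?z ?z" for nu
    by (simp add: schur_def skew_schur_empty)
  have shape_nu: "skew_shape nu ?z" if "nu \<in> partitions_of d" for nu
    by (rule skew_shape_empty[OF is_partition_partitions_of[OF that]])
  have R_nu: "\<forall>r\<ge>d. nu r = 0" if "nu \<in> partitions_of d" for nu
    using that by (simp add: partitions_of_def)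
  have size_nu: "pair_size d nu ?z ?z ?z = d" if "nu \<in> partitions_of d" for nu
    using that by (simp add: partitions_of_def pair_size_def)
  have "f m = 0"
  proof (cases "size m = d")
    case False
    have "series_coeff (schur nu) m = 0" if nu: "nu \<in> partitions_of d" for nu
      unfolding schur
      by (rule coeff_product_size[OF shape_nu[OF nu] z R_nu[OF nu]]) (use False size_nu[OF nu] in auto)
    then show ?thesis using coeff_product_size[OF shape R, of m] False by (simp add: f_def d_def)
  next
    case True
    obtain N0 where N0: "set_mset m \<subseteq> {..<N0}" using finite_nat_set_iff_bounded[of "set_mset m"] by (auto simp: subset_iff)
    define N where "N = max N0 d"
    show ?thesis
    proof (rule symmetric_eq_zero[where f = f and N = N and d = d])
      show "m \<in> multisets_of_size {..<N} d"
        using N0 True by (auto simp: multisets_of_size_def N_def less_max_iff_disj)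
      fix m' k
      have "series_coeff (schur nu) (image_mset (transpose k (Suc k)) m') = series_coeff (schur nu) m'"
        if nu: "nu \<in> partitions_of d" for nu
        unfolding schur by (rule coeff_product_symmetric[OF shape_nu[OF nu] z R_nu[OF nu]]) simp_all
      then show "f (image_mset (transpose k (Suc k)) m') = f m'"
        unfolding f_def coeff_product_symmetric[OF shape R] by simp
    next
      fix nu assume nu: "antimono nu" "\<And>i. N \<le> i \<Longrightarrow> nu i = 0" "(\<Sum>i<N. nu i) = d"
      let ?M = "multisets_of_size {..<N} d"
      have 1: "(\<Sum>m\<in>?M. alt_sign N nu (count m) * series_coeff (skew_schur lam mu * skew_schur lam' mu') m)
          = ?y nu"
        using sum_alt_sign_coeff_product[OF shape R nu(1,2)] by (simp add: d_def)
      have 2: "(\<Sum>m\<in>?M. alt_sign N nu (count m) * series_coeff (schur kappa) m) = of_bool (nu = kappa)"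
        if k: "kappa \<in> partitions_of d" for kappa
        using sum_alt_sign_coeff_product[OF shape_nu[OF k] z R_nu[OF k] _ nu(1,2)] size_nu[OF k]
          yamanouchi_count_straight[OF is_partition_partitions_of[OF k] R_nu[OF k], of nu]
        by (simp add: schur)
      have "(\<Sum>m\<in>?M. alt_sign N nu (count m) * f m) =
          ?y nu - (\<Sum>m\<in>?M. \<Sum>kappa\<in>partitions_of d.
            ?y kappa * (alt_sign N nu (count m) * series_coeff (schur kappa) m))"
        unfolding f_def right_diff_distrib sum_subtractf 1 by (simp add: sum_distrib_left mult.left_commute)
      also have "\<dots> = ?y nu - (\<Sum>kappa\<in>partitions_of d. ?y kappa * of_bool (nu = kappa))"
        by (subst sum.swap) (simp add: sum_distrib_left[symmetric] 2)
      also have "\<dots> = 0" using partitions_ofI[OF nu] finite_partitions_of[of d] by (simp add: if_distrib sum.delta' of_bool_def cong: if_cong)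
      finally show "(\<Sum>m\<in>?M. alt_sign N nu (count m) * f m) = 0" .
    qed
  qed
  then show "series_coeff (skew_schur lam mu * skew_schur lam' mu') m =
      series_coeff (\<Sum>nu\<in>partitions_of (pair_size R lam mu lam' mu').
        of_int (?y nu) * schur nu) m"
    by (simp only: coeff_sum coeff_of_int_times f_def d_def)
qed

section \<open>Exchanging components\<close>

text \<open>
  A chain is a function on the nodes \<open>(t, r)\<close> which is monotone along \<open>gt_edges\<close>. For two such
  functions, an edge is linked if exchanging the values at only one of its ends could destroy
  monotonicity; this depends only on the unordered pairs of values.
\<close>

definition gt_edges :: "((nat \<times> nat) \<times> (nat \<times> nat)) set" where
  "gt_edges = {((t, r), (Suc t, r)) | t r. True} \<union> {((Suc t, Suc r), (t, r)) | t r. True}"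

definition linked ::
  "(nat \<times> nat \<Rightarrow> nat) \<Rightarrow> (nat \<times> nat \<Rightarrow> nat) \<Rightarrow> ((nat \<times> nat) \<times> (nat \<times> nat)) set" where
  "linked u v = {(p, q) \<in> gt_edges. min (u q) (v q) < max (u p) (v p)}"

definition linked_to where
  "linked_to E u v = (linked u v \<union> (linked u v)\<inverse>)\<^sup>* `` E"

definition exchange :: "'a set \<Rightarrow> ('a \<Rightarrow> 'b) \<Rightarrow> ('a \<Rightarrow> 'b) \<Rightarrow> 'a \<Rightarrow> 'b" where
  "exchange S u v p = (if p \<in> S then v p else u p)"

text \<open>The exchanged set can therefore be recomputed from the result, which makes the exchange
  injective.\<close>

lemma linked_exchange: "linked (exchange S u v) (exchange S v u) = linked u v"
proof -
  have "min (exchange S u v q) (exchange S v u q) = min (u q) (v q)"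
    "max (exchange S u v q) (exchange S v u q) = max (u q) (v q)" for q
    by (simp_all add: exchange_def min.commute max.commute)
  then show ?thesis by (simp add: linked_def)
qed

lemma linked_to_exchange: "linked_to E (exchange S u v) (exchange S v u) = linked_to E u v"
  by (simp add: linked_to_def linked_exchange)

lemma linked_to_step:
  "p \<in> linked_to E u v \<Longrightarrow> (p, q) \<in> linked u v \<union> (linked u v)\<inverse> \<Longrightarrow> q \<in> linked_to E u v"
  unfolding linked_to_def Image_def by (blast intro: rtrancl_into_rtrancl)

context
  fixes u v :: "nat \<times> nat \<Rightarrow> nat" and E
  assumes edges: "\<forall>(p, q)\<in>gt_edges. u p \<le> u q \<and> v p \<le> v q"
    and seeds: "\<forall>p\<in>E. u p < v p"
begin

lemma edge_mono: "(p, q) \<in> gt_edges \<Longrightarrow> u p \<le> u q \<and> v p \<le> v q"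
  using edges by blast

text \<open>Let \<open>(p, q)\<close> be linked. If \<open>u p < v p\<close>, then
  \<open>u q < v p \<le> v q\<close>; if \<open>u q < v q\<close>, then
  \<open>u p \<le> u q < v p\<close>. So the strict inequality spreads from the seeds in both
  directions.\<close>

lemma linked_to_less:
  assumes "p \<in> linked_to E u v" shows "u p < v p"
proof -
  obtain e where e: "e \<in> E" "(e, p) \<in> (linked u v \<union> (linked u v)\<inverse>)\<^sup>*"
    using assms by (auto simp: linked_to_def)
  from e(2) show ?thesis
  proof (induction rule: rtrancl_induct)
    case base
    then show ?case using seeds e(1) by blast
  next
    case (step p q)
    then consider "(p, q) \<in> linked u v" | "(q, p) \<in> linked u v" by auto
    then show ?case
      using step.IH edge_mono[of p q] edge_mono[of q p] by cases (auto simp: linked_def min_def max_def split: if_splits)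
  qed
qed

text \<open>An edge with just one end in the component is not linked, so both values at its lower
  end are at most both values at its upper end.\<close>

lemma exchange_mono:
  assumes pq: "(p, q) \<in> gt_edges"
  shows "exchange (linked_to E u v) u v p \<le> exchange (linked_to E u v) u v q"
    and "exchange (linked_to E u v) v u p \<le> exchange (linked_to E u v) v u q"
proof -
  have "max (u p) (v p) \<le> min (u q) (v q)" if "(p \<in> linked_to E u v) \<noteq> (q \<in> linked_to E u v)"
  proof (rule ccontr)
    assume "\<not> ?thesis"
    then have "(p, q) \<in> linked u v" using pq unfolding linked_def not_le by blast
    then have "(p \<in> linked_to E u v) = (q \<in> linked_to E u v)"
      using linked_to_step[of p E u v q] linked_to_step[of q E u v p] by blast
    then show False using that by simp
  qed
  then show "exchange (linked_to E u v) u v p \<le> exchange (linked_to E u v) u v q"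
    and "exchange (linked_to E u v) v u p \<le> exchange (linked_to E u v) v u q"
    using edge_mono[OF pq] by (auto simp: exchange_def)
qed

end

lemma exchange_exchange: "exchange S (exchange S u v) (exchange S v u) = u"
  by (rule ext) (simp add: exchange_def)

lemma gt_chain_iff_edges:
  "gt_chain lam mu g \<longleftrightarrow> g 0 = mu \<and> (\<exists>N. \<forall>t\<ge>N. g t = lam) \<and>
     (\<forall>p q. (p, q) \<in> gt_edges \<longrightarrow> case_prod g p \<le> case_prod g q)"
proof -
  have "(\<forall>p q. (p, q) \<in> gt_edges \<longrightarrow> P p q) \<longleftrightarrow>
      (\<forall>t r. P (t, r) (Suc t, r) \<and> P (Suc t, Suc r) (t, r))" for P
    unfolding gt_edges_def by blast
  from this[of "\<lambda>p q. case_prod g p \<le> case_prod g q"] show ?thesis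
    unfolding gt_chain_def prod.case by argo
qed

lemma pair_excess_even: "pair_excess R g h k j (2 * r) =
    excess R g k (cut_column 0 j (2 * r)) + excess R h k (cut_column 0 j (2 * r))"
proof -
  have "cut_column 1 j (2 * r) = cut_column 0 j (2 * r)" by (auto simp: cut_column_def fun_eq_iff)
  then show ?thesis by (simp add: pair_excess_def)
qed

lemma pair_excess_half:
  assumes "r < R"
  shows "pair_excess R g h k j (2 * r + 1) = pair_excess R g h k j (2 * r) + incr g k j r"
    and "pair_excess R g h k j (2 * r + 2) = pair_excess R g h k j (2 * r + 1) + incr h k j r"
proof -
  have sets: "{a. a < R \<and> 2 * a + 0 < 2 * r + 1} = insert r {a. a < R \<and> 2 * a + 0 < 2 * r}"
    "{a. a < R \<and> 2 * a + 1 < 2 * r + 2} = insert r {a. a < R \<and> 2 * a + 1 < 2 * r + 1}"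
    "{a. a < R \<and> 2 * a + 1 < 2 * r + 1} = {a. a < R \<and> 2 * a + 1 < 2 * r}"
    "{a. a < R \<and> 2 * a + 0 < 2 * r + 2} = {a. a < R \<and> 2 * a + 0 < 2 * r + 1}"
    using assms by auto presburger
  show "pair_excess R g h k j (2 * r + 1) = pair_excess R g h k j (2 * r) + incr g k j r"
    unfolding pair_excess_def excess_cut sets(1,3) by simp
  show "pair_excess R g h k j (2 * r + 2) = pair_excess R g h k j (2 * r + 1) + incr h k j r"
    unfolding pair_excess_def excess_cut sets(2,4) by simp
qed

lemma pair_excess_beyond:
  assumes "2 * R \<le> s" shows "pair_excess R g h k j s = pair_excess R g h k j (2 * R)"
  using assms by (simp add: pair_excess_def excess_cut_full)

text \<open>Prefixes consisting of whole rows count both values at a node with the same cut, so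
  their excess is unchanged. A new violation inside row \<open>r\<close> needs \<open>k + 1\<close>
  in \<open>g'\<close> and \<open>k\<close> in \<open>h'\<close> at \<open>(r, j)\<close>. As the
  exchange only enlarges values of the first chain, \<open>g\<close> has its \<open>k + 1\<close>
  there too, and the violation is not new.\<close>

lemma yamanouchi_exchange:
  fixes g h R S
  defines "g' \<equiv> curry (exchange S (case_prod g) (case_prod h))"
    and "h' \<equiv> curry (exchange S (case_prod h) (case_prod g))"
  assumes less: "\<And>t r. (t, r) \<in> S \<Longrightarrow> g t r < h t r"
    and g': "gt_chain lam mu g'" and h': "gt_chain lam' mu' h'" and y: "yamanouchi R g h"
  shows "yamanouchi R g' h'"
  unfolding yamanouchi_def
proof (intro allI)
  fix k j s
  let ?D = "pair_excess R g h k j" and ?D' = "pair_excess R g' h' k j"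
  have val: "g' t r = g t r \<and> h' t r = h t r \<or> g' t r = h t r \<and> h' t r = g t r \<and> g t r < h t r" for t r
    using less by (auto simp: g'_def h'_def exchange_def)
  have D: "0 \<le> ?D s" for s using y by (simp add: yamanouchi_def)
  have swap: "f (g' t r) + f (h' t r) = f (g t r) + f (h t r)" for f :: "nat \<Rightarrow> int" and t r
    using val[of t r] by auto
  have even: "?D' (2 * r) = ?D (2 * r)" for r
    unfolding pair_excess_even excess_def sum.distrib[symmetric]
  proof (rule sum.cong[OF refl])
    fix a
    let ?f = "\<lambda>x. int (x - cut_column 0 j (2 * r) a)"
    show "2 * ?f (g' (Suc k) a) - ?f (g' k a) - ?f (g' (Suc (Suc k)) a) +
        (2 * ?f (h' (Suc k) a) - ?f (h' k a) - ?f (h' (Suc (Suc k)) a)) =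
        2 * ?f (g (Suc k) a) - ?f (g k a) - ?f (g (Suc (Suc k)) a) +
        (2 * ?f (h (Suc k) a) - ?f (h k a) - ?f (h (Suc (Suc k)) a))"
      using swap[of ?f k a] swap[of ?f "Suc k" a] swap[of ?f "Suc (Suc k)" a] by linarith
  qed
  have odd: "0 \<le> ?D' (2 * r + 1)" if r: "r < R" for r
  proof (rule ccontr)
    assume "\<not> 0 \<le> ?D' (2 * r + 1)"
    then have neg: "?D' (2 * r + 1) < 0" by simp
    have "0 \<le> ?D' (2 * r)" "0 \<le> ?D' (2 * r + 2)" using even[of r] even[of "Suc r"] D by simp_all
    then have incr: "incr g' k j r < 0" "0 < incr h' k j r"
      using neg unfolding pair_excess_half[OF r] by linarith+
    then have h: "j < h' (Suc k) r" "j < h' (Suc (Suc k)) r" "h' k r \<le> j"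
      using gt_chain_step(1)[OF h', of "Suc k" r] gt_chain_step(1)[OF h', of k r]
      by (auto simp: incr_def of_bool_def split: if_splits)
    have g: "g' (Suc k) r \<le> j" "j < g' (Suc (Suc k)) r"
      using incr(1) by (simp_all add: incr_neg_iff[OF g'])
    have "g (Suc k) r \<le> j" using val[of "Suc k" r] g h by auto
    moreover have "j < g (Suc (Suc k)) r" using val[of "Suc (Suc k)" r] g h by auto
    ultimately have "incr g k j r \<le> - 1" by (simp add: incr_def)
    then have "incr g k j r \<le> incr g' k j r" using incr_ge[OF g', of k j r] by simp
    then have "?D (2 * r + 1) \<le> ?D' (2 * r + 1)"
      unfolding pair_excess_half[OF r] even by simp
    then show False using neg D[of "2 * r + 1"] by simp
  qed
  show "0 \<le> ?D' s"
  proof (cases "s < 2 * R")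
    case True
    define r where "r = s div 2"
    then have r: "r < R" "s = 2 * r \<or> s = 2 * r + 1" using True by auto
    from r(2) show ?thesis
    proof
      assume "s = 2 * r"
      then show ?thesis using even[of r] D[of s] by simp
    qed (use odd[OF r(1)] in simp)
  next
    case False
    then show ?thesis using pair_excess_beyond[of R s] even[of R] D by simp
  qed
qed

section \<open>Row-wise maxima and minima\<close>

lemma is_partition_max:
  assumes "is_partition a" "is_partition b" shows "is_partition (\<lambda>r. max (a r) (b r))"
proof -
  have "finite {j. max (a j) (b j) \<noteq> 0}"
    by (rule finite_subset[of _ "{j. a j \<noteq> 0} \<union> {j. b j \<noteq> 0}"])
      (use assms in \<open>auto simp: is_partition_def\<close>)
  moreover have "max (a (Suc n)) (b (Suc n)) \<le> max (a n) (b n)" for n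
    using assms by (intro max.mono) (simp_all add: is_partition_def antimono_iff_le_Suc)
  ultimately show ?thesis unfolding is_partition_def antimono_iff_le_Suc by blast
qed

lemma is_partition_min:
  assumes "is_partition a" "is_partition b" shows "is_partition (\<lambda>r. min (a r) (b r))"
proof -
  have "finite {j. min (a j) (b j) \<noteq> 0}"
    by (rule finite_subset[of _ "{j. a j \<noteq> 0}"]) (use assms in \<open>auto simp: is_partition_def\<close>)
  moreover have "min (a (Suc n)) (b (Suc n)) \<le> min (a n) (b n)" for n
    using assms by (intro min.mono) (simp_all add: is_partition_def antimono_iff_le_Suc)
  ultimately show ?thesis unfolding is_partition_def antimono_iff_le_Suc by blast
qed

lemma skew_shape_max_min:
  assumes "skew_shape lam mu" "skew_shape lam' mu'"
  shows "skew_shape (\<lambda>r. max (lam r) (lam' r)) (\<lambda>r. max (mu r) (mu' r))"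
    and "skew_shape (\<lambda>r. min (lam r) (lam' r)) (\<lambda>r. min (mu r) (mu' r))"
  unfolding skew_shape_def
  by (intro conjI allI is_partition_max is_partition_min max.mono min.mono;
      use assms in \<open>simp add: skew_shape_def\<close>)+

lemma gt_chain_eventually:
  assumes g: "gt_chain lam mu g" and R: "\<forall>r\<ge>R. lam r = 0"
    and w: "\<And>t. N \<le> t \<Longrightarrow> gt_weight R g t = 0" and t: "N \<le> t"
  shows "g t = lam"
proof -
  have step: "g (Suc t) = g t" if t: "N \<le> t" for t
  proof
    fix r show "g (Suc t) r = g t r"
    proof (cases "r < R")
      case True
      then have "g (Suc t) r - g t r = 0" using w[OF t] by (simp add: gt_weight_def)
      then show ?thesis using gt_chain_step(1)[OF g, of t r] by linarith
    next
      case False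
      then show ?thesis using R gt_chain_le_outer[OF g, of "Suc t" r] gt_chain_le_outer[OF g, of t r] by simp
    qed
  qed
  obtain M where M: "\<forall>t\<ge>M. g t = lam" using g by (auto simp: gt_chain_def)
  have "g (t + i) = g t" for i using t by (induction i) (simp_all add: step)
  then show ?thesis using M[rule_format, of "t + M"] by simp
qed

text \<open>Since \<open>g < h\<close> on the whole component, it meets the innermost and outermost
  layers exactly in the seeds, so there the exchange produces row-wise maxima and minima.\<close>

lemma yamanouchi_count_le:
  fixes lam mu lam' mu' :: "nat \<Rightarrow> nat"
  defines "lmax \<equiv> \<lambda>r. max (lam r) (lam' r)" and "mmax \<equiv> \<lambda>r. max (mu r) (mu' r)"
    and "lmin \<equiv> \<lambda>r. min (lam r) (lam' r)" and "mmin \<equiv> \<lambda>r. min (mu r) (mu' r)"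
  assumes shape: "skew_shape lam mu" "skew_shape lam' mu'"
    and R: "\<forall>r\<ge>R. lam r = 0" "\<forall>r\<ge>R. lam' r = 0"
    and nu: "\<forall>i\<ge>N. nu i = 0"
  shows "yamanouchi_count R lam mu lam' mu' nu \<le> yamanouchi_count R lmax mmax lmin mmin nu"
proof -
  \<comment> \<open>As \<open>nu\<close> vanishes from \<open>N\<close> on, both chains have reached
    their outer shapes at these layers. The seeds thus depend on the shapes alone and are the same
    for all pairs, as recovering the component requires.\<close>
  define E where "E = {(t, r) | t r. t = 0 \<and> mu r < mu' r \<or> N \<le> t \<and> lam r < lam' r}"
  define S where "S x = linked_to E (case_prod (fst x)) (case_prod (snd x))" for x
  define F where "F x =
    (curry (exchange (S x) (case_prod (fst x)) (case_prod (snd x))),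
     curry (exchange (S x) (case_prod (snd x)) (case_prod (fst x))))" for x
  define A where "A = {x \<in> gt_pairs lam mu lam' mu'. yamanouchi R (fst x) (snd x) \<and> pair_weight R x = nu}"
  define B where "B = {x \<in> gt_pairs lmax mmax lmin mmin. yamanouchi R (fst x) (snd x) \<and> pair_weight R x = nu}"
  have SF: "S (F x) = S x" for x
    by (simp add: S_def F_def linked_to_exchange)
  have inj: "inj_on F A"
  proof (rule inj_on_inverseI[where g = "\<lambda>y.
      (curry (exchange (S y) (case_prod (fst y)) (case_prod (snd y))),
       curry (exchange (S y) (case_prod (snd y)) (case_prod (fst y))))"])
    fix x show "(curry (exchange (S (F x)) (case_prod (fst (F x))) (case_prod (snd (F x)))),
        curry (exchange (S (F x)) (case_prod (snd (F x))) (case_prod (fst (F x))))) = x"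
      unfolding SF by (simp add: F_def exchange_exchange)
  qed
  have F: "F x \<in> B" if x: "x \<in> A" for x
  proof -
    obtain g h where gh: "x = (g, h)" by (cases x)
    have g: "gt_chain lam mu g" and h: "gt_chain lam' mu' h"
      and y: "yamanouchi R g h" and w: "pair_weight R (g, h) = nu"
      using x by (auto simp: A_def gh gt_pairs_def)
    have "gt_weight R g t + gt_weight R h t = nu t" for t
      using fun_cong[OF w, of t] by (simp add: pair_weight_def)
    then have "gt_weight R g t = 0" "gt_weight R h t = 0" if "N \<le> t" for t
      using nu that by (metis add_is_0)+
    then have top: "g t = lam" "h t = lam'" if "N \<le> t" for t
      using gt_chain_eventually[OF g R(1) _ that] gt_chain_eventually[OF h R(2) _ that] by blast+
    have bottom: "g 0 = mu" "h 0 = mu'" using g h by (simp_all add: gt_chain_def)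
    let ?u = "case_prod g" and ?v = "case_prod h"
    define g' where "g' = curry (exchange (S x) ?u ?v)"
    define h' where "h' = curry (exchange (S x) ?v ?u)"
    have mono: "\<forall>(p, q)\<in>gt_edges. ?u p \<le> ?u q \<and> ?v p \<le> ?v q"
      using g h unfolding gt_chain_iff_edges by blast
    have seeds: "\<forall>p\<in>E. ?u p < ?v p"
      using top bottom by (auto simp: E_def)
    have S: "S x = linked_to E ?u ?v" by (simp add: S_def gh)
    have less: "g t r < h t r" if "(t, r) \<in> S x" for t r
      using linked_to_less[OF mono seeds, of "(t, r)"] that by (simp add: S)
    have sub: "E \<subseteq> S x" by (auto simp: S linked_to_def)
    have val: "g' t r = (if (t, r) \<in> S x then h t r else g t r)"
        "h' t r = (if (t, r) \<in> S x then g t r else h t r)" for t r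
      by (simp_all add: g'_def h'_def exchange_def)
    have edges: "case_prod g' p \<le> case_prod g' q \<and> case_prod h' p \<le> case_prod h' q"
      if "(p, q) \<in> gt_edges" for p q
      using exchange_mono[OF mono seeds that] by (simp add: g'_def h'_def S)
    have "(0, r) \<in> S x \<longleftrightarrow> mu r < mu' r" for r
      using less[of 0 r] sub by (auto simp: bottom E_def)
    then have bottom': "g' 0 = mmax" "h' 0 = mmin"
      by (auto simp: val bottom mmax_def mmin_def)
    have "(t, r) \<in> S x \<longleftrightarrow> lam r < lam' r" if "N \<le> t" for t r
      using less[of t r] sub top[OF that] that by (auto simp: E_def)
    then have top': "g' t = lmax" "h' t = lmin" if "N \<le> t" for t
      using that by (auto simp: val top lmax_def lmin_def)
    have g': "gt_chain lmax mmax g'" and h': "gt_chain lmin mmin h'"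
      using edges bottom' top' unfolding gt_chain_iff_edges by blast+
    have sum: "int (\<Sum>r<R. g' t r) + int (\<Sum>r<R. h' t r) = int (\<Sum>r<R. g t r) + int (\<Sum>r<R. h t r)" for t
      unfolding of_nat_sum sum.distrib[symmetric] by (rule sum.cong) (auto simp: val)
    have "pair_weight R (g', h') t = pair_weight R (g, h) t" for t
      using sum[of t] sum[of "Suc t"] int_gt_weight[OF g, of R t] int_gt_weight[OF h, of R t]
        int_gt_weight[OF g', of R t] int_gt_weight[OF h', of R t]
      unfolding pair_weight_def prod.case by linarith
    then have "pair_weight R (g', h') = nu" using w by (metis ext)
    moreover have "yamanouchi R g' h'"
      using yamanouchi_exchange[of "S x" g h lmax mmax lmin mmin R] less g' h' y by (simp add: g'_def h'_def)
    moreover have "F x = (g', h')" by (simp add: F_def g'_def h'_def gh)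
    ultimately show ?thesis using g' h' by (simp add: B_def gt_pairs_def)
  qed
  have "finite {i. 0 < nu i}"
  proof (rule finite_subset)
    show "{i. 0 < nu i} \<subseteq> {..<N}"
    proof
      fix i assume "i \<in> {i. 0 < nu i}"
      then show "i \<in> {..<N}" using nu by (cases "N \<le> i") auto
    qed
  qed simp
  then have nu': "nu = count (Abs_multiset nu)" by simp
  have "\<forall>r\<ge>R. lmax r = 0" "\<forall>r\<ge>R. lmin r = 0" using R by (simp_all add: lmax_def lmin_def)
  then have "finite {x \<in> gt_pairs lmax mmax lmin mmin. pair_weight R x = nu}"
    using coeff_skew_schur_times(1)[OF skew_shape_max_min[OF shape], of R "Abs_multiset nu"] nu'
    unfolding lmax_def mmax_def lmin_def mmin_def by simp
  \<comment> \<open>An infinite set has cardinality 0 by convention, so the injection gives a bound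
    only for a finite target.\<close>
  then have "finite B" by (rule finite_subset[rotated]) (auto simp: B_def)
  then have "card A \<le> card B" using inj F by (intro card_inj_on_le[of F]) auto
  then show ?thesis by (simp add: yamanouchi_count_def A_def B_def)
qed

lemma partition_bound:
  assumes "is_partition lam" shows "\<exists>R. \<forall>r\<ge>R. lam r = 0"
proof -
  obtain R where "\<forall>r\<in>{j. lam j \<noteq> 0}. r < R"
    using assms finite_nat_set_iff_bounded[of "{j. lam j \<noteq> 0}"] by (auto simp: is_partition_def)
  then have "lam r = 0" if "R \<le> r" for r using that by (metis (mono_tags) mem_Collect_eq not_less)
  then show ?thesis by blast
qed

lemma skew_shape_bound: "skew_shape lam mu \<Longrightarrow> \<exists>R. \<forall>r\<ge>R. lam r = 0"
  by (simp add: skew_shape_def partition_bound)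

lemma two_skew_shapes_bound:
  assumes "skew_shape lam mu" "skew_shape lam' mu'"
  obtains R where "\<forall>r\<ge>R. lam r = 0" "\<forall>r\<ge>R. lam' r = 0"
proof -
  obtain R R' where "\<forall>r\<ge>R. lam r = 0" "\<forall>r\<ge>R'. lam' r = 0"
    using assms skew_shape_bound by meson
  then show ?thesis using that[of "max R R'"] by simp
qed

section \<open>The cone of Schur nonnegative series\<close>

lemma schur_nonneg_zero: "schur_nonneg 0"
  unfolding schur_nonneg_def by (intro exI[of _ "{}"]) simp

lemma schur_nonneg_add:
  assumes "schur_nonneg f" "schur_nonneg g" shows "schur_nonneg (f + g)"
proof -
  obtain P c where P: "finite P" "\<forall>nu\<in>P. is_partition nu \<and> 0 \<le> c nu"
    "f = (\<Sum>nu\<in>P. of_int (c nu) * schur nu)" using assms(1) by (auto simp: schur_nonneg_def)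
  obtain Q d where Q: "finite Q" "\<forall>nu\<in>Q. is_partition nu \<and> 0 \<le> d nu"
    "g = (\<Sum>nu\<in>Q. of_int (d nu) * schur nu)" using assms(2) by (auto simp: schur_nonneg_def)
  define c' where "c' nu = (if nu \<in> P then c nu else 0)" for nu
  define d' where "d' nu = (if nu \<in> Q then d nu else 0)" for nu
  have "f = (\<Sum>nu\<in>P \<union> Q. of_int (c' nu) * schur nu)"
    unfolding P(3) by (rule sum.mono_neutral_cong_left) (use P Q in \<open>auto simp: c'_def\<close>)
  moreover have "g = (\<Sum>nu\<in>P \<union> Q. of_int (d' nu) * schur nu)"
    unfolding Q(3) by (rule sum.mono_neutral_cong_left) (use P Q in \<open>auto simp: d'_def\<close>)
  ultimately have "f + g = (\<Sum>nu\<in>P \<union> Q. of_int (c' nu + d' nu) * schur nu)"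
    by (simp add: sum.distrib[symmetric] distrib_right)
  moreover have "\<forall>nu\<in>P \<union> Q. is_partition nu \<and> 0 \<le> c' nu + d' nu"
    using P(2) Q(2) by (auto simp: c'_def d'_def)
  ultimately show ?thesis unfolding schur_nonneg_def
    using P(1) Q(1) by (intro exI[of _ "P \<union> Q"] exI[of _ "\<lambda>nu. c' nu + d' nu"]) simp
qed

lemma schur_nonneg_sum: "(\<And>x. x \<in> A \<Longrightarrow> schur_nonneg (f x)) \<Longrightarrow> schur_nonneg (\<Sum>x\<in>A. f x)"
  by (induction A rule: infinite_finite_induct) (auto simp: schur_nonneg_zero schur_nonneg_add)

lemma schur_nonneg_scale:
  assumes "schur_nonneg f" "0 \<le> a" shows "schur_nonneg (of_int a * f)"
proof -
  obtain P c where P: "finite P" "\<forall>nu\<in>P. is_partition nu \<and> 0 \<le> c nu"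
    "f = (\<Sum>nu\<in>P. of_int (c nu) * schur nu)" using assms(1) by (auto simp: schur_nonneg_def)
  then have "of_int a * f = (\<Sum>nu\<in>P. of_int (a * c nu) * schur nu)"
    by (simp add: sum_distrib_left mult.assoc)
  then show ?thesis unfolding schur_nonneg_def
    using P(1,2) assms(2) by (intro exI[of _ P] exI[of _ "\<lambda>nu. a * c nu"]) simp
qed

lemma schur_nonneg_schur:
  assumes "is_partition nu" shows "schur_nonneg (schur nu)"
  unfolding schur_nonneg_def by (intro exI[of _ "{nu}"] exI[of _ "\<lambda>_. 1"]) (simp add: assms)

lemma schur_nonneg_skew_product:
  assumes "skew_shape lam mu" "skew_shape lam' mu'"
  shows "schur_nonneg (skew_schur lam mu * skew_schur lam' mu')"
proof -
  obtain R where R: "\<forall>r\<ge>R. lam r = 0" "\<forall>r\<ge>R. lam' r = 0"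
    using two_skew_shapes_bound[OF assms] .
  show ?thesis unfolding skew_schur_times_expansion[OF assms R]
    by (intro schur_nonneg_sum schur_nonneg_scale schur_nonneg_schur)
      (auto intro: is_partition_partitions_of)
qed

lemma schur_nonneg_skew_schur: "skew_shape lam mu \<Longrightarrow> schur_nonneg (skew_schur lam mu)"
  using schur_nonneg_skew_product[OF _ skew_shape_empty[OF is_partition_zero]]
  by (simp add: skew_schur_empty)

text \<open>By bilinearity it suffices to multiply two Schur functions, which are skew Schur
  functions with empty inner shape.\<close>

lemma schur_nonneg_mult:
  assumes "schur_nonneg f" "schur_nonneg g" shows "schur_nonneg (f * g)"
proof -
  obtain P c where P: "\<forall>nu\<in>P. is_partition nu \<and> 0 \<le> c nu"
    "f = (\<Sum>nu\<in>P. of_int (c nu) * schur nu)" using assms(1) by (auto simp: schur_nonneg_def)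
  obtain Q d where Q: "\<forall>nu\<in>Q. is_partition nu \<and> 0 \<le> d nu"
    "g = (\<Sum>nu\<in>Q. of_int (d nu) * schur nu)" using assms(2) by (auto simp: schur_nonneg_def)
  have "f * g = (\<Sum>nu\<in>P. \<Sum>ka\<in>Q. of_int (c nu * d ka) * (schur nu * schur ka))"
    unfolding P(2) Q(2) sum_product by (simp add: mult_ac)
  also have "schur_nonneg \<dots>"
    using P(1) Q(1) by (intro schur_nonneg_sum schur_nonneg_scale)
      (auto simp: schur_def intro: schur_nonneg_skew_product skew_shape_empty)
  finally show ?thesis .
qed

lemma schur_nonneg_one: "schur_nonneg 1"
  using schur_nonneg_skew_schur[OF skew_shape_empty[OF is_partition_zero]] by (simp add: skew_schur_empty)

lemma schur_nonneg_prod: "(\<And>x. x \<in> A \<Longrightarrow> schur_nonneg (f x)) \<Longrightarrow> schur_nonneg (\<Prod>x\<in>A. f x)"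
  by (induction A rule: infinite_finite_induct) (auto simp: schur_nonneg_one schur_nonneg_mult)

text \<open>Both products have the same degree, so their expansions run over the same partitions and
  are compared coefficient by coefficient.\<close>

theorem schur_nonneg_max_min:
  assumes shape: "skew_shape lam mu" "skew_shape lam' mu'"
  shows "schur_nonneg
    (skew_schur (\<lambda>r. max (lam r) (lam' r)) (\<lambda>r. max (mu r) (mu' r)) *
     skew_schur (\<lambda>r. min (lam r) (lam' r)) (\<lambda>r. min (mu r) (mu' r)) -
     skew_schur lam mu * skew_schur lam' mu')"
proof -
  obtain R where R: "\<forall>r\<ge>R. lam r = 0" "\<forall>r\<ge>R. lam' r = 0"
    using two_skew_shapes_bound[OF shape] .
  let ?lmax = "\<lambda>r. max (lam r) (lam' r)" and ?mmax = "\<lambda>r. max (mu r) (mu' r)"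
  let ?lmin = "\<lambda>r. min (lam r) (lam' r)" and ?mmin = "\<lambda>r. min (mu r) (mu' r)"
  have R': "\<forall>r\<ge>R. ?lmax r = 0" "\<forall>r\<ge>R. ?lmin r = 0" using R by simp_all
  have "max a b + min a b = a + b" for a b :: nat by simp
  then have size: "pair_size R ?lmax ?mmax ?lmin ?mmin = pair_size R lam mu lam' mu'"
    by (simp only: pair_size_def)
  have "yamanouchi_count R lam mu lam' mu' nu \<le> yamanouchi_count R ?lmax ?mmax ?lmin ?mmin nu"
    if "nu \<in> partitions_of d" for nu d
    using that by (intro yamanouchi_count_le[OF shape R, of d]) (simp add: partitions_of_def)
  then show ?thesis
    unfolding skew_schur_times_expansion[OF shape R]
      skew_schur_times_expansion[OF skew_shape_max_min[OF shape] R'] size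
      sum_subtractf[symmetric] left_diff_distrib[symmetric] of_int_diff[symmetric]
    by (intro schur_nonneg_sum schur_nonneg_scale schur_nonneg_schur)
      (auto intro: is_partition_partitions_of)
qed

section \<open>Moves with a shift by one row\<close>

text \<open>Prepending the same \<open>b\<close> to the outer and the inner partition inserts an
  empty row on top, lowering the skew shape by one row.\<close>

definition prepend :: "'a \<Rightarrow> (nat \<Rightarrow> 'a) \<Rightarrow> nat \<Rightarrow> 'a" where
  "prepend b a r = (case r of 0 \<Rightarrow> b | Suc r' \<Rightarrow> a r')"

lemma prepend_simps [simp]: "prepend b a 0 = b" "prepend b a (Suc r) = a r"
  by (simp_all add: prepend_def)

lemma prepend_eqI: "f 0 = b \<Longrightarrow> (\<And>r. f (Suc r) = a r) \<Longrightarrow> f = prepend b a"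
  by (rule ext) (simp add: prepend_def split: nat.split)

lemma is_partition_prepend:
  assumes a: "is_partition a" and b: "a 0 \<le> b" shows "is_partition (prepend b a)"
proof -
  have "{j. prepend b a j \<noteq> 0} \<subseteq> insert 0 (Suc ` {j. a j \<noteq> 0})"
  proof
    fix j assume "j \<in> {j. prepend b a j \<noteq> 0}"
    then show "j \<in> insert 0 (Suc ` {j. a j \<noteq> 0})" by (cases j) auto
  qed
  then have "finite {j. prepend b a j \<noteq> 0}"
    by (rule finite_subset) (use a in \<open>simp add: is_partition_def\<close>)
  moreover have "prepend b a (Suc r) \<le> prepend b a r" for r
    using a b by (cases r) (simp_all add: is_partition_def antimono_iff_le_Suc)
  ultimately show ?thesis by (simp add: is_partition_def antimono_iff_le_Suc)
qed

lemma skew_shape_prepend: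
  assumes "skew_shape lam mu" and b: "lam 0 \<le> b"
  shows "skew_shape (prepend b lam) (prepend b mu)"
proof -
  have "mu 0 \<le> b" using assms order_trans by (auto simp: skew_shape_def)
  moreover have "prepend b mu r \<le> prepend b lam r" for r
    using assms(1) by (cases r) (simp_all add: skew_shape_def)
  ultimately show ?thesis using assms by (simp add: skew_shape_def is_partition_prepend)
qed

lemma gt_weight_prepend: "gt_weight (Suc R) (\<lambda>t. prepend b (g t)) = gt_weight R g"
  by (rule ext) (simp add: gt_weight_def sum.lessThan_Suc_shift del: sum.lessThan_Suc)

text \<open>Inner and outer shape agree in the new row, so it is frozen;
  \<open>lam 0 \<le> b\<close> gives the strip condition between it and the next row.\<close>

lemma gt_chain_prepend_iff:
  assumes b: "lam 0 \<le> b"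
  shows "gt_chain (prepend b lam) (prepend b mu) f \<longleftrightarrow>
    (\<exists>g. f = (\<lambda>t. prepend b (g t)) \<and> gt_chain lam mu g)"
proof
  assume f: "gt_chain (prepend b lam) (prepend b mu) f"
  define g where "g t r = f t (Suc r)" for t r
  have "f t 0 = b" for t
    using gt_chain_inner_le[OF f, of 0 t] gt_chain_le_outer[OF f, of t 0] by simp
  then have eq: "f t = prepend b (g t)" for t by (rule prepend_eqI) (simp add: g_def)
  obtain N where N: "\<forall>t\<ge>N. f t = prepend b lam" using f by (auto simp: gt_chain_def)
  have "g t = lam" if "N \<le> t" for t using N that by (simp add: g_def fun_eq_iff)
  moreover have "g 0 = mu" using f by (simp add: g_def fun_eq_iff gt_chain_def)
  ultimately have "gt_chain lam mu g"
    using gt_chain_step[OF f] unfolding gt_chain_def g_def by blast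
  then show "\<exists>g. f = (\<lambda>t. prepend b (g t)) \<and> gt_chain lam mu g" using eq by blast
next
  assume "\<exists>g. f = (\<lambda>t. prepend b (g t)) \<and> gt_chain lam mu g"
  then obtain g where eq: "f = (\<lambda>t. prepend b (g t))" and g: "gt_chain lam mu g" by blast
  have "prepend b (g t) r \<le> prepend b (g (Suc t)) r" for t r
    using gt_chain_step(1)[OF g] by (cases r) simp_all
  moreover have "prepend b (g (Suc t)) (Suc r) \<le> prepend b (g t) r" for t r
    using gt_chain_step(2)[OF g] gt_chain_le_outer[OF g, of "Suc t" 0] b by (cases r) simp_all
  moreover have "\<exists>N. \<forall>t\<ge>N. g t = lam" "g 0 = mu" using g by (simp_all add: gt_chain_def)
  ultimately show "gt_chain (prepend b lam) (prepend b mu) f"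
    unfolding gt_chain_def eq by metis
qed

lemma skew_schur_prepend:
  assumes shape: "skew_shape lam mu" and b: "lam 0 \<le> b"
  shows "skew_schur (prepend b lam) (prepend b mu) = skew_schur lam mu"
proof (rule series_eqI)
  fix m
  obtain R where R: "\<forall>r\<ge>R. lam r = 0" using skew_shape_bound[OF shape] by blast
  then have R': "\<forall>r\<ge>Suc R. prepend b lam r = 0" by (simp add: prepend_def split: nat.split)
  let ?f = "\<lambda>(g :: nat \<Rightarrow> nat \<Rightarrow> nat) t. prepend b (g t)"
  have "inj ?f"
  proof (rule injI)
    fix g h assume "?f g = ?f h"
    then have "prepend b (g t) (Suc r) = prepend b (h t) (Suc r)" for t r by metis
    then show "g = h" by (simp add: fun_eq_iff)
  qed
  moreover have "{f. gt_chain (prepend b lam) (prepend b mu) f \<and> gt_weight (Suc R) f = count m} =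
      ?f ` {g. gt_chain lam mu g \<and> gt_weight R g = count m}"
    unfolding gt_chain_prepend_iff[where lam = lam and b = b, OF b] using gt_weight_prepend by (auto simp: image_iff)
  ultimately show "series_coeff (skew_schur (prepend b lam) (prepend b mu)) m =
      series_coeff (skew_schur lam mu) m"
    unfolding coeff_skew_schur[OF shape R] coeff_skew_schur[OF skew_shape_prepend[OF shape b] R']
    by (simp add: card_image inj_on_subset[of _ UNIV])
qed

text \<open>
  The two moves compare the part at position \<open>i + r n\<close> of the merged sequence, taken from \<open>a\<close>,
  with the part at position \<open>i' + r n\<close> resp. \<open>i' + (r - 1) n\<close>, taken from \<open>b\<close>, where \<open>i < i'\<close>.
\<close>

definition move :: "bool \<Rightarrow> (nat \<Rightarrow> nat) \<Rightarrow> (nat \<Rightarrow> nat) \<Rightarrow> (nat \<Rightarrow> nat) \<times> (nat \<Rightarrow> nat)" where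
  "move s a b = (if s
     then (prepend (a 0) (\<lambda>r. min (a (Suc r)) (b r)), \<lambda>r. max (a (Suc r)) (b r))
     else (\<lambda>r. max (a r) (b r), \<lambda>r. min (a r) (b r)))"

text \<open>This is where the shifted \<open>move\<close> comes from: \<open>b\<close> is lowered by
  one row under a part \<open>c\<close>. The minimum becomes the new first partition; the maximum
  begins with \<open>c\<close> and is raised again to become the second.\<close>

lemma prepend_max_min:
  fixes a b :: "nat \<Rightarrow> nat"
  assumes "a 0 \<le> c"
  shows "(\<lambda>r. max (a r) (prepend c b r)) = prepend c (\<lambda>r. max (a (Suc r)) (b r))"
    and "(\<lambda>r. min (a r) (prepend c b r)) = prepend (a 0) (\<lambda>r. min (a (Suc r)) (b r))"
  using assms by (auto intro!: prepend_eqI)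

lemma is_partition_tail:
  assumes "is_partition (prepend c a)" shows "is_partition a"
proof -
  have "finite (Suc -` {j. prepend c a j \<noteq> 0})"
    using assms by (intro finite_vimageI) (simp_all add: is_partition_def)
  then have "finite {j. a j \<noteq> 0}" by (simp add: vimage_def)
  moreover have "a (Suc r) \<le> a r" for r
    using assms antimonoD[of "prepend c a" "Suc r" "Suc (Suc r)"] by (simp add: is_partition_def)
  ultimately show ?thesis by (simp add: is_partition_def antimono_iff_le_Suc)
qed

lemma skew_shape_tail:
  assumes "skew_shape (prepend c a) (prepend d b)" shows "skew_shape a b"
proof -
  have "b r \<le> a r" for r using assms by (metis skew_shape_def prepend_simps(2))
  then show ?thesis using assms is_partition_tail by (auto simp: skew_shape_def)
qed

lemma move_schur:
  assumes shape: "skew_shape lam mu" "skew_shape lam' mu'"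
  shows "skew_shape (fst (move s lam lam')) (fst (move s mu mu'))"
    and "skew_shape (snd (move s lam lam')) (snd (move s mu mu'))"
    and "schur_nonneg
      (skew_schur (fst (move s lam lam')) (fst (move s mu mu')) *
       skew_schur (snd (move s lam lam')) (snd (move s mu mu')) -
       skew_schur lam mu * skew_schur lam' mu')"
proof -
  \<comment> \<open>One \<open>c\<close> has to serve outer and inner partitions alike, so that the
    top row of the maximum is empty as well and can be removed.\<close>
  define c where "c = max (lam 0) (lam' 0)"
  have c: "lam 0 \<le> c" "lam' 0 \<le> c" "mu 0 \<le> c"
    using shape order_trans[of "mu 0" "lam 0" c] by (auto simp: c_def skew_shape_def)
  note p = skew_shape_prepend[OF shape(2) c(2)]
  note mm = prepend_max_min[of lam, OF c(1)] prepend_max_min[of mu, OF c(3)]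
  note sh = skew_shape_max_min[OF shape(1) p, unfolded mm]
  have t: "skew_shape (\<lambda>r. max (lam (Suc r)) (lam' r)) (\<lambda>r. max (mu (Suc r)) (mu' r))"
    by (rule skew_shape_tail[OF sh(1)])
  show "skew_shape (fst (move s lam lam')) (fst (move s mu mu'))"
    using sh(2) skew_shape_max_min(1)[OF shape] by (simp add: move_def)
  show "skew_shape (snd (move s lam lam')) (snd (move s mu mu'))"
    using t skew_shape_max_min(2)[OF shape] by (simp add: move_def)
  have "lam (Suc 0) \<le> c"
    using shape(1) c(1) antimonoD[of lam 0 "Suc 0"] by (simp add: skew_shape_def is_partition_def)
  then have "max (lam (Suc 0)) (lam' 0) \<le> c" using c by simp
  then have "skew_schur (prepend c (\<lambda>r. max (lam (Suc r)) (lam' r))) (prepend c (\<lambda>r. max (mu (Suc r)) (mu' r))) =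
      skew_schur (\<lambda>r. max (lam (Suc r)) (lam' r)) (\<lambda>r. max (mu (Suc r)) (mu' r))"
    by (rule skew_schur_prepend[OF t])
  then show "schur_nonneg
      (skew_schur (fst (move s lam lam')) (fst (move s mu mu')) *
       skew_schur (snd (move s lam lam')) (snd (move s mu mu')) -
       skew_schur lam mu * skew_schur lam' mu')"
    using schur_nonneg_max_min[OF shape] schur_nonneg_max_min[OF shape(1) p, unfolded mm]
    by (simp add: move_def skew_schur_prepend[OF shape(2) c(2)] mult.commute)
qed

section \<open>Parts and ranks under a move\<close>

lemma count_parts:
  assumes R: "\<forall>r\<ge>R. a r = 0"
  shows "count (parts a) v = (\<Sum>r<R. of_bool (a r = v \<and> v \<noteq> 0))"
proof -
  have sub: "{j. a j \<noteq> 0} \<subseteq> {..<R}"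
  proof
    fix j assume "j \<in> {j. a j \<noteq> 0}"
    then show "j \<in> {..<R}" using R by (cases "R \<le> j") auto
  qed
  then have fin: "finite {j. a j \<noteq> 0}" by (rule finite_subset) simp
  then have "count (parts a) v = card ({j. a j \<noteq> 0} \<inter> {j. v = a j})"
    by (simp add: parts_def count_image_mset' Collect_conj_eq)
  also have "{j. a j \<noteq> 0} \<inter> {j. v = a j} = {r \<in> {..<R}. a r = v \<and> v \<noteq> 0}"
    using sub by auto
  also have "card \<dots> = (\<Sum>r<R. of_bool (a r = v \<and> v \<noteq> 0))" by (simp add: Int_def)
  finally show ?thesis .
qed

context
  fixes R :: nat and a b :: "nat \<Rightarrow> nat"
  assumes R: "\<forall>r\<ge>R. a r = 0" "\<forall>r\<ge>R. b r = 0"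
begin

lemma move_bound:
  "\<forall>r\<ge>R. fst (move s a b) r = 0" "\<forall>r\<ge>R. snd (move s a b) r = 0"
proof -
  have "prepend (a 0) (\<lambda>r. min (a (Suc r)) (b r)) r = 0" if "R \<le> r" for r
    using R that by (cases r) simp_all
  then show "\<forall>r\<ge>R. fst (move s a b) r = 0" using R by (simp add: move_def)
  show "\<forall>r\<ge>R. snd (move s a b) r = 0" using R by (simp add: move_def)
qed

lemma parts_move: "parts (fst (move s a b)) + parts (snd (move s a b)) = parts a + parts b"
proof (rule multiset_eqI)
  fix v
  have R': "\<forall>r\<ge>Suc R. a r = 0" "\<forall>r\<ge>Suc R. fst (move s a b) r = 0" using R move_bound[of s] by simp_all
  have mm: "of_bool (min x y = v \<and> v \<noteq> 0) + of_bool (max x y = v \<and> v \<noteq> 0) =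
      (of_bool (x = v \<and> v \<noteq> 0) + of_bool (y = v \<and> v \<noteq> 0) :: nat)"
    "of_bool (max x y = v \<and> v \<noteq> 0) + of_bool (min x y = v \<and> v \<noteq> 0) =
      (of_bool (x = v \<and> v \<noteq> 0) + of_bool (y = v \<and> v \<noteq> 0) :: nat)" for x y :: nat
    by (auto simp: min_def max_def)
  show "count (parts (fst (move s a b)) + parts (snd (move s a b))) v = count (parts a + parts b) v"
  proof (cases s)
    case True
    then show ?thesis
      unfolding count_union count_parts[OF R'(1)] count_parts[OF R'(2)] count_parts[OF R(2)]
        count_parts[OF move_bound(2)] sum.lessThan_Suc_shift
      by (simp only: move_def if_True fst_conv snd_conv prepend_simps add.assoc sum.distrib[symmetric] mm)
  next
    case False
    then show ?thesis
      unfolding count_union count_parts[OF R(1)] count_parts[OF R(2)]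
        count_parts[OF move_bound(1)] count_parts[OF move_bound(2)] sum.distrib[symmetric]
      by (simp only: move_def if_False fst_conv snd_conv mm)
  qed
qed

end

text \<open>Each part is weighted with its position in the merged sequence, so the total over all
  \<open>i\<close> drops when a larger part moves to an earlier position.\<close>

definition rank :: "nat \<Rightarrow> nat \<Rightarrow> nat \<Rightarrow> (nat \<Rightarrow> nat) \<Rightarrow> nat" where
  "rank n R i a = (\<Sum>r<R. (i + r * n) * a r)"

lemma weighted_max_min:
  fixes x y p q :: nat
  assumes "p < q"
  shows "p * max x y + q * min x y \<le> p * x + q * y"
    and "x < y \<Longrightarrow> p * max x y + q * min x y < p * x + q * y"
proof -
  obtain d where q: "q = p + Suc d" using less_imp_Suc_add[OF assms] by auto
  show less: "x < y \<Longrightarrow> p * max x y + q * min x y < p * x + q * y"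
  proof -
    assume "x < y"
    then obtain e where "y = x + Suc e" using less_imp_Suc_add by auto
    then show ?thesis by (simp add: q max_def min_def algebra_simps)
  qed
  show "p * max x y + q * min x y \<le> p * x + q * y"
  proof (cases "x < y")
    case True
    then show ?thesis using less by simp
  qed (simp add: max_def min_def)
qed

lemma rank_move:
  assumes i: "i < i'" "i' < n" and R: "\<forall>r\<ge>R. a r = 0" "\<forall>r\<ge>R. b r = 0"
  shows "rank n R i (fst (move s a b)) + rank n R i' (snd (move s a b)) \<le> rank n R i a + rank n R i' b"
    and "move s a b \<noteq> (a, b) \<Longrightarrow>
      rank n R i (fst (move s a b)) + rank n R i' (snd (move s a b)) < rank n R i a + rank n R i' b"
proof -
  \<comment> \<open>In the shifted move \<open>a (Suc r)\<close> is compared with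
    \<open>b r\<close>; the part \<open>a 0\<close> has no partner and is split off as
    \<open>Z\<close>.\<close>
  define T where "T = (\<lambda>(u, v) r. if s then (i + Suc r * n) * u (Suc r) + (i' + r * n) * v r
    else (i + r * n) * u r + (i' + r * n) * (v r :: nat))"
  define Z where "Z = (\<lambda>(u :: nat \<Rightarrow> nat). if s then i * u 0 else 0)"
  have split: "rank n R i u + rank n R i' v = Z u + (\<Sum>r<R. T (u, v) r)" if "u R = 0" for u v
  proof (cases s)
    case True
    have "rank n R i u = (\<Sum>r<Suc R. (i + r * n) * u r)" using that by (simp add: rank_def)
    also have "\<dots> = i * u 0 + (\<Sum>r<R. (i + Suc r * n) * u (Suc r))"
      by (subst sum.lessThan_Suc_shift) simp
    finally show ?thesis using True by (simp add: rank_def T_def Z_def sum.distrib)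
  next
    case False
    then show ?thesis by (simp add: rank_def T_def Z_def sum.distrib)
  qed
  have zero: "a R = 0" "fst (move s a b) R = 0" using R move_bound(1)[OF R] by simp_all
  note split1 = split[where u = a and v = b, OF zero(1)]
  note split2 = split[where u = "fst (move s a b)" and v = "snd (move s a b)", OF zero(2),
      unfolded prod.collapse]
  \<comment> \<open>Positions of the two sequences alternate: the first inequality rests on
    \<open>i' < n\<close>, the second on \<open>i < i'\<close>.\<close>
  have less: "i' + r * n < i + Suc r * n" "i + r * n < i' + r * n" for r using i by simp_all
  have Z: "Z (fst (move s a b)) = Z a" by (simp add: Z_def move_def)
  have T: "T (move s a b) r \<le> T (a, b) r" for r
    using weighted_max_min(1)[OF less(1)[of r], of "b r" "a (Suc r)"]
      weighted_max_min(1)[OF less(2)[of r], of "a r" "b r"]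
    by (simp add: T_def move_def max.commute min.commute add.commute)
  have le: "(\<Sum>r<R. T (move s a b) r) \<le> (\<Sum>r<R. T (a, b) r)" by (rule sum_mono) (rule T)
  show "rank n R i (fst (move s a b)) + rank n R i' (snd (move s a b)) \<le> rank n R i a + rank n R i' b"
    unfolding split1 split2 Z using le by simp
  assume ne: "move s a b \<noteq> (a, b)"
  have "\<exists>r. if s then b r < a (Suc r) else a r < b r"
  proof (rule ccontr)
    assume "\<not> ?thesis"
    then have "if s then a (Suc r) \<le> b r else b r \<le> a r" for r by (auto simp: not_less)
    then have "move s a b = (a, b)"
      by (cases s) (auto simp: move_def max_absorb1 max_absorb2 min_absorb1 min_absorb2 intro!: prepend_eqI[symmetric])
    then show False using ne by blast
  qed
  then obtain r where r: "if s then b r < a (Suc r) else a r < b r" by blast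
  have "r < R"
  proof (rule ccontr)
    assume "\<not> r < R"
    then have "R \<le> r" "R \<le> Suc r" by simp_all
    then show False using r R by (cases s) auto
  qed
  moreover have "T (move s a b) r < T (a, b) r"
    using r weighted_max_min(2)[OF less(1)[of r], of "b r" "a (Suc r)"]
      weighted_max_min(2)[OF less(2)[of r], of "a r" "b r"]
    by (cases s) (simp_all add: T_def move_def max.commute min.commute add.commute)
  ultimately have "(\<Sum>r<R. T (move s a b) r) < (\<Sum>r<R. T (a, b) r)"
    using T by (intro sum_strict_mono_ex1) auto
  then show "rank n R i (fst (move s a b)) + rank n R i' (snd (move s a b)) < rank n R i a + rank n R i' b"
    unfolding split1 split2 Z by simp
qed

section \<open>Sorting the merged sequence\<close>

lemma partition_of_parts_parts:
  assumes x: "is_partition x" shows "partition_of_parts (parts x) = x"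
proof -
  obtain R where R: "\<forall>r\<ge>R. x r = 0" using partition_bound[OF x] by blast
  define L where "L = (LEAST l. x l = 0)"
  have "x R = 0" using R by simp
  then have L: "x L = 0" unfolding L_def by (rule LeastI)
  have anti: "antimono x" using x by (simp add: is_partition_def)
  have support: "{j. x j \<noteq> 0} = {..<L}"
  proof (intro equalityI subsetI)
    fix j assume "j \<in> {j. x j \<noteq> 0}"
    then show "j \<in> {..<L}" using L antimonoD[OF anti, of L j] by (cases "L \<le> j") auto
  next
    fix j assume "j \<in> {..<L}"
    then show "j \<in> {j. x j \<noteq> 0}" using not_less_Least[of j "\<lambda>l. x l = 0"] by (simp add: L_def)
  qed
  let ?l = "map x [0..<L]"
  have "parts x = mset ?l"
    unfolding parts_def support by (simp add: lessThan_atLeast0 flip: mset_upt)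
  moreover have "sort ?l = rev ?l"
  proof (rule properties_for_sort)
    show "sorted (rev ?l)"
      unfolding sorted_rev_iff_nth_mono using antimonoD[OF anti] by simp
  qed simp
  ultimately have "rev (sorted_list_of_multiset (parts x)) = ?l"
    by (simp only: sorted_list_of_multiset_mset rev_rev_ident)
  moreover have "x j = 0" if "\<not> j < L" for j using that support by blast
  ultimately show ?thesis by (intro ext) (simp add: partition_of_parts_def Let_def)
qed

definition merge :: "nat \<Rightarrow> (nat \<Rightarrow> nat \<Rightarrow> nat) \<Rightarrow> nat \<Rightarrow> nat" where
  "merge n lams m = lams (m mod n) (m div n)"

lemma parts_merge:
  assumes n: "0 < n" and R: "\<forall>i<n. \<forall>r\<ge>R. lams i r = 0"
  shows "(\<Sum>i<n. parts (lams i)) = parts (merge n lams)"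
proof (rule multiset_eqI)
  fix v
  have bound: "\<forall>m\<ge>n * R. merge n lams m = 0"
  proof (intro allI impI)
    fix m assume "n * R \<le> m"
    then have "R \<le> m div n" using n by (simp add: less_eq_div_iff_mult_less_eq mult.commute)
    then show "merge n lams m = 0" using R n by (simp add: merge_def)
  qed
  have "count (\<Sum>i<n. parts (lams i)) v = (\<Sum>i<n. \<Sum>r<R. of_bool (lams i r = v \<and> v \<noteq> 0))"
    unfolding count_sum by (rule sum.cong[OF refl], rule count_parts) (use R in simp)
  also have "\<dots> = (\<Sum>(i, r)\<in>{..<n} \<times> {..<R}. of_bool (lams i r = v \<and> v \<noteq> 0))"
    by (rule sum.cartesian_product)
  also have "\<dots> = (\<Sum>m<n * R. of_bool (merge n lams m = v \<and> v \<noteq> 0))"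
  proof (rule sum.reindex_bij_witness[where j = "\<lambda>(i, r). i + n * r" and i = "\<lambda>m. (m mod n, m div n)"])
    fix x assume x: "x \<in> {..<n} \<times> {..<R}"
    then obtain i r where ir: "x = (i, r)" "i < n" "r < R" by auto
    have "i + n * r < n * Suc r" using ir by simp
    also have "\<dots> \<le> n * R" using ir by (intro mult_le_mono2) simp
    finally show "(case x of (i, r) \<Rightarrow> i + n * r) \<in> {..<n * R}" using ir by simp
  next
    fix m assume "m \<in> {..<n * R}"
    then show "(m mod n, m div n) \<in> {..<n} \<times> {..<R}"
      using n by (simp add: less_mult_imp_div_less mult.commute)
  qed (auto simp: merge_def)
  also have "\<dots> = count (parts (merge n lams)) v" by (simp add: count_parts[OF bound])
  finally show "count (\<Sum>i<n. parts (lams i)) v = count (parts (merge n lams)) v" .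
qed

text \<open>Neighbours in the merged sequence are either in the same row of two consecutive
  sequences, or the last sequence is followed by the first one in the next row. Stability under the
  plain and the shifted move orders them, so the merged sequence is already the union.\<close>

lemma every_nth_sorted:
  assumes lams: "\<And>i. i < n \<Longrightarrow> is_partition (lams i)"
    and R: "\<forall>i<n. \<forall>r\<ge>R. lams i r = 0"
    and stable: "\<And>i i' s. i < i' \<Longrightarrow> i' < n \<Longrightarrow> move s (lams i) (lams i') = (lams i, lams i')"
    and i: "i < n"
  shows "every_nth (partition_union n lams) i n = lams i"
proof -
  have n: "0 < n" using i by simp
  have desc: "lams i' r \<le> lams i r" "lams i (Suc r) \<le> lams i' r" if "i < i'" "i' < n" for i i' r
  proof -
    have "max (lams i r) (lams i' r) = lams i r"
      using stable[OF that, of False] unfolding move_def by (auto dest: fun_cong)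
    then show "lams i' r \<le> lams i r" by (metis max.cobounded2)
    have "max (lams i (Suc r)) (lams i' r) = lams i' r"
      using stable[OF that, of True] unfolding move_def by (auto dest: fun_cong)
    then show "lams i (Suc r) \<le> lams i' r" by (metis max.cobounded1)
  qed
  have "merge n lams (Suc m) \<le> merge n lams m" for m
  proof (cases "Suc (m mod n) = n")
    case False
    then have "Suc m mod n = Suc (m mod n)" "Suc m div n = m div n"
      by (simp_all add: mod_Suc div_Suc)
    moreover have "Suc (m mod n) < n" using False n mod_less_divisor[of n m] by linarith
    ultimately show ?thesis using desc(1) by (simp add: merge_def)
  next
    case True
    then have m: "Suc m mod n = 0" "Suc m div n = Suc (m div n)"
      by (simp_all add: mod_Suc div_Suc)
    show ?thesis
    proof (cases "m mod n = 0")
      case True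
      \<comment> \<open>Here \<open>n = 1\<close>, and the neighbours belong to the same
        partition.\<close>
      then show ?thesis using lams[OF n] m
        by (simp add: merge_def is_partition_def antimono_iff_le_Suc)
    next
      case False
      then show ?thesis using desc(2)[of 0 "m mod n"] n m by (simp add: merge_def)
    qed
  qed
  moreover have "{m. merge n lams m \<noteq> 0} \<subseteq> {..<n * R}"
  proof
    fix m assume "m \<in> {m. merge n lams m \<noteq> 0}"
    then have "m div n < R" using R n by (cases "R \<le> m div n") (auto simp: merge_def)
    then show "m \<in> {..<n * R}" using n by (simp add: div_less_iff_less_mult mult.commute)
  qed
  then have "finite {m. merge n lams m \<noteq> 0}" by (rule finite_subset) simp
  ultimately have "is_partition (merge n lams)" by (simp add: is_partition_def antimono_iff_le_Suc)
  then have "partition_union n lams = merge n lams"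
    by (simp add: partition_union_def parts_merge[OF n R] partition_of_parts_parts)
  then show ?thesis using i by (simp add: every_nth_def merge_def fun_eq_iff)
qed

lemma sum_fun_upd2:
  fixes f :: "nat \<Rightarrow> 'a \<Rightarrow> 'b :: comm_monoid_add"
  assumes "i < i'" "i' < n"
  shows "(\<Sum>k<n. f k ((g(i := x, i' := y)) k)) + (f i (g i) + f i' (g i')) =
    (\<Sum>k<n. f k (g k)) + (f i x + f i' y)"
proof -
  have set: "{..<n} = insert i (insert i' ({..<n} - {i, i'}))" using assms by auto
  have "(\<Sum>k<n. f k (h k)) = f i (h i) + (f i' (h i') + (\<Sum>k\<in>{..<n} - {i, i'}. f k (h k)))" for h
    by (subst set) (use assms in simp)
  note split = this
  have "(\<Sum>k\<in>{..<n} - {i, i'}. f k ((g(i := x, i' := y)) k)) = (\<Sum>k\<in>{..<n} - {i, i'}. f k (g k))"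
    by (rule sum.cong) auto
  then show ?thesis unfolding split[of "g(i := x, i' := y)"] split[of g] using assms by (simp add: add_ac)
qed

lemma prod_split2:
  fixes f :: "nat \<Rightarrow> 'b :: comm_monoid_mult"
  assumes "i < i'" "i' < n"
  shows "(\<Prod>k<n. f k) = f i * f i' * (\<Prod>k\<in>{..<n} - {i, i'}. f k)"
proof -
  have set: "{..<n} = insert i (insert i' ({..<n} - {i, i'}))" using assms by auto
  show ?thesis by (subst set) (use assms in \<open>simp add: mult.assoc\<close>)
qed

theorem theorem4p3:
  fixes n :: nat
    and lam mu :: "nat \<Rightarrow> nat \<Rightarrow> nat"
  assumes "\<And>i. i < n \<Longrightarrow> skew_shape (lam i) (mu i)"
  shows "schur_nonneg
    ((\<Prod>i<n. skew_schur (every_nth (partition_union n lam) i n)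
                         (every_nth (partition_union n mu) i n))
     - (\<Prod>i<n. skew_schur (lam i) (mu i)))"
proof -
  have "\<exists>R. \<forall>i<n. \<forall>r\<ge>R. lam i r = 0"
  proof -
    obtain f where f: "\<forall>i<n. \<forall>r\<ge>f i. lam i r = 0" using skew_shape_bound[OF assms] by metis
    have "f i \<le> (\<Sum>k<n. f k)" if "i < n" for i using that by (intro member_le_sum) auto
    then show ?thesis using f order_trans by blast
  qed
  then obtain R where R: "\<forall>i<n. \<forall>r\<ge>R. lam i r = 0" by blast
  \<comment> \<open>A move acts on outer and inner partitions at once. Neither total increases, and
    one of them drops whenever something changes, so their sum is the induction measure.\<close>
  let ?w = "\<lambda>lams. \<Sum>i<n. rank n R i (lams i)"
  show ?thesis using assms R
  proof (induction "?w lam + ?w mu" arbitrary: lam mu rule: less_induct)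
    case less
    note shape = less.prems(1) and Rl = less.prems(2)
    have Rm: "\<forall>i<n. \<forall>r\<ge>R. mu i r = 0"
      using shape Rl unfolding skew_shape_def by (metis le_zero_eq)
    show ?case
    proof (cases "\<exists>i i' s. i < i' \<and> i' < n \<and>
        (move s (lam i) (lam i') \<noteq> (lam i, lam i') \<or> move s (mu i) (mu i') \<noteq> (mu i, mu i'))")
      case False
      then have "every_nth (partition_union n lam) i n = lam i \<and>
          every_nth (partition_union n mu) i n = mu i" if "i < n" for i
        using every_nth_sorted[of n lam R i] every_nth_sorted[of n mu R i] shape Rl Rm that
        by (auto simp: skew_shape_def)
      then show ?thesis by (simp add: schur_nonneg_zero)
    next
      case True
      then obtain i i' s where i: "i < i'" "i' < n"
        and ne: "move s (lam i) (lam i') \<noteq> (lam i, lam i') \<or> move s (mu i) (mu i') \<noteq> (mu i, mu i')"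
        by blast
      have bounds: "\<forall>r\<ge>R. lam i r = 0" "\<forall>r\<ge>R. lam i' r = 0" "\<forall>r\<ge>R. mu i r = 0" "\<forall>r\<ge>R. mu i' r = 0"
        using Rl Rm i by simp_all
      have sh: "skew_shape (lam i) (mu i)" "skew_shape (lam i') (mu i')" using shape i by simp_all
      define upd where "upd lams = lams(i := fst (move s (lams i) (lams i')), i' := snd (move s (lams i) (lams i')))"
        for lams :: "nat \<Rightarrow> nat \<Rightarrow> nat"
      have upd: "upd lams i = fst (move s (lams i) (lams i'))" "upd lams i' = snd (move s (lams i) (lams i'))"
        "k \<noteq> i \<Longrightarrow> k \<noteq> i' \<Longrightarrow> upd lams k = lams k" for lams k
        using i by (simp_all add: upd_def)
      have weight: "?w (upd lams) + (rank n R i (lams i) + rank n R i' (lams i')) =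
          ?w lams + (rank n R i (fst (move s (lams i) (lams i'))) +
            rank n R i' (snd (move s (lams i) (lams i'))))" for lams
        unfolding upd_def by (rule sum_fun_upd2[OF i, where f = "\<lambda>k. rank n R k"])
      have "?w (upd lam) + ?w (upd mu) < ?w lam + ?w mu"
        using ne weight[of lam] weight[of mu]
          rank_move[OF i bounds(1,2), of s] rank_move[OF i bounds(3,4), of s] by linarith
      moreover have "skew_shape (upd lam k) (upd mu k)" if "k < n" for k
        using move_schur(1,2)[OF sh, of s] shape[OF that] upd by (cases "k = i"; cases "k = i'") simp_all
      moreover have "\<forall>k<n. \<forall>r\<ge>R. upd lam k r = 0"
      proof (intro allI impI)
        fix k r assume "k < n" "R \<le> r"
        then show "upd lam k r = 0"
          using move_bound[OF bounds(1,2), of s] Rl upd by (cases "k = i"; cases "k = i'") simp_all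
      qed
      ultimately have IH: "schur_nonneg
        ((\<Prod>k<n. skew_schur (every_nth (partition_union n (upd lam)) k n)
                             (every_nth (partition_union n (upd mu)) k n))
         - (\<Prod>k<n. skew_schur (upd lam k) (upd mu k)))"
        by (rule less.hyps)
      have union: "partition_union n (upd lams) = partition_union n lams"
        if "\<forall>r\<ge>R. lams i r = 0" "\<forall>r\<ge>R. lams i' r = 0" for lams
      proof -
        have "(\<Sum>k<n. parts (upd lams k)) + (parts (lams i) + parts (lams i')) =
            (\<Sum>k<n. parts (lams k)) + (parts (lams i) + parts (lams i'))"
          using sum_fun_upd2[OF i, where f = "\<lambda>_. parts" and g = lams] parts_move[OF that, of s]
          unfolding upd_def by metis
        then show ?thesis by (simp add: partition_union_def)
      qed
      let ?rest = "\<Prod>k\<in>{..<n} - {i, i'}. skew_schur (lam k) (mu k)"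
      have rest: "(\<Prod>k\<in>{..<n} - {i, i'}. skew_schur (upd lam k) (upd mu k)) = ?rest"
        using upd(3) by (intro prod.cong) auto
      have "schur_nonneg ?rest"
        using shape by (intro schur_nonneg_prod schur_nonneg_skew_schur) simp
      then have "schur_nonneg ((skew_schur (upd lam i) (upd mu i) * skew_schur (upd lam i') (upd mu i') -
          skew_schur (lam i) (mu i) * skew_schur (lam i') (mu i')) * ?rest)"
        using move_schur(3)[OF sh, of s] unfolding upd by (intro schur_nonneg_mult)
      then have "schur_nonneg ((\<Prod>k<n. skew_schur (upd lam k) (upd mu k)) - (\<Prod>k<n. skew_schur (lam k) (mu k)))"
        unfolding prod_split2[OF i] rest left_diff_distrib .
      from schur_nonneg_add[OF IH this] show ?thesis
        by (simp add: union[OF bounds(1,2)] union[OF bounds(3,4)])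
    qed
  qed
qed

end
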